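(* Let $\nu_0$ denote the $\delta$-measure at the point $(1,0,0,\ldots)\in\Sigma_1$, let $T$ be the split-merge Markov operator on $\Sigma_1$ and let $E$ be the identity operator, both regarded as operators on the space of Borel probability measures on $\Sigma_1$. Then the sequence of probability measures $$\left(\frac{E+T}{2}\right)^m\nu_0$$ converges weakly as $m\to\infty$ to the Poisson--Dirichlet measure $PD(1)$.
   Context: $\Sigma_1=\{x=(x_1,x_2,\ldots): x_1\ge x_2\ge\ldots\ge 0,\ \sum_{i=1}^\infty x_i=1\}$ is the infinite-dimensional simplex of non-increasing non-negative sequences with sum one, with the topology of coordinatewise convergence (and its Borel $\sigma$-algebra). Poisson--Dirichlet measure $PD(1)$: let $U_1,U_2,\ldots$ be i.i.d. random variables uniformly distributed on $[0,1]$, and $V_n=U_n\prod_{i=1}^{n-1}(1-U_i)$; then $\sum_{i=1}^\infty V_i=1$ almost surely. $PD(1)$ is the distribution on $\Sigma_1$ of the order statistics $V_{(1)}\ge V_{(2)}\ge\ldots$ of the sequence $V_1,V_2,\ldots$. Split-merge operator $T$: let $V$ denote the operator that arranges the elements of a sequence in non-increasing order. For $x\in\Sigma_1$, $Tx$ is the random element of $\Sigma_1$ defined by: - for each pair $i<j$, with probability $2x_ix_j$, $Tx=V(x_i+x_j,x_1,\ldots,x_{i-1},x_{i+1},\ldots,x_{j-1},x_{j+1},\ldots)$; - for each $i=1,2,\ldots$, with probability $x_i\,dt$, $t\in[0,x_i]$, $Tx=V(t,x_i-t,x_1,\ldots,x_{i-1},x_{i+1},\ldots)$ (that is, with total probability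 $x_i^2$ the element $x_i$ is split into $t$ and $x_i-t$ with $t$ uniform on $[0,x_i]$). $T$ acts on a Borel probability measure $\nu$ on $\Sigma_1$ by $T\nu=\int_{\Sigma_1}\mathrm{Law}(Tx)\,d\nu(x)$, and $E\nu=\nu$. *)

theory Defs
  imports "HOL-Probability.Probability"
begin

definition Sigma1 :: "(nat \<Rightarrow> real) set" where
  "Sigma1 = {x. decseq x \<and> (\<forall>i. 0 \<le> x i) \<and> x sums 1}"

(* The product topology on nat => real is that of coordinatewise convergence. *)
definition borel_Sigma1 :: "(nat \<Rightarrow> real) measure" where
  "borel_Sigma1 = restrict_space borel Sigma1"

(* The n-th largest entry (n = 0, 1, ...) of a non-negative null sequence, as the maximum over
   the (n+1)-element index sets of the smallest entry. If only finitely many entries are positive,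
   the result is filled up with zeros. If infinitely many entries are positive, zero entries are
   never reached. See rearrange_unique below. *)
definition rearrange :: "(nat \<Rightarrow> real) \<Rightarrow> nat \<Rightarrow> real" where
  "rearrange x n = (SUP F \<in> {F. finite F \<and> card F = Suc n}. Min (x ` F))"

definition cons_seq :: "real \<Rightarrow> (nat \<Rightarrow> real) \<Rightarrow> nat \<Rightarrow> real" where
  "cons_seq a x n = (case n of 0 \<Rightarrow> a | Suc m \<Rightarrow> x m)"

definition del_seq :: "nat \<Rightarrow> (nat \<Rightarrow> real) \<Rightarrow> nat \<Rightarrow> real" where
  "del_seq i x n = (if n < i then x n else x (Suc n))"

(* Intended for i < j: deleting index j first leaves index i in place. *)
definition merge_at :: "nat \<Rightarrow> nat \<Rightarrow> (nat \<Rightarrow> real) \<Rightarrow> nat \<Rightarrow> real" where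
  "merge_at i j x = rearrange (cons_seq (x i + x j) (del_seq i (del_seq j x)))"

definition split_at :: "nat \<Rightarrow> real \<Rightarrow> (nat \<Rightarrow> real) \<Rightarrow> nat \<Rightarrow> real" where
  "split_at i t x = rearrange (cons_seq t (cons_seq (x i - t) (del_seq i x)))"

(* The law of Tx for x in Sigma1. The set function is countably additive on the Borel sets of Sigma1
   and has total mass one (emeasure_split_merge_law, prob_space_split_merge_law), so that measure_of
   does not degenerate. *)
definition split_merge_law :: "(nat \<Rightarrow> real) \<Rightarrow> (nat \<Rightarrow> real) measure" where
  "split_merge_law x = measure_of Sigma1 (sets borel_Sigma1) (\<lambda>A.
     (\<Sum>j. \<Sum>i<j. ennreal (2 * x i * x j) * indicator A (merge_at i j x)) +
     (\<Sum>i. \<integral>\<^sup>+t\<in>{0..x i}. ennreal (x i) * indicator A (split_at i t x) \<partial>lborel))"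

definition split_merge :: "(nat \<Rightarrow> real) measure \<Rightarrow> (nat \<Rightarrow> real) measure" where
  "split_merge \<nu> = \<nu> \<bind> split_merge_law"

(* (P + Q)/2 for operators P, Q on Borel measures on Sigma1. *)
definition half_sum ::
  "((nat \<Rightarrow> real) measure \<Rightarrow> (nat \<Rightarrow> real) measure) \<Rightarrow>
   ((nat \<Rightarrow> real) measure \<Rightarrow> (nat \<Rightarrow> real) measure) \<Rightarrow>
   (nat \<Rightarrow> real) measure \<Rightarrow> (nat \<Rightarrow> real) measure" where
  "half_sum P Q \<nu> = measure_of Sigma1 (sets borel_Sigma1)
     (\<lambda>A. (emeasure (P \<nu>) A + emeasure (Q \<nu>) A) / 2)"

definition nu0 :: "(nat \<Rightarrow> real) measure" where
  "nu0 = return borel_Sigma1 (\<lambda>n. if n = 0 then 1 else 0)"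

definition stick_breaking :: "(nat \<Rightarrow> real) \<Rightarrow> nat \<Rightarrow> real" where
  "stick_breaking u n = u n * (\<Prod>i<n. 1 - u i)"

(* The rearranged sequence lies in Sigma1 almost surely, so that its distribution, a measure on
   all real sequences, is restricted to Sigma1 without loss of mass (PD1_in_prob_algebra). *)
definition PD1 :: "(nat \<Rightarrow> real) measure" where
  "PD1 = restrict_space
     (distr (\<Pi>\<^sub>M i\<in>UNIV. uniform_measure lborel {0..1}) borel (\<lambda>u. rearrange (stick_breaking u)))
     Sigma1"

definition weakly_converges_on ::
  "'a::topological_space set \<Rightarrow> (nat \<Rightarrow> 'a measure) \<Rightarrow> 'a measure \<Rightarrow> bool" where
  "weakly_converges_on X \<mu> \<nu> \<longleftrightarrow>
     (\<forall>f :: 'a \<Rightarrow> real. continuous_on X f \<and> bounded (f ` X) \<longrightarrow>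
        (\<lambda>m. \<integral>x. f x \<partial>\<mu> m) \<longlonglongrightarrow> (\<integral>x. f x \<partial>\<nu>))"

lemma finite_level:
  fixes x :: "nat \<Rightarrow> real"
  assumes "x \<longlonglongrightarrow> 0" "0 < t"
  shows "finite {i. t \<le> x i}"
proof -
  have "eventually (\<lambda>i. x i < t) sequentially"
    using assms by (rule order_tendstoD(2))
  then obtain N where "\<And>i. i \<ge> N \<Longrightarrow> x i < t"
    by (auto simp: eventually_sequentially)
  then have "{i. t \<le> x i} \<subseteq> {..<N}"
    by (metis (mono_tags, lifting) lessThan_iff linorder_not_le mem_Collect_eq subsetI)
  then show ?thesis
    by (rule finite_subset) simp
qed

lemma bdd_above_Min_image:
  fixes x :: "nat \<Rightarrow> real"
  assumes "bdd_above (range x)"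
  shows "bdd_above ((\<lambda>F. Min (x ` F)) ` {F. finite F \<and> card F = Suc n})"
proof -
  obtain B where B: "\<And>i. x i \<le> B"
    using assms by (auto simp: bdd_above_def)
  show ?thesis
  proof (rule bdd_aboveI2)
    fix F :: "nat set" assume F: "F \<in> {F. finite F \<and> card F = Suc n}"
    then have "F \<noteq> {}" "finite F" by auto
    then obtain i where "i \<in> F" by auto
    then have "Min (x ` F) \<le> x i" using \<open>finite F\<close> by (intro Min_le) auto
    also note B[of i]
    finally show "Min (x ` F) \<le> B" .
  qed
qed

lemma le_rearrange_iff:
  fixes x :: "nat \<Rightarrow> real"
  assumes x: "x \<longlonglongrightarrow> 0" and t: "0 < t"
  shows "t \<le> rearrange x n \<longleftrightarrow> n < card {i. t \<le> x i}"
proof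
  have bdd: "bdd_above ((\<lambda>F. Min (x ` F)) ` {F. finite F \<and> card F = Suc n})"
    using x by (intro bdd_above_Min_image Bseq_bdd_above convergent_imp_Bseq convergentI)
  {
    assume "n < card {i. t \<le> x i}"
    then obtain F where F: "F \<subseteq> {i. t \<le> x i}" "card F = Suc n" "finite F"
      by (metis Suc_leI obtain_subset_with_card_n)
    then have "t \<le> Min (x ` F)" by (subst Min_ge_iff) auto
    also have "\<dots> \<le> rearrange x n"
      unfolding rearrange_def using F by (intro cSUP_upper bdd) auto
    finally show "t \<le> rearrange x n" .
  }
  assume le: "t \<le> rearrange x n"
  show "n < card {i. t \<le> x i}"
  proof (rule ccontr)
    assume n: "\<not> n < card {i. t \<le> x i}"
    define S where "S = insert (t / 2) (x ` {i. t / 2 \<le> x i \<and> x i < t})"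
    have fin: "finite S"
      unfolding S_def using finite_level[OF x, of "t / 2"] t
      by (auto intro!: finite_imageI elim!: rev_finite_subset)
    have "Max S < t"
      using fin t by (subst Max_less_iff) (auto simp: S_def)
    moreover have "rearrange x n \<le> Max S"
      unfolding rearrange_def
    proof (rule cSUP_least)
      have "{..n} \<in> {F. finite F \<and> card F = Suc n}" by auto
      then show "{F::nat set. finite F \<and> card F = Suc n} \<noteq> {}" by blast
      fix F :: "nat set" assume F: "F \<in> {F. finite F \<and> card F = Suc n}"
      have "\<not> F \<subseteq> {i. t \<le> x i}"
      proof
        assume "F \<subseteq> {i. t \<le> x i}"
        then have "card F \<le> card {i. t \<le> x i}"
          by (intro card_mono finite_level[OF x t])
        with F n show False by auto
      qed
      then obtain i where i: "i \<in> F" "x i < t" by (metis (mono_tags) linorder_not_le mem_Collect_eq subsetI)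
      have "Min (x ` F) \<le> x i" using F i by (intro Min_le) auto
      also have "x i \<le> Max S"
      proof (cases "t / 2 \<le> x i")
        case True
        then show ?thesis using fin i by (intro Max_ge) (auto simp: S_def)
      next
        case False
        then have "x i \<le> t / 2" by simp
        also have "\<dots> \<le> Max S" using fin by (intro Max_ge) (auto simp: S_def)
        finally show ?thesis .
      qed
      finally show "Min (x ` F) \<le> Max S" .
    qed
    ultimately show False using le by simp
  qed
qed

lemma rearrange_nonneg:
  fixes x :: "nat \<Rightarrow> real"
  assumes "bdd_above (range x)" "\<And>i. 0 \<le> x i"
  shows "0 \<le> rearrange x n"
proof -
  have "0 \<le> Min (x ` {..n})" using assms(2) by (subst Min_ge_iff) auto
  also have "\<dots> \<le> rearrange x n"
    unfolding rearrange_def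
    by (rule cSUP_upper[OF _ bdd_above_Min_image[OF assms(1)]]) auto
  finally show ?thesis .
qed

lemma null_seq_bdd_above: "x \<longlonglongrightarrow> (0::real) \<Longrightarrow> bdd_above (range x)"
  by (intro Bseq_bdd_above convergent_imp_Bseq convergentI)

lemma decseq_rearrange:
  assumes x: "x \<longlonglongrightarrow> 0" and nn: "\<And>i. 0 \<le> x i"
  shows "decseq (rearrange x)"
proof (rule decseq_SucI)
  fix n
  show "rearrange x (Suc n) \<le> rearrange x n"
  proof (cases "0 < rearrange x (Suc n)")
    case True
    then show ?thesis
      using le_rearrange_iff[OF x True, of "Suc n"] le_rearrange_iff[OF x True, of n] by auto
  next
    case False
    then show ?thesis
      using rearrange_nonneg[OF null_seq_bdd_above[OF x] nn, of n] by linarith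
  qed
qed

lemma rearrange_level:
  assumes "x \<longlonglongrightarrow> 0" "0 < t"
  shows "{i. t \<le> rearrange x i} = {..<card {i. t \<le> x i}}"
  using assms by (auto simp: le_rearrange_iff)

lemma rearrange_tendsto_0:
  assumes x: "x \<longlonglongrightarrow> 0" and nn: "\<And>i. 0 \<le> x i"
  shows "rearrange x \<longlonglongrightarrow> 0"
proof (rule LIMSEQ_I)
  fix t :: real assume t: "0 < t"
  show "\<exists>no. \<forall>n\<ge>no. norm (rearrange x n - 0) < t"
    using le_rearrange_iff[OF x t] rearrange_nonneg[OF null_seq_bdd_above[OF x] nn]
    by (intro exI[of _ "card {i. t \<le> x i}"]) (auto simp: not_le[symmetric])
qed

lemma card_fiber_eq:
  fixes x y :: "nat \<Rightarrow> real"
  assumes x: "x \<longlonglongrightarrow> 0" and y: "y \<longlonglongrightarrow> 0" and c: "0 < c"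
    and eq: "\<And>t. 0 < t \<Longrightarrow> card {i. t \<le> x i} = card {i. t \<le> y i}"
  shows "card {i. x i = c} = card {i. y i = c}"
proof -
  define V where "V = insert (c + 1) (x ` {i. c \<le> x i} \<union> y ` {i. c \<le> y i}) \<inter> {c<..}"
  have fin: "finite V" "V \<noteq> {}"
    unfolding V_def using finite_level[OF x c] finite_level[OF y c] by auto
  define d where "d = Min V"
  have d: "c < d"
    unfolding d_def using fin by (subst Min_gr_iff) (auto simp: V_def)
  have *: "card {i. z i = c} = card {i. c \<le> z i} - card {i. d \<le> z i}"
    if z: "z \<longlonglongrightarrow> 0" and zV: "z ` {i. c \<le> z i} \<inter> {c<..} \<subseteq> V" for z :: "nat \<Rightarrow> real"
  proof -
    have "{i. z i = c} = {i. c \<le> z i} - {i. d \<le> z i}"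
      using d zV Min_le[OF fin(1)] by (force simp: d_def)
    then show ?thesis
      using d c finite_level[OF z, of d] by (simp add: card_Diff_subset Collect_mono)
  qed
  show ?thesis
    proof -
    have "x ` {i. c \<le> x i} \<inter> {c<..} \<subseteq> V" "y ` {i. c \<le> y i} \<inter> {c<..} \<subseteq> V"
      by (auto simp: V_def)
    then show ?thesis using *[OF x] *[OF y] eq[of c] eq[of d] c d by simp
  qed
qed

lemma rearrange_card_fiber:
  assumes x: "x \<longlonglongrightarrow> 0" and nn: "\<And>i. 0 \<le> x i" and c: "0 < c"
  shows "card {i. rearrange x i = c} = card {i. x i = c}"
  by (rule card_fiber_eq[OF rearrange_tendsto_0[OF x nn] x c]) (simp add: rearrange_level[OF x])

lemma level_card_eq:
  fixes x y :: "nat \<Rightarrow> real"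
  assumes x: "x \<longlonglongrightarrow> 0" and y: "y \<longlonglongrightarrow> 0" and t: "0 < t"
    and eq: "\<And>c. 0 < c \<Longrightarrow> card {i. x i = c} = card {i. y i = c}"
  shows "card {i. t \<le> x i} = card {i. t \<le> y i}"
proof -
  define C where "C = x ` {i. t \<le> x i} \<union> y ` {i. t \<le> y i}"
  have C: "finite C" "\<And>c. c \<in> C \<Longrightarrow> t \<le> c"
    unfolding C_def using finite_level[OF x t] finite_level[OF y t] by auto
  have *: "card {i. t \<le> z i} = (\<Sum>c\<in>C. card {i. z i = c})"
    if z: "z \<longlonglongrightarrow> 0" and "z ` {i. t \<le> z i} \<subseteq> C" for z :: "nat \<Rightarrow> real"
  proof -
    have "{i. t \<le> z i} = (\<Union>c\<in>C. {i. z i = c})" using that C by auto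
    moreover have "finite {i. z i = c}" if "c \<in> C" for c
      using finite_level[OF z t] C(2)[OF that] by (rule_tac finite_subset[of _ "{i. t \<le> z i}"]) auto
    ultimately show ?thesis
      using C(1) by (simp add: card_UN_disjoint disjoint_iff)
  qed
  have "(\<Sum>c\<in>C. card {i. x i = c}) = (\<Sum>c\<in>C. card {i. y i = c})"
    using t C(2) by (intro sum.cong eq) force+
  then show ?thesis
    using *[OF x] *[OF y] by (simp add: C_def)
qed

text \<open>The rearrangement of a non-negative null sequence is its unique non-increasing
  non-negative rearrangement, multiplicities of positive entries being preserved.\<close>

lemma rearrange_unique:
  assumes x: "x \<longlonglongrightarrow> 0" and nn: "\<And>i. 0 \<le> x i"
  shows "y = rearrange x \<longleftrightarrow>
    decseq y \<and> y \<longlonglongrightarrow> 0 \<and> (\<forall>i. 0 \<le> y i) \<and> (\<forall>c>0. card {i. y i = c} = card {i. x i = c})"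
proof
  assume "y = rearrange x"
  then show "decseq y \<and> y \<longlonglongrightarrow> 0 \<and> (\<forall>i. 0 \<le> y i) \<and> (\<forall>c>0. card {i. y i = c} = card {i. x i = c})"
    using x nn by (auto intro: decseq_rearrange rearrange_tendsto_0 rearrange_nonneg
        null_seq_bdd_above rearrange_card_fiber)
next
  assume y: "decseq y \<and> y \<longlonglongrightarrow> 0 \<and> (\<forall>i. 0 \<le> y i) \<and> (\<forall>c>0. card {i. y i = c} = card {i. x i = c})"
  have iff: "t \<le> y n \<longleftrightarrow> n < card {i. t \<le> x i}" if t: "0 < t" for t n
  proof -
    have fin: "finite {i. t \<le> y i}" using finite_level y t by blast
    have eq: "card {i. t \<le> x i} = card {i. t \<le> y i}"
      using y by (intro level_card_eq x t) auto
    have dec: "y k \<le> y m" if "m \<le> k" for m k using y that by (auto simp: decseq_def)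
    show ?thesis
    proof
      assume "t \<le> y n"
      then have "{..n} \<subseteq> {i. t \<le> y i}" using dec by force
      from card_mono[OF fin this] show "n < card {i. t \<le> x i}" by (simp add: eq)
    next
      assume n: "n < card {i. t \<le> x i}"
      show "t \<le> y n"
      proof (rule ccontr)
        assume "\<not> t \<le> y n"
        then have "{i. t \<le> y i} \<subseteq> {..<n}" using dec by (force simp: not_le[symmetric])
        from card_mono[OF _ this] n show False by (simp add: eq)
      qed
    qed
  qed
  show "y = rearrange x"
  proof
    fix n
    have r: "0 \<le> rearrange x n" using rearrange_nonneg[OF null_seq_bdd_above[OF x] nn] .
    have "t \<le> y n \<longleftrightarrow> t \<le> rearrange x n" if "0 < t" for t
      using iff[OF that] le_rearrange_iff[OF x that] by simp
    from this[of "y n"] this[of "rearrange x n"] r y show "y n = rearrange x n"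
      by (metis order.antisym order_le_less)
  qed
qed

lemma suminf_layer_cake:
  fixes x :: "nat \<Rightarrow> real"
  assumes x: "x \<longlonglongrightarrow> 0" and nn: "\<And>i. 0 \<le> x i"
  shows "(\<Sum>i. ennreal (x i)) = (\<integral>\<^sup>+t\<in>{0<..}. of_nat (card {i. t \<le> x i}) \<partial>lborel)"
proof -
  have "(\<Sum>i. ennreal (x i)) = (\<Sum>i. \<integral>\<^sup>+t. indicator {0<..x i} t \<partial>lborel)"
    using nn by simp
  also have "\<dots> = (\<integral>\<^sup>+t. (\<Sum>i. indicator {0<..x i} t) \<partial>lborel)"
    by (rule nn_integral_suminf[symmetric]) auto
  also have "\<dots> = (\<integral>\<^sup>+t\<in>{0<..}. of_nat (card {i. t \<le> x i}) \<partial>lborel)"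
  proof (rule nn_integral_cong)
    fix t :: real
    show "(\<Sum>i. indicator {0<..x i} t) = (of_nat (card {i. t \<le> x i}) * indicator {0<..} t :: ennreal)"
    proof (cases "0 < t")
      case True
      have "(\<Sum>i. indicator {0<..x i} t) = (\<Sum>i\<in>{i. t \<le> x i}. indicator {0<..x i} t :: ennreal)"
        using finite_level[OF x True] by (rule suminf_finite) (auto simp: indicator_def)
      also have "\<dots> = (\<Sum>i\<in>{i. t \<le> x i}. 1)"
        using True by (intro sum.cong) (auto simp: indicator_def)
      finally show ?thesis using True by simp
    qed simp
  qed
  finally show ?thesis .
qed

lemma suminf_rearrange:
  assumes x: "x \<longlonglongrightarrow> 0" and nn: "\<And>i. 0 \<le> x i"
  shows "(\<Sum>i. ennreal (rearrange x i)) = (\<Sum>i. ennreal (x i))"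
  unfolding suminf_layer_cake[OF x nn]
  by (subst suminf_layer_cake[OF rearrange_tendsto_0[OF x nn] rearrange_nonneg])
     (auto intro!: nn_integral_cong null_seq_bdd_above x nn simp: rearrange_level x indicator_def)

lemma sums_1_iff:
  fixes x :: "nat \<Rightarrow> real"
  assumes "\<And>i. 0 \<le> x i"
  shows "x sums 1 \<longleftrightarrow> (\<Sum>i. ennreal (x i)) = 1"
proof
  assume "x sums 1"
  then show "(\<Sum>i. ennreal (x i)) = 1"
    using assms by (subst suminf_ennreal2) (auto simp: sums_iff)
next
  assume *: "(\<Sum>i. ennreal (x i)) = 1"
  have "(\<lambda>i. ennreal (x i)) sums ennreal 1"
    using * by (metis ennreal_1 summableI summable_sums)
  then show "x sums 1" using assms by (subst (asm) sums_ennreal) auto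
qed

lemma rearrange_in_Sigma1:
  assumes nn: "\<And>i. 0 \<le> x i" and "x sums 1"
  shows "rearrange x \<in> Sigma1"
proof -
  have x: "x \<longlonglongrightarrow> 0" using assms by (auto simp: sums_iff intro: summable_LIMSEQ_zero)
  have r: "0 \<le> rearrange x i" for i using rearrange_nonneg[OF null_seq_bdd_above[OF x] nn] .
  show ?thesis
    using decseq_rearrange[OF x nn] r suminf_rearrange[OF x nn] sums_1_iff[OF r] sums_1_iff[OF nn]
      assms(2) by (auto simp: Sigma1_def)
qed

lemma cons_seq_sums: "x sums s \<Longrightarrow> cons_seq a x sums (s + a)"
  by (subst sums_Suc_iff[symmetric, where f = "cons_seq a x", simplified cons_seq_def, simplified])
     (simp_all add: cons_seq_def)

lemma del_seq_sums:
  assumes "x sums s" shows "del_seq i x sums (s - x i)"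
proof -
  have "(\<lambda>n. x (n + Suc i)) sums (s - (\<Sum>k<Suc i. x k))"
    using assms by (rule sums_split_initial_segment)
  moreover have "(\<lambda>n. x (n + Suc i)) = (\<lambda>n. del_seq i x (n + i))"
    by (auto simp: del_seq_def)
  moreover have "(\<Sum>k<i. del_seq i x k) = (\<Sum>k<i. x k)" by (simp add: del_seq_def)
  ultimately show ?thesis
    by (subst sums_iff_shift'[of "del_seq i x" i, symmetric]) (simp add: algebra_simps)
qed

lemma cons_seq_nonneg: "0 \<le> a \<Longrightarrow> (\<And>i. 0 \<le> x i) \<Longrightarrow> 0 \<le> cons_seq a x n"
  by (simp add: cons_seq_def split: nat.split)

lemma del_seq_nonneg: "(\<And>i. 0 \<le> x i) \<Longrightarrow> 0 \<le> del_seq j x n"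
  by (simp add: del_seq_def)

lemma merge_at_in_Sigma1:
  assumes x: "x \<in> Sigma1" and "i < j"
  shows "merge_at i j x \<in> Sigma1"
proof -
  have nn: "\<And>i. 0 \<le> x i" and s: "x sums 1" using x by (auto simp: Sigma1_def)
  have "cons_seq (x i + x j) (del_seq i (del_seq j x)) sums (1 - x j - del_seq j x i + (x i + x j))"
    by (intro cons_seq_sums del_seq_sums s)
  then have "cons_seq (x i + x j) (del_seq i (del_seq j x)) sums 1"
    using \<open>i < j\<close> by (simp add: del_seq_def)
  then show ?thesis
    unfolding merge_at_def by (intro rearrange_in_Sigma1 cons_seq_nonneg del_seq_nonneg add_nonneg_nonneg nn)
qed

lemma split_at_in_Sigma1:
  assumes x: "x \<in> Sigma1" and "t \<in> {0..x i}"
  shows "split_at i t x \<in> Sigma1"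
proof -
  have nn: "\<And>i. 0 \<le> x i" and s: "x sums 1" using x by (auto simp: Sigma1_def)
  have "cons_seq t (cons_seq (x i - t) (del_seq i x)) sums (1 - x i + (x i - t) + t)"
    by (intro cons_seq_sums del_seq_sums s)
  then have "cons_seq t (cons_seq (x i - t) (del_seq i x)) sums 1"
    by simp
  then show ?thesis
    unfolding split_at_def using assms(2)
    by (intro rearrange_in_Sigma1 cons_seq_nonneg del_seq_nonneg add_nonneg_nonneg nn) auto
qed

lemma measurable_Min_image:
  assumes "finite F" "F \<noteq> {}"
  shows "(\<lambda>x::nat \<Rightarrow> real. Min (x ` F)) \<in> borel_measurable borel"
proof -
  have "(\<lambda>x::nat \<Rightarrow> real. Min (x ` F)) = (\<lambda>x. INF i\<in>F. x i)"
    using assms by (auto simp: cInf_eq_Min)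
  also have "\<dots> \<in> borel_measurable borel"
    using assms by (intro borel_measurable_cINF) (auto simp: countable_finite)
  finally show ?thesis .
qed

lemma measurable_rearrange [measurable]: "rearrange \<in> borel \<rightarrow>\<^sub>M borel"
proof (rule measurable_coordinatewise_then_product)
  fix n
  define Fs where "Fs = {F :: nat set. finite F \<and> card F = Suc n}"
  define b where "b x \<longleftrightarrow> bdd_above ((\<lambda>F. Min (x ` F)) ` Fs)" for x :: "nat \<Rightarrow> real"
  have c [simp]: "countable Fs"
    unfolding Fs_def by (rule countable_subset[OF _ countable_Collect_finite]) auto
  have m: "(\<lambda>x::nat \<Rightarrow> real. Min (x ` F)) \<in> borel_measurable borel" if "F \<in> Fs" for F
    using that by (intro measurable_Min_image) (auto simp: Fs_def)
  have "b x \<longleftrightarrow> (\<exists>k::nat. \<forall>F\<in>Fs. Min (x ` F) \<le> real k)" for x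
    unfolding b_def bdd_above_def by (auto dest: order_trans intro: real_arch_simple) (meson order_trans real_arch_simple)
  then have "{x \<in> space borel. b x} = {x \<in> space borel. \<exists>k::nat. \<forall>F\<in>Fs. Min (x ` F) \<le> real k}"
    by simp
  also have "\<dots> \<in> sets borel"
    using m by (intro sets.sets_Collect_countable_Ex sets.sets_Collect_countable_Ball c borel_measurable_le) auto
  finally have bs: "{x \<in> space borel. b x} \<in> sets borel" .
  have "(\<lambda>x. rearrange x n) = (\<lambda>x. if b x then SUP F\<in>Fs. Min (x ` F) else LEAST z. False)"
  proof
    fix x :: "nat \<Rightarrow> real"
    show "rearrange x n = (if b x then SUP F\<in>Fs. Min (x ` F) else LEAST z. False)"
    proof (cases "b x")
      case False
      then have "(\<lambda>z. \<forall>y\<in>(\<lambda>F. Min (x ` F)) ` Fs. y \<le> z) = (\<lambda>z. False)"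
        unfolding b_def bdd_above_def by (intro ext) blast
      then show ?thesis
        using False unfolding rearrange_def Fs_def[symmetric] Sup_real_def by (simp only: if_False)
    qed (simp add: rearrange_def Fs_def)
  qed
  also have "\<dots> \<in> borel_measurable borel"
    unfolding measurable_If_restrict_space_iff[OF bs]
    using m by (intro conjI measurable_const borel_measurable_cSUP c measurable_restrict_space1)
       (auto simp: space_restrict_space b_def)
  finally show "(\<lambda>x. rearrange x n) \<in> borel_measurable borel" .
qed

lemma Sigma1_in_borel [measurable]: "Sigma1 \<in> sets borel"
proof -
  have "Sigma1 = {x \<in> space borel. (\<forall>n. x (Suc n) \<le> x n) \<and> (\<forall>i. 0 \<le> x i) \<and> (\<Sum>i. ennreal (x i)) = 1}"
    unfolding Sigma1_def by (auto simp: decseq_Suc_iff sums_1_iff)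
  also have "\<dots> \<in> sets borel"
  proof (intro sets.sets_Collect borel_measurable_le borel_measurable_eq
        measurable_product_coordinates borel_measurable_const)
    have [measurable]: "(\<lambda>w::nat \<Rightarrow> real. w i) \<in> borel_measurable borel" for i
      by (rule measurable_product_coordinates)
    have "(\<lambda>w::nat \<Rightarrow> real. ennreal (w i)) \<in> borel_measurable borel" for i
      by measurable
    then show "(\<lambda>w::nat \<Rightarrow> real. \<Sum>i. ennreal (w i)) \<in> borel_measurable borel"
      by (rule borel_measurable_suminf_order)
  qed
  finally show ?thesis .
qed

lemma space_borel_Sigma1 [simp]: "space borel_Sigma1 = Sigma1"
  by (simp add: borel_Sigma1_def space_restrict_space)

lemma sets_borel_Sigma1_iff: "A \<in> sets borel_Sigma1 \<longleftrightarrow> A \<in> sets borel \<and> A \<subseteq> Sigma1"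
  unfolding borel_Sigma1_def by (subst sets_restrict_space_iff) auto

lemma sets_borel_Sigma1_Pow: "sets borel_Sigma1 \<subseteq> Pow Sigma1"
  by (auto simp: sets_borel_Sigma1_iff)

lemma sigma_algebra_borel_Sigma1: "sigma_algebra Sigma1 (sets borel_Sigma1)"
  using sets.sigma_algebra_axioms[of borel_Sigma1] by simp

lemma sets_measure_of_Sigma1 [simp]:
  "sets (measure_of Sigma1 (sets borel_Sigma1) \<mu>) = sets borel_Sigma1"
  using sigma_algebra.sets_measure_of_eq[OF sigma_algebra_borel_Sigma1] .

lemma split_merge_law_space [simp]: "space (split_merge_law x) = Sigma1"
  and split_merge_law_sets [simp]: "sets (split_merge_law x) = sets borel_Sigma1"
  unfolding split_merge_law_def by (simp_all add: space_measure_of_conv)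

lemma measurable_cons_seq [measurable (raw)]:
  assumes [measurable]: "f \<in> M \<rightarrow>\<^sub>M borel" "g \<in> M \<rightarrow>\<^sub>M borel"
  shows "(\<lambda>w. cons_seq (f w) (g w)) \<in> M \<rightarrow>\<^sub>M borel"
proof (rule measurable_coordinatewise_then_product)
  have [measurable]: "(\<lambda>w. g w k) \<in> borel_measurable M" for k
    by (rule measurable_product_then_coordinatewise) measurable
  show "(\<lambda>w. cons_seq (f w) (g w) n) \<in> borel_measurable M" for n
    by (cases n) (simp_all add: cons_seq_def)
qed

lemma measurable_del_seq [measurable (raw)]:
  assumes [measurable]: "g \<in> M \<rightarrow>\<^sub>M borel"
  shows "(\<lambda>w. del_seq i (g w)) \<in> M \<rightarrow>\<^sub>M borel"
proof (rule measurable_coordinatewise_then_product)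
  have [measurable]: "(\<lambda>w. g w k) \<in> borel_measurable M" for k
    by (rule measurable_product_then_coordinatewise) measurable
  show "(\<lambda>w. del_seq i (g w) n) \<in> borel_measurable M" for n
    by (simp add: del_seq_def)
qed

lemma measurable_merge_at [measurable (raw)]:
  assumes [measurable]: "g \<in> M \<rightarrow>\<^sub>M borel"
  shows "(\<lambda>w. merge_at i j (g w)) \<in> M \<rightarrow>\<^sub>M borel"
proof -
  have [measurable]: "(\<lambda>w. g w k) \<in> borel_measurable M" for k
    by (rule measurable_product_then_coordinatewise) measurable
  show ?thesis unfolding merge_at_def by measurable
qed

lemma measurable_split_at [measurable (raw)]:
  assumes [measurable]: "f \<in> M \<rightarrow>\<^sub>M borel" "g \<in> M \<rightarrow>\<^sub>M borel"
  shows "(\<lambda>w. split_at i (f w) (g w)) \<in> M \<rightarrow>\<^sub>M borel"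
proof -
  have [measurable]: "(\<lambda>w. g w k) \<in> borel_measurable M" for k
    by (rule measurable_product_then_coordinatewise) measurable
  show ?thesis unfolding split_at_def by measurable
qed

lemma suminf_swap_ennreal:
  fixes f :: "nat \<Rightarrow> nat \<Rightarrow> ennreal"
  shows "(\<Sum>i. \<Sum>k. f i k) = (\<Sum>k. \<Sum>i. f i k)"
proof -
  have "(\<Sum>i. \<Sum>k. f i k) = (\<integral>\<^sup>+i. (\<Sum>k. f i k) \<partial>count_space UNIV)"
    by (simp add: nn_integral_count_space_nat)
  also have "\<dots> = (\<Sum>k. \<integral>\<^sup>+i. f i k \<partial>count_space UNIV)"
    by (rule nn_integral_suminf) simp
  finally show ?thesis by (simp add: nn_integral_count_space_nat)
qed

lemma emeasure_split_merge_law: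
  assumes A: "A \<in> sets borel_Sigma1"
  shows "emeasure (split_merge_law x) A =
     (\<Sum>j. \<Sum>i<j. ennreal (2 * x i * x j) * indicator A (merge_at i j x)) +
     (\<Sum>i. \<integral>\<^sup>+t\<in>{0..x i}. ennreal (x i) * indicator A (split_at i t x) \<partial>lborel)"
    (is "_ = ?\<mu> A")
proof -
  have "countably_additive (sets borel_Sigma1) ?\<mu>"
  proof (rule countably_additiveI)
    fix B :: "nat \<Rightarrow> (nat \<Rightarrow> real) set"
    assume B: "range B \<subseteq> sets borel_Sigma1" "disjoint_family B"
    have [measurable]: "B k \<in> sets borel" for k
      using B(1) sets_borel_Sigma1_iff[of "B k"] by blast
    have ind: "indicator (\<Union>k. B k) y = (\<Sum>k. indicator (B k) y :: ennreal)" for y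
      using suminf_indicator[OF B(2), of y] by simp
    have "(\<Sum>k. ?\<mu> (B k)) =
      (\<Sum>k. \<Sum>j. \<Sum>i<j. ennreal (2 * x i * x j) * indicator (B k) (merge_at i j x)) +
      (\<Sum>k. \<Sum>i. \<integral>\<^sup>+t\<in>{0..x i}. ennreal (x i) * indicator (B k) (split_at i t x) \<partial>lborel)"
      by (intro suminf_add[symmetric]) auto
    also have "(\<Sum>k. \<Sum>j. \<Sum>i<j. ennreal (2 * x i * x j) * indicator (B k) (merge_at i j x)) =
      (\<Sum>j. \<Sum>k. \<Sum>i<j. ennreal (2 * x i * x j) * indicator (B k) (merge_at i j x))"
      by (rule suminf_swap_ennreal)
    also have "\<dots> = (\<Sum>j. \<Sum>i<j. \<Sum>k. ennreal (2 * x i * x j) * indicator (B k) (merge_at i j x))"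
      by (intro suminf_cong suminf_sum summableI)
    also have "\<dots> = (\<Sum>j. \<Sum>i<j. ennreal (2 * x i * x j) * indicator (\<Union>k. B k) (merge_at i j x))"
      unfolding ind by (intro suminf_cong sum.cong refl ennreal_suminf_cmult)
    also have "(\<Sum>k. \<Sum>i. \<integral>\<^sup>+t\<in>{0..x i}. ennreal (x i) * indicator (B k) (split_at i t x) \<partial>lborel) =
      (\<Sum>i. \<Sum>k. \<integral>\<^sup>+t\<in>{0..x i}. ennreal (x i) * indicator (B k) (split_at i t x) \<partial>lborel)"
      by (rule suminf_swap_ennreal)
    also have "\<dots> = (\<Sum>i. \<integral>\<^sup>+t\<in>{0..x i}. ennreal (x i) * indicator (\<Union>k. B k) (split_at i t x) \<partial>lborel)"
      by (subst nn_integral_suminf[symmetric]) (simp_all add: ind)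
    finally show "(\<Sum>k. ?\<mu> (B k)) = ?\<mu> (\<Union>k. B k)" .
  qed
  then show ?thesis
    using A by (subst emeasure_measure_of[OF split_merge_law_def sets_borel_Sigma1_Pow])
      (auto simp: positive_def)
qed

lemma prob_space_split_merge_law:
  assumes x: "x \<in> Sigma1"
  shows "prob_space (split_merge_law x)"
proof (rule prob_spaceI)
  have nn: "\<And>i. 0 \<le> x i" and s: "x sums 1" using x by (auto simp: Sigma1_def)
  have S: "Sigma1 \<in> sets borel_Sigma1" by (simp add: sets_borel_Sigma1_iff)
  have 1: "(\<Sum>i<j. ennreal (2 * x i * x j) * indicator Sigma1 (merge_at i j x)) =
      ennreal (\<Sum>i<j. 2 * x i * x j)" for j
    using nn by (simp add: merge_at_in_Sigma1[OF x] sum_ennreal)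
  have 2: "(\<integral>\<^sup>+t\<in>{0..x i}. ennreal (x i) * indicator Sigma1 (split_at i t x) \<partial>lborel) =
      ennreal (x i * x i)" for i
  proof -
    have "(\<integral>\<^sup>+t\<in>{0..x i}. ennreal (x i) * indicator Sigma1 (split_at i t x) \<partial>lborel) =
      (\<integral>\<^sup>+t\<in>{0..x i}. ennreal (x i) \<partial>lborel)"
      by (intro nn_integral_cong) (auto simp: indicator_def split_at_in_Sigma1[OF x])
    also have "\<dots> = ennreal (x i * x i)"
      using nn by (subst nn_integral_cmult_indicator) (auto simp: ennreal_mult)
    finally show ?thesis .
  qed
  have "(\<lambda>n. \<Sum>j<n. (\<Sum>i<j. 2 * x i * x j) + x j * x j) = (\<lambda>n. (\<Sum>j<n. x j) * (\<Sum>j<n. x j))"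
  proof
    show "(\<Sum>j<n. (\<Sum>i<j. 2 * x i * x j) + x j * x j) = (\<Sum>j<n. x j) * (\<Sum>j<n. x j)" for n
      by (induction n) (auto simp: algebra_simps sum_distrib_left sum_distrib_right)
  qed
  moreover have "(\<lambda>n. (\<Sum>j<n. x j) * (\<Sum>j<n. x j)) \<longlonglongrightarrow> 1 * 1"
    using s by (intro tendsto_mult) (auto simp: sums_def)
  ultimately have sq: "(\<lambda>j. (\<Sum>i<j. 2 * x i * x j) + x j * x j) sums 1"
    by (simp add: sums_def)
  have "emeasure (split_merge_law x) (space (split_merge_law x)) =
      (\<Sum>j. ennreal (\<Sum>i<j. 2 * x i * x j) + ennreal (x j * x j))"
    by (simp add: emeasure_split_merge_law[OF S] 1 2 suminf_add)
  also have "\<dots> = (\<Sum>j. ennreal ((\<Sum>i<j. 2 * x i * x j) + x j * x j))"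
    using nn by (intro suminf_cong ennreal_plus[symmetric]) (auto intro!: sum_nonneg)
  also have "\<dots> = 1"
    using sq nn by (subst sums_1_iff[symmetric]) (auto intro!: sum_nonneg add_nonneg_nonneg)
  finally show "emeasure (split_merge_law x) (space (split_merge_law x)) = 1" .
qed

lemma measurable_split_merge_law: "split_merge_law \<in> borel_Sigma1 \<rightarrow>\<^sub>M prob_algebra borel_Sigma1"
proof (intro measurable_prob_algebraI measurable_subprob_algebra)
  fix A assume A: "A \<in> sets borel_Sigma1"
  then have [measurable]: "A \<in> sets borel" by (simp add: sets_borel_Sigma1_iff)
  have [measurable]: "(\<lambda>x. x) \<in> borel_Sigma1 \<rightarrow>\<^sub>M borel"
    unfolding borel_Sigma1_def by (rule measurable_restrict_space1) simp
  have [measurable]: "(\<lambda>x. x k) \<in> borel_measurable borel_Sigma1" for k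
    by (rule measurable_product_then_coordinatewise) measurable
  have f: "fst \<in> borel_Sigma1 \<Otimes>\<^sub>M lborel \<rightarrow>\<^sub>M borel"
    by (rule measurable_compose[OF measurable_fst]) measurable
  have [measurable]: "(\<lambda>p. split_at i (snd p) (fst p)) \<in> borel_Sigma1 \<Otimes>\<^sub>M lborel \<rightarrow>\<^sub>M borel" for i
    by (rule measurable_split_at[OF _ f]) measurable
  have [measurable]: "(\<lambda>p. fst p i) \<in> borel_Sigma1 \<Otimes>\<^sub>M lborel \<rightarrow>\<^sub>M borel" for i
    using f by (rule measurable_product_then_coordinatewise)
  have "(\<lambda>p. ennreal (fst p i) * indicator A (split_at i (snd p) (fst p)) * (if 0 \<le> snd p \<and> snd p \<le> fst p i then 1 else 0))
      \<in> borel_measurable (borel_Sigma1 \<Otimes>\<^sub>M lborel)" for i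
    by measurable
  then have "(\<lambda>x. \<integral>\<^sup>+t\<in>{0..x i}. ennreal (x i) * indicator A (split_at i t x) \<partial>lborel)
      \<in> borel_measurable borel_Sigma1" for i
    by (intro lborel.borel_measurable_nn_integral)
      (simp add: split_beta' indicator_def[of "{0.._}"] of_bool_def)
  moreover have "(\<lambda>x. ennreal (2 * x i * x j) * indicator A (merge_at i j x))
      \<in> borel_measurable borel_Sigma1" for i j
    by measurable
  ultimately show "(\<lambda>x. emeasure (split_merge_law x) A) \<in> borel_measurable borel_Sigma1"
    unfolding emeasure_split_merge_law[OF A]
    by (intro borel_measurable_add borel_measurable_suminf_order borel_measurable_sum)
qed (auto intro!: prob_space_split_merge_law prob_space_imp_subprob_space)

lemma split_merge_in_prob_algebra:
  assumes "\<nu> \<in> space (prob_algebra borel_Sigma1)"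
  shows "split_merge \<nu> \<in> space (prob_algebra borel_Sigma1)"
  unfolding split_merge_def space_prob_algebra
  using prob_space_bind'[OF assms measurable_split_merge_law]
    sets_bind'[OF assms measurable_split_merge_law] by simp

lemma emeasure_split_merge:
  assumes "\<nu> \<in> space (prob_algebra borel_Sigma1)" "A \<in> sets borel_Sigma1"
  shows "emeasure (split_merge \<nu>) A = (\<integral>\<^sup>+x. emeasure (split_merge_law x) A \<partial>\<nu>)"
  unfolding split_merge_def
  by (rule emeasure_bind_prob_algebra[OF assms(1) measurable_split_merge_law assms(2)])

lemma space_half_sum [simp]: "space (half_sum P Q \<nu>) = Sigma1"
  and sets_half_sum [simp]: "sets (half_sum P Q \<nu>) = sets borel_Sigma1"
  unfolding half_sum_def by (simp_all add: space_measure_of_conv)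

lemma emeasure_half_sum:
  assumes P: "P \<nu> \<in> space (prob_algebra borel_Sigma1)" and Q: "Q \<nu> \<in> space (prob_algebra borel_Sigma1)"
    and A: "A \<in> sets borel_Sigma1"
  shows "emeasure (half_sum P Q \<nu>) A = (emeasure (P \<nu>) A + emeasure (Q \<nu>) A) / 2"
proof -
  have [simp]: "sets (P \<nu>) = sets borel_Sigma1" "sets (Q \<nu>) = sets borel_Sigma1"
    using P Q by (auto simp: space_prob_algebra)
  have "countably_additive (sets borel_Sigma1) (\<lambda>A. (emeasure (P \<nu>) A + emeasure (Q \<nu>) A) / 2)"
    by (rule countably_additiveI)
      (simp add: divide_ennreal_def ennreal_suminf_multc suminf_add[symmetric] suminf_emeasure)
  then show ?thesis
    using A by (subst emeasure_measure_of[OF half_sum_def sets_borel_Sigma1_Pow])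
      (auto simp: positive_def)
qed

lemma half_sum_in_prob_algebra:
  assumes P: "P \<nu> \<in> space (prob_algebra borel_Sigma1)" and Q: "Q \<nu> \<in> space (prob_algebra borel_Sigma1)"
  shows "half_sum P Q \<nu> \<in> space (prob_algebra borel_Sigma1)"
proof -
  have "emeasure M Sigma1 = 1" if "M \<in> space (prob_algebra borel_Sigma1)" for M
    using that prob_space.emeasure_space_1[of M] sets_eq_imp_space_eq[of M borel_Sigma1]
    by (auto simp: space_prob_algebra)
  then have "emeasure (half_sum P Q \<nu>) Sigma1 = (1 + 1) / 2"
    using P Q by (subst emeasure_half_sum) (auto simp: sets_borel_Sigma1_iff)
  then show ?thesis
    by (auto simp: space_prob_algebra intro!: prob_spaceI)
qed

lemma nu0_in_prob_algebra: "nu0 \<in> space (prob_algebra borel_Sigma1)"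
proof -
  have "(\<lambda>n::nat. if n = 0 then 1 else 0 :: real) \<in> Sigma1"
    using sums_single[of 0 "\<lambda>_. 1::real"] by (auto simp: Sigma1_def decseq_def)
  then show ?thesis
    by (simp add: nu0_def space_prob_algebra prob_space_return)
qed

lemma iterates_in_prob_algebra:
  "(half_sum (\<lambda>\<nu>. \<nu>) split_merge ^^ m) nu0 \<in> space (prob_algebra borel_Sigma1)"
  by (induction m) (auto intro: nu0_in_prob_algebra half_sum_in_prob_algebra split_merge_in_prob_algebra)

lemma stick_breaking_sum: "(\<Sum>k<n. stick_breaking u k) = 1 - (\<Prod>i<n. 1 - u i)"
  by (induction n) (auto simp: stick_breaking_def algebra_simps)

lemma nn_integral_uniform_complement:
  "(\<integral>\<^sup>+u. ennreal (1 - u) \<partial>uniform_measure lborel {0..1}) = ennreal (1 / 2)"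
proof -
  have "(\<integral>\<^sup>+u\<in>{0..1}. ennreal (1 - u) \<partial>lborel) = ennreal ((1 - 1\<^sup>2 / 2) - (0 - 0\<^sup>2 / 2))"
    by (rule nn_integral_FTC_Icc[where F = "\<lambda>u. u - u\<^sup>2 / 2"])
      (auto intro!: derivative_eq_intros)
  then show ?thesis
    by (subst nn_integral_uniform_measure) (auto simp: divide_ennreal_def)
qed

abbreviation uniform_seq :: "(nat \<Rightarrow> real) measure" where
  "uniform_seq \<equiv> \<Pi>\<^sub>M i\<in>UNIV. uniform_measure lborel {0..1}"

lemma prob_space_uniform_unit: "prob_space (uniform_measure lborel {0..1::real})"
  by (rule prob_space_uniform_measure) auto

lemma sets_uniform_seq [measurable_cong]: "sets uniform_seq = sets borel"
proof -
  have "sets uniform_seq = sets (\<Pi>\<^sub>M i\<in>(UNIV::nat set). (borel :: real measure))"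
    by (rule sets_PiM_cong) auto
  then show ?thesis by (simp add: sets_PiM_equal_borel)
qed

lemma nn_integral_prod_complement:
  "(\<integral>\<^sup>+u. (\<Prod>i<n. ennreal (1 - u i)) \<partial>uniform_seq) = ennreal (1 / 2) ^ n"
proof -
  interpret product_prob_space "\<lambda>_::nat. uniform_measure lborel {0..1::real}" UNIV
    using prob_space_uniform_unit
    by (auto simp: product_prob_space_def product_prob_space_axioms_def product_sigma_finite_def
        intro: prob_space_imp_sigma_finite)
  let ?U = "\<lambda>_::nat. uniform_measure lborel {0..1::real}"
  have "(\<integral>\<^sup>+u. (\<Prod>i<n. ennreal (1 - u i)) \<partial>uniform_seq) =
      (\<integral>\<^sup>+u. (\<Prod>i<n. ennreal (1 - restrict u {..<n} i)) \<partial>uniform_seq)"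
    by simp
  also have "\<dots> = (\<integral>\<^sup>+u. (\<Prod>i<n. ennreal (1 - u i))
      \<partial>distr uniform_seq (Pi\<^sub>M {..<n} ?U) (\<lambda>u. restrict u {..<n}))"
    by (rule nn_integral_distr[symmetric], rule measurable_restrict_subset) auto
  also have "\<dots> = (\<integral>\<^sup>+u. (\<Prod>i<n. ennreal (1 - u i)) \<partial>Pi\<^sub>M {..<n} ?U)"
    by (subst distr_PiM_restrict_finite) auto
  also have "\<dots> = (\<Prod>i<n. \<integral>\<^sup>+u. ennreal (1 - u) \<partial>?U i)"
    by (rule product_nn_integral_prod) auto
  also have "\<dots> = ennreal (1 / 2) ^ n"
    by (simp add: nn_integral_uniform_complement)
  finally show ?thesis .
qed

lemma AE_stick_breaking: "AE u in uniform_seq. rearrange (stick_breaking u) \<in> Sigma1"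
proof -
  interpret prob_space "uniform_measure lborel {0..1::real}" by (rule prob_space_uniform_unit)
  have [measurable]: "(\<lambda>u. u i) \<in> borel_measurable uniform_seq" for i
    using measurable_product_coordinates by (simp cong: measurable_cong_sets)
  have "AE u in uniform_seq. u i \<in> {0..1}" for i
    by (rule AE_PiM_component) (auto intro!: prob_space_uniform_unit AE_uniform_measureI)
  then have unit: "AE u in uniform_seq. \<forall>i. u i \<in> {0..1}"
    by (simp add: AE_all_countable)
  have "(\<integral>\<^sup>+u. (\<Sum>n. \<Prod>i<n. ennreal (1 - u i)) \<partial>uniform_seq) = (\<Sum>n. ennreal (1 / 2) ^ n)"
    by (subst nn_integral_suminf) (auto simp: nn_integral_prod_complement)
  also have "\<dots> = (\<Sum>n. ennreal ((1 / 2) ^ n))"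
    by (intro suminf_cong ennreal_power) simp
  also have "\<dots> \<noteq> \<infinity>"
    by (subst suminf_ennreal2) (auto intro: summable_geometric)
  finally have "AE u in uniform_seq. (\<Sum>n. \<Prod>i<n. ennreal (1 - u i)) \<noteq> \<infinity>"
    by (intro nn_integral_noteq_infinite) auto
  with unit show ?thesis
  proof eventually_elim
    case (elim u)
    define p where "p n = (\<Prod>i<n. 1 - u i)" for n
    have p: "0 \<le> p n" for n using elim(1) by (auto simp: p_def intro!: prod_nonneg)
    have "(\<Sum>n. ennreal (p n)) \<noteq> top"
      using elim by (simp add: p_def prod_ennreal)
    then have "summable p" by (rule summable_suminf_not_top[OF p])
    then have "(\<lambda>n. 1 - p n) \<longlonglongrightarrow> 1 - 0"
      by (intro tendsto_diff tendsto_const summable_LIMSEQ_zero)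
    then have "stick_breaking u sums 1"
      by (simp add: sums_def stick_breaking_sum p_def)
    moreover have "0 \<le> stick_breaking u i" for i
      using elim(1) p[of i] by (simp add: stick_breaking_def p_def)
    ultimately show "rearrange (stick_breaking u) \<in> Sigma1"
      by (intro rearrange_in_Sigma1)
  qed
qed

lemma measurable_stick_breaking [measurable]: "stick_breaking \<in> borel \<rightarrow>\<^sub>M borel"
  unfolding stick_breaking_def
  by (rule measurable_coordinatewise_then_product) measurable

lemma PD1_in_prob_algebra: "PD1 \<in> space (prob_algebra borel_Sigma1)"
proof -
  interpret prob_space uniform_seq
    by (intro prob_space_PiM prob_space_uniform_unit)
  have m [measurable]: "(\<lambda>u. rearrange (stick_breaking u)) \<in> uniform_seq \<rightarrow>\<^sub>M borel"
    by measurable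
  have "emeasure PD1 Sigma1 = emeasure (distr uniform_seq borel (\<lambda>u. rearrange (stick_breaking u))) Sigma1"
    unfolding PD1_def by (rule emeasure_restrict_space) auto
  also have "\<dots> = emeasure uniform_seq {u \<in> space uniform_seq. rearrange (stick_breaking u) \<in> Sigma1}"
    by (subst emeasure_distr) (auto intro!: arg_cong2[where f = emeasure])
  also have "\<dots> = 1"
  proof (rule emeasure_eq_1_AE)
    show "{u \<in> space uniform_seq. rearrange (stick_breaking u) \<in> Sigma1} \<in> events"
      using measurable_sets_Collect[OF m] by measurable
    show "AE u in uniform_seq. u \<in> {u \<in> space uniform_seq. rearrange (stick_breaking u) \<in> Sigma1}"
      using AE_stick_breaking AE_space by eventually_elim simp
  qed
  finally have "emeasure PD1 Sigma1 = 1" .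
  moreover have "space PD1 = Sigma1" "sets PD1 = sets borel_Sigma1"
    by (simp_all add: PD1_def borel_Sigma1_def space_restrict_space sets_restrict_space)
  ultimately show ?thesis
    by (auto simp: space_prob_algebra intro: prob_spaceI)
qed

end

theory Submission
  imports Defs
begin

text \<open>
  Write \<open>\<nu>\<^sub>m\<close> for the \<open>m\<close>-th iterate. It has an explicit description: break a stick according to the uniform
  stick-breaking scheme, throw \<open>m\<close> independent uniform points on it, and glue together everything
  from the first piece on that is hit by none of the points. As \<open>m\<close> grows, the first unhit
  piece moves to infinity almost surely, so the glued sequence converges to the full stick-breaking
  sequence; dominated convergence then yields the limit.

  To prove the description, symmetrize it. On the partitions of the unit interval into \<open>k + 1\<close> parts,
  \<open>\<nu>\<^sub>m\<close> has, with respect to Lebesgue measure divided by \<open>(k + 1)!\<close>, the density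
  \<open>m! [s^(m+1)] G(s)\<close> over the product of the parts, where \<open>G(s)\<close> is the product of
  \<open>exp(s x\<^sub>i) - 1\<close>. The split-merge operator is symmetric with respect to the
  measure with density \<open>1 / (x\<^sub>0 \<dots> x\<^sub>k)\<close>, and it turns \<open>G\<close> into \<open>2 G' - G - 2 G / s\<close>, whose
  coefficients give \<open>T \<nu>\<^sub>m = 2 \<nu>\<^sub>m\<^sub>+\<^sub>1 - \<nu>\<^sub>m\<close>. The size-biased
  ordering of the parts leads back from the symmetric density to stick-breaking.
\<close>

section \<open>Coefficients of products of exponentials\<close>

text \<open>The points on a stick are convenient for the limit but hard to push through
  \<open>split_merge\<close>, which forgets the order of the parts; on a symmetric density it acts
  explicitly. The division by the parts is absorbed into \<open>exp_quot y\<close>, the series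
  (exp(s y) - 1) / y in s, whose coefficients are polynomials in y. The order m + 1 comes from
  averaging over the fraction broken off last: the mean of exp((1 - v) r s) over a uniform v is
  (exp(r s) - 1) / (r s), and the 1 / s shifts the coefficient. The recursion closes because in G +
  (2 G' - G - 2 G / s) the terms G cancel, and what is left at s^(m+1) is 2 (m + 2) - 2 = 2 (m + 1)
  times the coefficient of s^(m+2) in G; multiplied by m!, this is twice the next density. Lebesgue
  measure on the simplex enters only as an expectation over stick-breaking with a Jacobian. This
  gives iterated integrals at once, but hides the symmetry of the parts, which has to be
  proved.\<close>

definition exp_quot :: "real \<Rightarrow> real fps" where
  "exp_quot y = Abs_fps (\<lambda>n. if n = 0 then 0 else y ^ (n - 1) / fact n)"

lemma exp_quot_nth: "fps_nth (exp_quot y) n = (if n = 0 then 0 else y ^ (n - 1) / fact n)"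
  by (simp add: exp_quot_def)

lemma const_mult_exp_quot: "fps_const y * exp_quot y = fps_exp y - 1"
  by (rule fps_ext) (auto simp: exp_quot_nth power_eq_if)

lemma deriv_exp_quot: "fps_deriv (exp_quot y) = fps_const y * exp_quot y + 1"
proof (rule fps_ext)
  fix n
  have "fps_nth (fps_deriv (exp_quot y)) n = (real (Suc n) * y ^ n) / (real (Suc n) * fact n)"
    by (simp add: exp_quot_nth)
  also have "\<dots> = y ^ n / fact n"
    by (simp del: of_nat_Suc)
  finally show "fps_nth (fps_deriv (exp_quot y)) n = fps_nth (fps_const y * exp_quot y + 1) n"
    by (simp add: const_mult_exp_quot)
qed

section \<open>The differential identity for products of exponentials\<close>

lemma fps_deriv_prod:
  fixes f :: "'b \<Rightarrow> 'a::comm_ring_1 fps"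
  assumes "finite A"
  shows "fps_deriv (\<Prod>i\<in>A. f i) = (\<Sum>i\<in>A. fps_deriv (f i) * (\<Prod>j\<in>A - {i}. f j))"
  using assms
proof (induction A)
  case (insert a A)
  have "(\<Sum>i\<in>A. fps_deriv (f i) * (\<Prod>j\<in>insert a A - {i}. f j)) =
     (\<Sum>i\<in>A. f a * (fps_deriv (f i) * (\<Prod>j\<in>A - {i}. f j)))"
  proof (rule sum.cong)
    fix i assume "i \<in> A"
    then have "insert a A - {i} = insert a (A - {i})" using insert by auto
    then show "fps_deriv (f i) * (\<Prod>j\<in>insert a A - {i}. f j) = f a * (fps_deriv (f i) * (\<Prod>j\<in>A - {i}. f j))"
      using insert by (simp add: mult_ac)
  qed simp
  then show ?case
    using insert by (simp add: sum_distrib_left algebra_simps)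
qed simp

text \<open>As a function of s this is y (exp(s y) + 1) - 2 (exp(s y) - 1) / s, the integral of
  (exp(s t) - 1) (exp(s (y - t)) - 1) over t in [0, y]. The explicit \<open>Abs_fps\<close> is the
  quotient by s.\<close>

definition split_kernel :: "real \<Rightarrow> real fps" where
  "split_kernel y = fps_const y * (fps_exp y + 1) - fps_const 2 * Abs_fps (\<lambda>n. y ^ Suc n / fact (Suc n))"

text \<open>Multiplying by the variable replaces the division by s, after which only
  \<open>exp_quot y\<close> is left.\<close>

lemma X_mult_split_kernel:
  "fps_X * split_kernel y =
     fps_X * fps_const y * (fps_const y * exp_quot y + 2) - 2 * (fps_const y * exp_quot y)"
proof -
  define D where "D = Abs_fps (\<lambda>n. y ^ Suc n / fact (Suc n))"
  have "fps_X * D = fps_exp y - 1"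
    unfolding D_def by (rule fps_ext) (auto simp: gr0_conv_Suc)
  moreover have "fps_X * (fps_const y * (fps_exp y + 1) - fps_const 2 * D) =
      fps_X * fps_const y * (fps_exp y - 1 + 2) - 2 * (fps_X * D)"
    unfolding numeral_fps_const[of "num.Bit0 num.One"] by (simp add: algebra_simps)
  ultimately show ?thesis
    unfolding split_kernel_def const_mult_exp_quot D_def by simp
qed

text \<open>Write c_i for x_i and h_i for \<open>exp_quot (x i)\<close>. Each exponential is c_i h_i
  + 1, so both sums expand into multiples of g and of the products with one factor omitted. The
  coefficients c_i c_j from pairs and c_i^2 from single parts add up to the square of the sum of the
  c_i, which is 1; likewise each product with one factor omitted receives the coefficient 2 in
  total. Total mass one is thus what removes the explicit dependence on x.\<close>

lemma exp_quot_product_identity: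
  fixes x :: "'b \<Rightarrow> real"
  assumes A: "finite A" and s: "(\<Sum>i\<in>A. x i) = 1"
  defines "g \<equiv> \<Prod>i\<in>A. exp_quot (x i)"
  shows "fps_X * ((\<Sum>i\<in>A. split_kernel (x i) * (\<Prod>l\<in>A - {i}. exp_quot (x l))) +
      (\<Sum>i\<in>A. \<Sum>j\<in>A - {i}. fps_const (x i + x j) * exp_quot (x i + x j) * (\<Prod>l\<in>A - {i, j}. exp_quot (x l))))
    = 2 * fps_X * fps_deriv g - fps_X * g - 2 * g"
proof -
  define c where "c i = fps_const (x i)" for i
  define h where "h i = exp_quot (x i)" for i
  define Q where "Q i = (\<Prod>l\<in>A - {i}. h l)" for i
  define Q2 where "Q2 i j = (\<Prod>l\<in>A - {i, j}. h l)" for i j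
  have c1: "(\<Sum>i\<in>A. c i) = 1"
    using s by (intro fps_ext) (simp add: c_def fps_sum_nth sum.neutral)
  have Q: "h i * Q i = g" if "i \<in> A" for i
    unfolding Q_def g_def h_def using A that by (simp add: prod.remove)
  have Q2: "h j * Q2 i j = Q i" "h i * Q2 i j = Q j" if "i \<in> A" "j \<in> A - {i}" for i j
  proof -
    have 1: "A - {i, j} = A - {i} - {j}" and 2: "A - {i, j} = A - {j} - {i}" by auto
    show "h j * Q2 i j = Q i"
      unfolding Q_def Q2_def 1 using A that by (intro prod.remove[symmetric]) auto
    show "h i * Q2 i j = Q j"
      unfolding Q_def Q2_def 2 using A that by (intro prod.remove[symmetric]) auto
  qed
  have cQ: "(\<Sum>i\<in>A. \<Sum>j\<in>A - {i}. c i * c j) = 1 - (\<Sum>i\<in>A. c i * c i)"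
  proof -
    have "(\<Sum>i\<in>A. \<Sum>j\<in>A - {i}. c i * c j) = (\<Sum>i\<in>A. c i * (1 - c i))"
      using A c1 by (intro sum.cong) (simp_all add: sum_distrib_left[symmetric] sum_diff1)
    then show ?thesis using c1 by (simp add: algebra_simps sum_subtractf)
  qed
  have cQ1: "(\<Sum>i\<in>A. \<Sum>j\<in>A - {i}. c j * Q i) = (\<Sum>i\<in>A. (1 - c i) * Q i)"
    using A c1 by (intro sum.cong) (simp_all add: sum_distrib_right[symmetric] sum_diff1)
  have cQ2: "(\<Sum>i\<in>A. \<Sum>j\<in>A - {i}. c i * Q j) = (\<Sum>i\<in>A. (1 - c i) * Q i)"
  proof -
    have *: "A - {i} = {j\<in>A. j \<noteq> i}" for i by auto
    have "(\<Sum>i\<in>A. \<Sum>j\<in>A - {i}. c i * Q j) = (\<Sum>j\<in>A. \<Sum>i\<in>A - {j}. c i * Q j)"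
      unfolding * by (subst sum.swap_restrict[OF A A]) (simp add: eq_commute)
    then show ?thesis using cQ1 by simp
  qed
  have "(\<Sum>i\<in>A. fps_X * (split_kernel (x i) * Q i)) =
      (\<Sum>i\<in>A. fps_X * (c i * c i) * g + 2 * fps_X * (c i * Q i) - 2 * c i * g)"
  proof (rule sum.cong)
    fix i assume i: "i \<in> A"
    have "fps_X * (split_kernel (x i) * Q i) =
       (fps_X * c i * (c i * h i + 2) - 2 * (c i * h i)) * Q i"
      unfolding c_def h_def X_mult_split_kernel[symmetric] by (simp add: mult_ac)
    also have "\<dots> = fps_X * (c i * c i) * (h i * Q i) + 2 * fps_X * (c i * Q i) - 2 * c i * (h i * Q i)"
      by (simp add: algebra_simps)
    finally show "fps_X * (split_kernel (x i) * Q i) =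
      fps_X * (c i * c i) * g + 2 * fps_X * (c i * Q i) - 2 * c i * g" unfolding Q[OF i] .
  qed simp
  also have "\<dots> = fps_X * (\<Sum>i\<in>A. c i * c i) * g + 2 * fps_X * (\<Sum>i\<in>A. c i * Q i) - 2 * (\<Sum>i\<in>A. c i) * g"
    by (simp add: sum.distrib sum_subtractf sum_distrib_left sum_distrib_right)
  finally have 1: "fps_X * (\<Sum>i\<in>A. split_kernel (x i) * Q i) =
      fps_X * (\<Sum>i\<in>A. c i * c i) * g + 2 * fps_X * (\<Sum>i\<in>A. c i * Q i) - 2 * g"
    by (simp add: c1 sum_distrib_left)
  have "(\<Sum>i\<in>A. \<Sum>j\<in>A - {i}. fps_const (x i + x j) * exp_quot (x i + x j) * Q2 i j) =
     (\<Sum>i\<in>A. \<Sum>j\<in>A - {i}. c i * Q j + c j * Q i + c i * c j * g)"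
  proof (intro sum.cong refl)
    fix i j assume i: "i \<in> A" and j: "j \<in> A - {i}"
    have "fps_const (x i + x j) * exp_quot (x i + x j) =
        (c i * h i + 1) * (c j * h j + 1) - 1"
      unfolding const_mult_exp_quot c_def h_def fps_exp_add_mult by simp
    then have "fps_const (x i + x j) * exp_quot (x i + x j) * Q2 i j =
       c i * (h i * Q2 i j) + c j * (h j * Q2 i j) + c i * c j * (h i * (h j * Q2 i j))"
      by (simp add: algebra_simps)
    then show "fps_const (x i + x j) * exp_quot (x i + x j) * Q2 i j = c i * Q j + c j * Q i + c i * c j * g"
      using Q[OF i] Q2[OF i j] by simp
  qed
  also have "\<dots> = 2 * (\<Sum>i\<in>A. (1 - c i) * Q i) + (1 - (\<Sum>i\<in>A. c i * c i)) * g"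
    by (simp only: sum.distrib cQ1 cQ2 cQ mult_2 sum_distrib_right[symmetric, where r = g])
  finally have 2: "(\<Sum>i\<in>A. \<Sum>j\<in>A - {i}. fps_const (x i + x j) * exp_quot (x i + x j) * Q2 i j) =
     2 * (\<Sum>i\<in>A. (1 - c i) * Q i) + (1 - (\<Sum>i\<in>A. c i * c i)) * g" .
  have "fps_deriv g = (\<Sum>i\<in>A. c i * (h i * Q i) + Q i)"
    unfolding g_def fps_deriv_prod[OF A] deriv_exp_quot
    by (intro sum.cong) (simp_all add: c_def h_def Q_def algebra_simps)
  also have "\<dots> = (\<Sum>i\<in>A. c i * g + Q i)"
    using Q by (intro sum.cong) simp_all
  finally have 3: "fps_deriv g = g + (\<Sum>i\<in>A. Q i)"
    by (simp add: sum.distrib sum_distrib_right[symmetric] c1)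
  have "fps_X * ((\<Sum>i\<in>A. split_kernel (x i) * Q i) +
      (\<Sum>i\<in>A. \<Sum>j\<in>A - {i}. fps_const (x i + x j) * exp_quot (x i + x j) * Q2 i j))
    = 2 * fps_X * fps_deriv g - fps_X * g - 2 * g"
  proof -
    have 4: "(\<Sum>i\<in>A. (1 - c i) * Q i) = (\<Sum>i\<in>A. Q i) - (\<Sum>i\<in>A. c i * Q i)"
      by (simp add: left_diff_distrib sum_subtractf)
    \<comment> \<open>The remaining ring identity is stated for free variables, so that
      simplification cannot open the sums.\<close>
    have "X * (s + (2 * (q - b) + (1 - a) * g)) = 2 * X * (g + q) - X * g - 2 * g"
      if "X * s = X * a * g + 2 * X * b - 2 * g" for X s a b q :: "real fps"
      unfolding distrib_left[of X s] that by (simp add: algebra_simps)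
    from this[OF 1] show ?thesis unfolding 2 3 4 .
  qed
  then show ?thesis unfolding Q_def Q2_def h_def .
qed

text \<open>The coefficient of order m + 2: the derivative gives 2 (m + 2), and
  \<open>- 2 * g\<close> lowers this to 2 (m + 1), the factor that takes m! to 2 (m + 1)!.\<close>

lemma coefficient_identity:
  fixes x :: "'b \<Rightarrow> real"
  assumes A: "finite A" and s: "(\<Sum>i\<in>A. x i) = 1"
  defines "g \<equiv> \<Prod>i\<in>A. exp_quot (x i)"
  shows "(\<Sum>i\<in>A. fps_nth (split_kernel (x i) * (\<Prod>l\<in>A - {i}. exp_quot (x l))) (Suc m)) +
      (\<Sum>i\<in>A. \<Sum>j\<in>A - {i}. (x i + x j) * fps_nth (exp_quot (x i + x j) * (\<Prod>l\<in>A - {i, j}. exp_quot (x l))) (Suc m))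
    = 2 * (real m + 1) * fps_nth g (Suc (Suc m)) - fps_nth g (Suc m)"
proof -
  define S where "S = (\<Sum>i\<in>A. split_kernel (x i) * (\<Prod>l\<in>A - {i}. exp_quot (x l)))"
  define R where "R = (\<Sum>i\<in>A. \<Sum>j\<in>A - {i}. fps_const (x i + x j) * exp_quot (x i + x j) * (\<Prod>l\<in>A - {i, j}. exp_quot (x l)))"
  have two: "(2 :: real fps) = fps_const 2" by (rule numeral_fps_const)
  have "fps_X * (S + R) = 2 * fps_X * fps_deriv g - fps_X * g - 2 * g"
    unfolding S_def R_def g_def by (rule exp_quot_product_identity[OF A s])
  then have "fps_X * (S + R) = fps_const 2 * (fps_X * fps_deriv g) - fps_X * g - fps_const 2 * g"
    unfolding two mult.assoc .
  moreover have "fps_nth (fps_X * (S + R)) (Suc (Suc m)) = fps_nth S (Suc m) + fps_nth R (Suc m)"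
    by (simp only: fps_add_nth fps_X_mult_nth) simp
  moreover have "fps_nth (fps_const 2 * (fps_X * fps_deriv g) - fps_X * g - fps_const 2 * g) (Suc (Suc m))
    = 2 * (real m + 1) * fps_nth g (Suc (Suc m)) - fps_nth g (Suc m)"
    by (simp only: fps_sub_nth fps_X_mult_nth fps_mult_left_const_nth fps_deriv_nth)
       (simp add: algebra_simps)
  ultimately have "fps_nth S (Suc m) + fps_nth R (Suc m) = 2 * (real m + 1) * fps_nth g (Suc (Suc m)) - fps_nth g (Suc m)"
    by simp
  then show ?thesis
    unfolding S_def R_def fps_sum_nth by (simp only: mult.assoc fps_mult_left_const_nth)
qed

section \<open>Order, sign and measurability of coefficients\<close>

lemma fps_nth_prod_eq_0:
  fixes f :: "'b \<Rightarrow> 'a::comm_ring_1 fps"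
  assumes "finite A" "\<And>i. i \<in> A \<Longrightarrow> fps_nth (f i) 0 = 0" "n < card A"
  shows "fps_nth (\<Prod>i\<in>A. f i) n = 0"
  using assms
proof (induction A arbitrary: n)
  case (insert a A)
  have "fps_nth (f a) i * fps_nth (\<Prod>i\<in>A. f i) (n - i) = 0" if "i \<le> n" for i
    using insert that by (cases "i = 0") auto
  then show ?case using insert.hyps by (simp add: fps_mult_nth)
qed simp

lemma fps_nth_prod_nonneg:
  fixes f :: "'b \<Rightarrow> 'a::linordered_idom fps"
  assumes "\<And>i n. i \<in> A \<Longrightarrow> 0 \<le> fps_nth (f i) n"
  shows "0 \<le> fps_nth (\<Prod>i\<in>A. f i) n"
  using assms
proof (induction A arbitrary: n rule: infinite_finite_induct)
  case (insert a A)
  then show ?case by (auto simp: fps_mult_nth intro!: sum_nonneg mult_nonneg_nonneg)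
qed auto

lemma fps_nth_mult_mono:
  fixes f f' g g' :: "'a::linordered_idom fps"
  assumes "\<And>n. 0 \<le> fps_nth f n" "\<And>n. fps_nth f n \<le> fps_nth f' n"
    and "\<And>n. 0 \<le> fps_nth g n" "\<And>n. fps_nth g n \<le> fps_nth g' n"
  shows "fps_nth (f * g) n \<le> fps_nth (f' * g') n"
  unfolding fps_mult_nth using assms
  by (intro sum_mono mult_mono) (auto intro: order_trans)

lemma measurable_fps_nth_mult:
  assumes "\<And>n. (\<lambda>w. fps_nth (f w) n :: real) \<in> borel_measurable M" "\<And>n. (\<lambda>w. fps_nth (g w) n) \<in> borel_measurable M"
  shows "(\<lambda>w. fps_nth (f w * g w) n) \<in> borel_measurable M"
  unfolding fps_mult_nth using assms by (intro borel_measurable_sum borel_measurable_times)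

lemma measurable_fps_nth_prod:
  assumes "\<And>i n. i \<in> A \<Longrightarrow> (\<lambda>w. fps_nth (f i w) n :: real) \<in> borel_measurable M"
  shows "(\<lambda>w. fps_nth (\<Prod>i\<in>A. f i w) n) \<in> borel_measurable M"
  using assms
proof (induction A arbitrary: n rule: infinite_finite_induct)
  case (insert a A)
  then show ?case by (auto intro!: measurable_fps_nth_mult)
qed auto

lemma measurable_exp_quot [measurable (raw)]:
  assumes [measurable]: "f \<in> borel_measurable M"
  shows "(\<lambda>w. fps_nth (exp_quot (f w)) n) \<in> borel_measurable M"
  unfolding exp_quot_nth by measurable

text \<open>The factors t and y - t cancel the quotients in \<open>exp_quot\<close>, so the
  integrand is a coefficient of (exp(s y) - exp(s t) - exp(s (y - t)) + 1) Q and the integral is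
  elementary. It collects all ways to obtain a part of size y from two pieces.\<close>

lemma nn_integral_split_kernel:
  fixes Q :: "real fps"
  assumes y: "0 < y" and Q: "\<And>n. 0 \<le> fps_nth Q n"
  shows "(\<integral>\<^sup>+t\<in>{0<..<y}. ennreal (t * (y - t) * fps_nth (exp_quot t * exp_quot (y - t) * Q) n) \<partial>lborel) =
    ennreal (fps_nth (split_kernel y * Q) n)"
proof -
  \<comment> \<open>\<open>of_bool (j = 0)\<close> is the coefficient of the summand 1;
    \<open>F\<close> is the termwise primitive of \<open>f\<close>.\<close>
  define f where "f t = (\<Sum>j\<le>n. (y ^ j - t ^ j - (y - t) ^ j + of_bool (j = 0)) / fact j * fps_nth Q (n - j))" for t
  define F where "F t = (\<Sum>j\<le>n. (t * y ^ j - t ^ Suc j / Suc j + (y - t) ^ Suc j / Suc j + t * of_bool (j = 0)) / fact j * fps_nth Q (n - j))" for t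
  have f: "t * (y - t) * fps_nth (exp_quot t * exp_quot (y - t) * Q) n = f t" for t
  proof -
    have "fps_const (t * (y - t)) * (exp_quot t * exp_quot (y - t)) =
        (fps_const t * exp_quot t) * (fps_const (y - t) * exp_quot (y - t))"
      by (simp only: fps_const_mult[symmetric] mult_ac)
    also have "\<dots> = fps_exp y - fps_exp t - fps_exp (y - t) + 1"
      unfolding const_mult_exp_quot by (simp add: algebra_simps fps_exp_add_mult[symmetric])
    finally have *: "fps_const (t * (y - t)) * (exp_quot t * exp_quot (y - t)) = fps_exp y - fps_exp t - fps_exp (y - t) + 1" .
    have "t * (y - t) * fps_nth (exp_quot t * exp_quot (y - t) * Q) n =
        fps_nth ((fps_const (t * (y - t)) * (exp_quot t * exp_quot (y - t))) * Q) n"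
      by (simp only: mult.assoc fps_mult_left_const_nth)
    also have "\<dots> = f t"
      unfolding * f_def fps_mult_nth atMost_atLeast0
      by (intro sum.cong) (auto simp: left_diff_distrib right_diff_distrib diff_divide_distrib)
    finally show ?thesis .
  qed
  have pos: "0 \<le> f t" if "t \<in> {0..y}" for t
    unfolding f[symmetric] using that Q
    by (auto intro!: mult_nonneg_nonneg sum_nonneg simp: fps_mult_nth exp_quot_nth)
  have "(\<integral>\<^sup>+t\<in>{0<..<y}. ennreal (f t) \<partial>lborel) = (\<integral>\<^sup>+t\<in>{0..y}. ennreal (f t) \<partial>lborel)"
  proof (rule nn_integral_cong_AE)
    show "AE t in lborel. ennreal (f t) * indicator {0<..<y} t = ennreal (f t) * indicator {0..y} t"
      using AE_lborel_singleton[of 0] AE_lborel_singleton[of y]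
      by eventually_elim (auto simp: indicator_def)
  qed
  also have "\<dots> = ennreal (F y - F 0)"
  proof (rule nn_integral_FTC_Icc)
    show "f \<in> borel_measurable borel" unfolding f_def by measurable
    show "(F has_real_derivative f t) (at t)" if "t \<in> {0..y}" for t
    proof -
      have "((\<lambda>t. t ^ Suc j / real (Suc j)) has_real_derivative t ^ j) (at t)" for j
        using DERIV_cdivide[OF DERIV_pow[of "Suc j" t], of "real (Suc j)"] by simp
      moreover have "((\<lambda>t. (y - t) ^ Suc j / real (Suc j)) has_real_derivative - ((y - t) ^ j)) (at t)" for j
      proof -
        have "((\<lambda>t. (y - t) ^ Suc j) has_real_derivative real (Suc j) * (y - t) ^ j * (0 - 1)) (at t)"
          by (rule derivative_eq_intros refl)+ simp
        from DERIV_cdivide[OF this, of "real (Suc j)"] show ?thesis by simp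
      qed
      ultimately have "((\<lambda>t. t * y ^ j - t ^ Suc j / real (Suc j) + (y - t) ^ Suc j / real (Suc j) + t * c)
          has_real_derivative 1 * y ^ j - t ^ j + - ((y - t) ^ j) + 1 * c) (at t)" for j and c :: real
        by (intro DERIV_add DERIV_diff DERIV_cmult_right DERIV_ident)
      then show ?thesis
        unfolding F_def f_def
        by (intro DERIV_sum DERIV_cmult_right DERIV_cdivide) simp
    qed
  qed (use pos y in auto)
  also have "F y - F 0 = fps_nth (split_kernel y * Q) n"
    unfolding F_def sum_subtractf[symmetric] fps_mult_nth atMost_atLeast0
  proof (rule sum.cong)
    fix j assume "j \<in> {0..n}"
    have "(y * y ^ j - y ^ Suc j / Suc j + (y - y) ^ Suc j / Suc j + y * of_bool (j = 0)) / fact j -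
       (0 * y ^ j - 0 ^ Suc j / Suc j + (y - 0) ^ Suc j / Suc j + 0 * of_bool (j = 0)) / fact j =
        fps_nth (split_kernel y) j"
    proof -
      have f: "fact j * real (Suc j) = fact (Suc j)"
        by (simp add: algebra_simps)
      then have "y ^ Suc j / real (Suc j) / fact j = y ^ Suc j / fact (Suc j)"
        by (simp only: divide_divide_eq_left mult.commute)
      then show ?thesis
        by (cases "j = 0")
          (simp_all add: split_kernel_def add_divide_distrib diff_divide_distrib f del: fact_Suc of_nat_Suc power_Suc, simp)
    qed
    then show "(y * y ^ j - y ^ Suc j / Suc j + (y - y) ^ Suc j / Suc j + y * of_bool (j = 0)) / fact j * fps_nth Q (n - j) -
       (0 * y ^ j - 0 ^ Suc j / Suc j + (y - 0) ^ Suc j / Suc j + 0 * of_bool (j = 0)) / fact j * fps_nth Q (n - j) =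
        fps_nth (split_kernel y) j * fps_nth Q (n - j)"
      by (simp only: left_diff_distrib[symmetric])
  qed simp
  finally show ?thesis by (simp only: f)
qed

lemma fps_nth_mult_nonneg:
  fixes f g :: "'a::linordered_idom fps"
  shows "(\<And>n. 0 \<le> fps_nth f n) \<Longrightarrow> (\<And>n. 0 \<le> fps_nth g n) \<Longrightarrow> 0 \<le> fps_nth (f * g) n"
  unfolding fps_mult_nth by (intro sum_nonneg mult_nonneg_nonneg)

lemma exp_quot_nonneg: "0 \<le> y \<Longrightarrow> 0 \<le> fps_nth (exp_quot y) n"
  by (simp add: exp_quot_nth)

lemma prod_exp_quot_nonneg:
  "(\<And>i. i \<in> A \<Longrightarrow> 0 \<le> x i) \<Longrightarrow> 0 \<le> fps_nth (\<Prod>i\<in>A. exp_quot (x i)) n"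
  by (intro fps_nth_prod_nonneg exp_quot_nonneg)

text \<open>For n >= 1 the coefficient is y^(n+1) (1 / n! - 2 / (n+1)!), nonnegative because n + 1
  >= 2; the constant coefficient is 2 y - 2 y.\<close>

lemma split_kernel_nonneg: "0 \<le> y \<Longrightarrow> 0 \<le> fps_nth (split_kernel y) n"
proof -
  assume y: "0 \<le> y"
  have f: "fact (Suc n) = (real n + 1) * fact n" by simp
  show ?thesis
  proof (cases "n = 0")
    case False
    then have "2 * y ^ Suc n / ((real n + 1) * fact n) \<le> y ^ Suc n / fact n"
      using y by (simp add: divide_simps mult_right_mono mult.commute)
    then show ?thesis
      using False by (simp add: split_kernel_def f del: fact_Suc)
  qed (simp add: split_kernel_def)
qed

lemma measurable_split_kernel:
  "f \<in> borel_measurable M \<Longrightarrow> (\<lambda>w. fps_nth (split_kernel (f w)) n) \<in> borel_measurable M"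
  by (simp add: split_kernel_def)

lemma fps_exp_minus_1_nonneg: "0 \<le> y \<Longrightarrow> 0 \<le> fps_nth (fps_exp y - 1) n" for y :: real
  by (cases "n = 0") auto

section \<open>Rearrangements and the dual split-merge operator\<close>

text \<open>The supremum in \<open>rearrange\<close> runs over all index sets of one size, and a
  bijection permutes these.\<close>

lemma rearrange_comp_bij:
  assumes "bij p"
  shows "rearrange (x \<circ> p) = rearrange x"
proof
  fix n
  let ?Fs = "{F :: nat set. finite F \<and> card F = Suc n}"
  have *: "finite (f ` F) \<and> card (f ` F) = Suc n" if "bij f" "F \<in> ?Fs" for f F
    using that by (auto simp: card_image bij_is_inj inj_on_subset[OF bij_is_inj])
  have "(`) p ` ?Fs = ?Fs"
  proof (intro equalityI subsetI)
    fix F assume F: "F \<in> ?Fs"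
    have "F = p ` (inv p ` F)"
      using assms by (simp add: image_f_inv_f bij_is_surj)
    moreover have "inv p ` F \<in> ?Fs"
      using *[OF bij_imp_bij_inv[OF assms] F] by simp
    ultimately show "F \<in> (`) p ` ?Fs" by blast
  qed (use *[OF assms] in auto)
  then have "(\<lambda>F. Min (x ` F)) ` ?Fs = (\<lambda>F. Min (x ` F)) ` ((`) p ` ?Fs)"
    by simp
  also have "\<dots> = (\<lambda>F. Min ((x \<circ> p) ` F)) ` ?Fs"
    by (simp add: image_image image_comp)
  finally show "rearrange (x \<circ> p) n = rearrange x n"
    unfolding rearrange_def by simp
qed

text \<open>By \<open>le_rearrange_iff\<close> the counts at positive levels decide every entry, so
  merges and splits can be compared by counting alone.\<close>

lemma rearrange_cong_level:
  assumes x: "x \<longlonglongrightarrow> 0" and y: "y \<longlonglongrightarrow> 0"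
    and nn: "\<And>i. 0 \<le> x i" "\<And>i. 0 \<le> y i"
    and eq: "\<And>t. 0 < t \<Longrightarrow> card {i. t \<le> x i} = card {i. t \<le> y i}"
  shows "rearrange x = rearrange y"
proof
  fix n
  have "t \<le> rearrange x n \<longleftrightarrow> t \<le> rearrange y n" if "0 < t" for t
    using le_rearrange_iff[OF x that] le_rearrange_iff[OF y that] eq[OF that] by simp
  then show "rearrange x n = rearrange y n"
    using rearrange_nonneg[OF null_seq_bdd_above[OF x] nn(1), of n]
      rearrange_nonneg[OF null_seq_bdd_above[OF y] nn(2), of n]
    by (metis order.antisym order_le_less)
qed

lemma rearrange_decseq:
  assumes "decseq x" "x \<longlonglongrightarrow> 0" "\<And>i. 0 \<le> x i"
  shows "rearrange x = x"
  using rearrange_unique[of x x] assms by auto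

lemma tendsto_cons_seq: "x \<longlonglongrightarrow> l \<Longrightarrow> cons_seq a x \<longlonglongrightarrow> l"
  by (subst filterlim_sequentially_Suc[symmetric]) (simp add: cons_seq_def)

lemma tendsto_del_seq: "x \<longlonglongrightarrow> l \<Longrightarrow> del_seq i x \<longlonglongrightarrow> l"
proof -
  assume "x \<longlonglongrightarrow> l"
  then have "(\<lambda>n. x (n + Suc i)) \<longlonglongrightarrow> l" by (rule LIMSEQ_ignore_initial_segment)
  then have "(\<lambda>n. del_seq i x (n + i)) \<longlonglongrightarrow> l" by (simp add: del_seq_def)
  then show ?thesis by (rule LIMSEQ_offset)
qed

lemma tendsto_fun_upd_seq:
  fixes x :: "nat \<Rightarrow> 'a::topological_space"
  shows "x \<longlonglongrightarrow> l \<Longrightarrow> x(i := a) \<longlonglongrightarrow> l"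
proof (rule Lim_transform_eventually)
  show "eventually (\<lambda>n. x n = (x(i := a)) n) sequentially"
    using eventually_gt_at_top[of i] by eventually_elim simp
qed

lemma card_level_cons_seq:
  assumes "y \<longlonglongrightarrow> 0" "0 < t"
  shows "card {n. t \<le> cons_seq a y n} = of_bool (t \<le> a) + card {n. t \<le> y n}"
proof -
  have "{n. t \<le> cons_seq a y n} = (if t \<le> a then {0} else {}) \<union> Suc ` {n. t \<le> y n}"
  proof (rule set_eqI)
    show "n \<in> {n. t \<le> cons_seq a y n} \<longleftrightarrow> n \<in> (if t \<le> a then {0} else {}) \<union> Suc ` {n. t \<le> y n}" for n
      by (cases n) (auto simp: cons_seq_def)
  qed
  also have "card \<dots> = of_bool (t \<le> a) + card {n. t \<le> y n}"
    using finite_level[OF assms] by (subst card_Un_disjoint) (auto simp: card_image)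
  finally show ?thesis .
qed

lemma card_level_del_seq:
  assumes "y \<longlonglongrightarrow> 0" "0 < t"
  shows "card {n. t \<le> y n} = of_bool (t \<le> y i) + card {n. t \<le> del_seq i y n}"
proof -
  define sk where "sk n = (if n < i then n else Suc n)" for n
  have s: "del_seq i y n = y (sk n)" for n by (simp add: del_seq_def sk_def)
  have "{n. t \<le> y n} = (if t \<le> y i then {i} else {}) \<union> sk ` {n. t \<le> y (sk n)}"
  proof (rule set_eqI)
    fix n
    show "n \<in> {n. t \<le> y n} \<longleftrightarrow> n \<in> (if t \<le> y i then {i} else {}) \<union> sk ` {n. t \<le> y (sk n)}"
    proof (cases "n = i")
      case True
      then show ?thesis by (auto split: if_splits)
    next
      case False
      then obtain m where m: "n = sk m"
        by (cases "n < i") (auto simp: sk_def intro: that[of n] that[of "n - 1"])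
      then show ?thesis using False by auto
    qed
  qed
  also have "card \<dots> = of_bool (t \<le> y i) + card {n. t \<le> y (sk n)}"
  proof (subst card_Un_disjoint)
    have "finite {n. t \<le> y (sk n)}"
      using finite_level[OF tendsto_del_seq[OF assms(1), of i] assms(2)] by (simp add: s)
    then show "finite (sk ` {n. t \<le> y (sk n)})" by simp
    have "inj sk" by (auto simp: inj_on_def sk_def split: if_splits)
    then show "card (if t \<le> y i then {i} else {}) + card (sk ` {n. t \<le> y (sk n)}) = of_bool (t \<le> y i) + card {n. t \<le> y (sk n)}"
      by (simp add: card_image inj_on_subset)
  qed (auto simp: sk_def split: if_splits)
  finally show ?thesis by (simp add: s)
qed

lemma card_level_fun_upd:
  fixes y :: "nat \<Rightarrow> real"
  assumes "y \<longlonglongrightarrow> 0" "0 < t"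
  shows "card {n. t \<le> (y(i := a)) n} + of_bool (t \<le> y i) = card {n. t \<le> y n} + of_bool (t \<le> a)"
proof -
  have *: "card {n. t \<le> z n} = of_bool (t \<le> z i) + card {n. n \<noteq> i \<and> t \<le> z n}" if z: "z \<longlonglongrightarrow> 0" for z :: "nat \<Rightarrow> real"
  proof -
    have "{n. t \<le> z n} = (if t \<le> z i then {i} else {}) \<union> {n. n \<noteq> i \<and> t \<le> z n}" by auto
    also have "card \<dots> = of_bool (t \<le> z i) + card {n. n \<noteq> i \<and> t \<le> z n}"
      using finite_level[OF z assms(2)] by (subst card_Un_disjoint) auto
    finally show ?thesis .
  qed
  have "{n. n \<noteq> i \<and> t \<le> (y(i := a)) n} = {n. n \<noteq> i \<and> t \<le> y n}" by auto
  then show ?thesis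
    using *[OF assms(1)] *[OF tendsto_fun_upd_seq[OF assms(1), of i a]] by simp
qed

text \<open>Overwriting entries instead of deleting and shifting leaves all other indices in place,
  so that permutations can be applied to the result. The zero left at j is invisible to the counts
  at positive levels.\<close>

lemma merge_at_eq:
  assumes x: "x \<longlonglongrightarrow> 0" and nn: "\<And>i. 0 \<le> x i" and "i < j"
  shows "merge_at i j x = rearrange (x(i := x i + x j, j := 0))"
  unfolding merge_at_def
proof (rule rearrange_cong_level)
  let ?d = "del_seq j x"
  note lim = tendsto_del_seq tendsto_cons_seq tendsto_fun_upd_seq x
  show "cons_seq (x i + x j) (del_seq i ?d) \<longlonglongrightarrow> 0" "x(i := x i + x j, j := 0) \<longlonglongrightarrow> 0"
    by (intro lim)+
  show "0 \<le> cons_seq (x i + x j) (del_seq i ?d) n" "0 \<le> (x(i := x i + x j, j := 0)) n" for n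
    using nn by (auto intro!: cons_seq_nonneg del_seq_nonneg add_nonneg_nonneg)
  fix t :: real assume t: "0 < t"
  have i: "?d i = x i" using \<open>i < j\<close> by (simp add: del_seq_def)
  have "card {n. t \<le> cons_seq (x i + x j) (del_seq i ?d) n} = of_bool (t \<le> x i + x j) + card {n. t \<le> del_seq i ?d n}"
    by (intro card_level_cons_seq lim t)
  moreover have "card {n. t \<le> ?d n} = of_bool (t \<le> x i) + card {n. t \<le> del_seq i ?d n}"
    using card_level_del_seq[OF tendsto_del_seq[OF x] t, of j i] i by simp
  moreover have "card {n. t \<le> x n} = of_bool (t \<le> x j) + card {n. t \<le> ?d n}"
    by (intro card_level_del_seq lim t)
  moreover have "card {n. t \<le> (x(i := x i + x j)) n} + of_bool (t \<le> x i) = card {n. t \<le> x n} + of_bool (t \<le> x i + x j)"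
    by (intro card_level_fun_upd x t)
  moreover have "card {n. t \<le> (x(i := x i + x j, j := 0)) n} + of_bool (t \<le> x j) = card {n. t \<le> (x(i := x i + x j)) n}"
    using card_level_fun_upd[OF tendsto_fun_upd_seq[OF x] t, of i "x i + x j" j 0] t \<open>i < j\<close> by simp
  ultimately show "card {n. t \<le> cons_seq (x i + x j) (del_seq i ?d) n} = card {n. t \<le> (x(i := x i + x j, j := 0)) n}"
    by linarith
qed

text \<open>The second piece needs a free slot, an index l that carries zero.\<close>

lemma split_at_eq:
  assumes x: "x \<longlonglongrightarrow> 0" and nn: "\<And>i. 0 \<le> x i" and t: "0 \<le> t" "t \<le> x i" and l: "l \<noteq> i" "x l = 0"
  shows "split_at i t x = rearrange (x(i := t, l := x i - t))"
  unfolding split_at_def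
proof (rule rearrange_cong_level)
  note lim = tendsto_del_seq tendsto_cons_seq tendsto_fun_upd_seq x
  show "cons_seq t (cons_seq (x i - t) (del_seq i x)) \<longlonglongrightarrow> 0" "x(i := t, l := x i - t) \<longlonglongrightarrow> 0"
    by (intro lim)+
  show "0 \<le> cons_seq t (cons_seq (x i - t) (del_seq i x)) n" "0 \<le> (x(i := t, l := x i - t)) n" for n
    using nn t by (auto intro!: cons_seq_nonneg del_seq_nonneg)
  fix s :: real assume s: "0 < s"
  have "card {n. s \<le> cons_seq t (cons_seq (x i - t) (del_seq i x)) n} = of_bool (s \<le> t) + card {n. s \<le> cons_seq (x i - t) (del_seq i x) n}"
    by (intro card_level_cons_seq lim s)
  moreover have "card {n. s \<le> cons_seq (x i - t) (del_seq i x) n} = of_bool (s \<le> x i - t) + card {n. s \<le> del_seq i x n}"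
    by (intro card_level_cons_seq lim s)
  moreover have "card {n. s \<le> x n} = of_bool (s \<le> x i) + card {n. s \<le> del_seq i x n}"
    by (intro card_level_del_seq lim s)
  moreover have "card {n. s \<le> (x(i := t)) n} + of_bool (s \<le> x i) = card {n. s \<le> x n} + of_bool (s \<le> t)"
    by (intro card_level_fun_upd x s)
  moreover have "card {n. s \<le> (x(i := t, l := x i - t)) n} = card {n. s \<le> (x(i := t)) n} + of_bool (s \<le> x i - t)"
    using card_level_fun_upd[OF tendsto_fun_upd_seq[OF x] s, of i t l "x i - t"] s l by simp
  ultimately show "card {n. s \<le> cons_seq t (cons_seq (x i - t) (del_seq i x)) n} = card {n. s \<le> (x(i := t, l := x i - t)) n}"
    by linarith
qed

section \<open>Points with exactly k + 1 positive parts\<close>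

definition open_simplex :: "nat \<Rightarrow> (nat \<Rightarrow> real) set" where
  "open_simplex k = {x. (\<forall>i\<le>k. 0 < x i) \<and> (\<forall>i>k. x i = 0) \<and> (\<Sum>i\<le>k. x i) = 1}"

lemma open_simplex_null:
  assumes "x \<in> open_simplex k" shows "x \<longlonglongrightarrow> 0"
proof (rule tendsto_eventually)
  show "eventually (\<lambda>n. x n = 0) sequentially"
    using eventually_gt_at_top[of k] by eventually_elim (use assms in \<open>auto simp: open_simplex_def\<close>)
qed

lemma open_simplex_nonneg: "x \<in> open_simplex k \<Longrightarrow> 0 \<le> x i"
  by (cases "i \<le> k") (auto simp: open_simplex_def less_imp_le)

lemma open_simplex_sums: "x \<in> open_simplex k \<Longrightarrow> x sums 1"
  using sums_finite[of "{..k}" x] by (auto simp: open_simplex_def)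

lemma rearrange_open_simplex_in_Sigma1: "x \<in> open_simplex k \<Longrightarrow> rearrange x \<in> Sigma1"
  by (intro rearrange_in_Sigma1 open_simplex_nonneg open_simplex_sums)

lemma open_simplex_comp:
  assumes x: "x \<in> open_simplex k" and p: "p permutes {..k}"
  shows "x \<circ> p \<in> open_simplex k"
proof -
  have "(\<Sum>i\<le>k. x (p i)) = 1"
    using x sum.permute[OF p, of x] by (simp add: open_simplex_def comp_def)
  moreover have "p i \<le> k" if "i \<le> k" for i
    using permutes_in_image[OF p, of i] that by simp
  moreover have "p i = i" if "i > k" for i
    using permutes_not_in[OF p, of i] that by simp
  ultimately show ?thesis using x by (auto simp: open_simplex_def)
qed

text \<open>Sorting the list of the first k + 1 entries supplies the permutation; the zeros beyond k
  already stand behind all positive entries.\<close>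

lemma open_simplex_rearrange:
  assumes x: "x \<in> open_simplex k"
  obtains p where "p permutes {..k}" "rearrange x = x \<circ> p"
proof -
  define xs where "xs = map x [0..<Suc k]"
  define ys where "ys = rev (sort xs)"
  have "mset ys = mset xs" by (simp add: ys_def)
  then obtain p where p: "p permutes {..<length xs}" "permute_list p xs = ys"
    by (metis mset_eq_permutation)
  have len: "{..<length xs} = {..k}" by (auto simp: xs_def)
  have "p permutes {..k}" using p(1) len by simp
  moreover have "rearrange x = x \<circ> p"
  proof -
    have s: "x \<circ> p \<in> open_simplex k" by (rule open_simplex_comp[OF x]) fact
    have nth: "(x \<circ> p) i = ys ! i" if "i \<le> k" for i
    proof -
      have "p i \<le> k" using permutes_in_image[OF \<open>p permutes {..k}\<close>, of i] that by simp
      then show ?thesis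
        using that p(2) permute_list_nth[OF p(1), of i] by (auto simp: xs_def simp del: upt_Suc)
    qed
    have dec: "sorted_wrt (\<ge>) ys"
      unfolding ys_def by (simp add: sorted_wrt_rev)
    have lys: "length ys = Suc k" by (simp add: ys_def xs_def)
    have "decseq (x \<circ> p)"
    proof (rule decseq_SucI)
      fix n
      show "(x \<circ> p) (Suc n) \<le> (x \<circ> p) n"
      proof (cases "Suc n \<le> k")
        case True
        then show ?thesis
          using nth[of n] nth[of "Suc n"] sorted_wrt_nth_less[OF dec, of n "Suc n"] lys by simp
      next
        case False
        then have "(x \<circ> p) (Suc n) = 0" using s by (auto simp: open_simplex_def)
        then show ?thesis using open_simplex_nonneg[OF s, of n] by simp
      qed
    qed
    then have "rearrange (x \<circ> p) = x \<circ> p"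
      by (intro rearrange_decseq open_simplex_null[OF s] open_simplex_nonneg[OF s])
    then show ?thesis
      using rearrange_comp_bij[OF permutes_bij[OF p(1)]] by simp
  qed
  ultimately show ?thesis by (rule that)
qed

text \<open>The operator T acting on test functions: the integral of h over the law of Tx. With an
  indicator for h this is the set function of \<open>split_merge_law\<close>.\<close>

definition split_merge_dual :: "((nat \<Rightarrow> real) \<Rightarrow> ennreal) \<Rightarrow> (nat \<Rightarrow> real) \<Rightarrow> ennreal" where
  "split_merge_dual h x =
     (\<Sum>j. \<Sum>i<j. ennreal (2 * x i * x j) * h (merge_at i j x)) +
     (\<Sum>i. \<integral>\<^sup>+t\<in>{0..x i}. ennreal (x i) * h (split_at i t x) \<partial>lborel)"

lemma measurable_coordinate:
  fixes f :: "'a \<Rightarrow> nat \<Rightarrow> real"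
  shows "f \<in> M \<rightarrow>\<^sub>M borel \<Longrightarrow> (\<lambda>w. f w i) \<in> borel_measurable M"
  by (rule measurable_product_then_coordinatewise)

lemma measurable_split_merge_dual [measurable]:
  assumes [measurable]: "h \<in> borel_measurable borel"
  shows "split_merge_dual h \<in> borel_measurable borel"
proof -
  have f [measurable]: "fst \<in> borel \<Otimes>\<^sub>M (lborel :: real measure) \<rightarrow>\<^sub>M (borel :: (nat \<Rightarrow> real) measure)"
    by (rule measurable_fst)
  have [measurable]: "(\<lambda>p. split_at i (snd p) (fst p)) \<in> borel \<Otimes>\<^sub>M lborel \<rightarrow>\<^sub>M borel" for i
    by (rule measurable_split_at[OF _ f]) measurable
  have [measurable]: "(\<lambda>p. fst p i :: real) \<in> borel_measurable (borel \<Otimes>\<^sub>M (lborel :: real measure))" for i :: nat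
    by (rule measurable_coordinate[OF f])
  have [measurable]: "(\<lambda>x :: nat \<Rightarrow> real. x i) \<in> borel_measurable borel" for i
    by (rule measurable_product_coordinates)
  have "(\<lambda>p. ennreal (fst p i) * h (split_at i (snd p) (fst p)) * (if 0 \<le> snd p \<and> snd p \<le> fst p i then 1 else 0))
      \<in> borel_measurable (borel \<Otimes>\<^sub>M lborel)" for i
    by measurable
  then have "(\<lambda>x. \<integral>\<^sup>+t\<in>{0..x i}. ennreal (x i) * h (split_at i t x) \<partial>lborel)
      \<in> borel_measurable borel" for i
    by (intro lborel.borel_measurable_nn_integral)
      (simp add: split_beta' indicator_def[of "{0.._}"] of_bool_def)
  moreover have "(\<lambda>x. ennreal (2 * x i * x j) * h (merge_at i j x)) \<in> borel_measurable borel" for i j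
    by measurable
  ultimately show ?thesis
    unfolding split_merge_dual_def
    by (intro borel_measurable_add borel_measurable_suminf_order borel_measurable_sum)
qed

text \<open>Serves to distribute the factor 2 of a merge of i < j over the two orders of the
  pair.\<close>

lemma sum_off_diagonal:
  fixes g :: "nat \<Rightarrow> nat \<Rightarrow> 'a::comm_monoid_add"
  shows "(\<Sum>i\<le>k. \<Sum>j\<in>{..k} - {i}. g i j) = (\<Sum>j\<le>k. \<Sum>i<j. g i j + g j i)"
proof (induction k)
  case (Suc k)
  have "{..Suc k} - {i} = insert (Suc k) ({..k} - {i})" if "i \<le> k" for i using that by auto
  then have "(\<Sum>i\<le>k. \<Sum>j\<in>{..Suc k} - {i}. g i j) = (\<Sum>i\<le>k. g i (Suc k) + (\<Sum>j\<in>{..k} - {i}. g i j))"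
    by (intro sum.cong) auto
  moreover have "{..Suc k} - {Suc k} = {..k}" "{..<Suc k} = {..k}" by auto
  ultimately show ?case
    using Suc by (simp add: sum.distrib ac_simps)
qed simp

text \<open>\<open>merge_dual\<close> and \<open>split_dual\<close> are the two halves of
  \<open>split_merge_dual\<close> at an unsorted point with k + 1 parts: they contain no
  rearrangement, and the piece split off goes to the free index \<open>Suc k\<close>.\<close>

definition merge_dual where
  "merge_dual h k x = (\<Sum>i\<le>k. \<Sum>j\<in>{..k} - {i}. ennreal (x i * x j) * h (x(i := x i + x j, j := 0)))"

definition split_dual where
  "split_dual h k x = (\<Sum>i\<le>k. ennreal (x i) * (\<integral>\<^sup>+t\<in>{0<..<x i}. h (x(i := t, Suc k := x i - t)) \<partial>lborel))"

lemma split_merge_dual_open_simplex: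
  assumes x: "x \<in> open_simplex k" and [measurable]: "h \<in> borel_measurable borel"
  shows "split_merge_dual h x = merge_dual (\<lambda>y. h (rearrange y)) k x + split_dual (\<lambda>y. h (rearrange y)) k x"
proof -
  have zero: "x i = 0" if "k < i" for i using x that by (auto simp: open_simplex_def)
  note nn = open_simplex_nonneg[OF x] and null = open_simplex_null[OF x]
  \<comment> \<open>The two results differ by the transposition of i and j.\<close>
  have sym: "rearrange (x(i := x i + x j, j := 0)) = rearrange (x(j := x j + x i, i := 0))" if "i \<noteq> j" for i j
  proof -
    have "x(i := x i + x j, j := 0) = x(j := x j + x i, i := 0) \<circ> Transposition.transpose i j"
      using that by (auto simp: fun_eq_iff transpose_def)
    then show ?thesis
      using rearrange_comp_bij[OF bij_transpose] by simp
  qed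
  have "(\<Sum>j. \<Sum>i<j. ennreal (2 * x i * x j) * h (merge_at i j x)) =
      (\<Sum>j\<le>k. \<Sum>i<j. ennreal (2 * x i * x j) * h (merge_at i j x))"
    by (rule suminf_finite) (auto simp: zero)
  also have "\<dots> = (\<Sum>j\<le>k. \<Sum>i<j. ennreal (x i * x j) * h (rearrange (x(i := x i + x j, j := 0)))
      + ennreal (x j * x i) * h (rearrange (x(j := x j + x i, i := 0))))"
  proof (intro sum.cong refl)
    fix i j :: nat assume "i \<in> {..<j}"
    then have ij: "i < j" by simp
    then have ij': "i \<noteq> j" by simp
    have "ennreal (2 * x i * x j) = ennreal (x i * x j) + ennreal (x j * x i)"
      using nn by (subst ennreal_plus[symmetric]) (auto simp: mult.commute)
    then show "ennreal (2 * x i * x j) * h (merge_at i j x) =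
      ennreal (x i * x j) * h (rearrange (x(i := x i + x j, j := 0)))
      + ennreal (x j * x i) * h (rearrange (x(j := x j + x i, i := 0)))"
      unfolding merge_at_eq[OF null nn ij] sym[OF ij', symmetric] by (simp only: distrib_right)
  qed
  also have "\<dots> = merge_dual (\<lambda>y. h (rearrange y)) k x"
    unfolding merge_dual_def by (rule sum_off_diagonal[symmetric])
  finally have 1: "(\<Sum>j. \<Sum>i<j. ennreal (2 * x i * x j) * h (merge_at i j x)) = merge_dual (\<lambda>y. h (rearrange y)) k x" .
  have [measurable]: "(\<lambda>t. split_at i t x) \<in> borel \<rightarrow>\<^sub>M borel" for i
    by measurable
  have "(\<Sum>i. \<integral>\<^sup>+t\<in>{0..x i}. ennreal (x i) * h (split_at i t x) \<partial>lborel) =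
      (\<Sum>i\<le>k. \<integral>\<^sup>+t\<in>{0..x i}. ennreal (x i) * h (split_at i t x) \<partial>lborel)"
    by (rule suminf_finite) (auto simp: zero)
  also have "\<dots> = split_dual (\<lambda>y. h (rearrange y)) k x"
    unfolding split_dual_def
  proof (intro sum.cong refl)
    fix i assume i: "i \<in> {..k}"
    have "(\<integral>\<^sup>+t\<in>{0..x i}. ennreal (x i) * h (split_at i t x) \<partial>lborel) =
        (\<integral>\<^sup>+t. ennreal (x i) * (h (split_at i t x) * indicator {0<..<x i} t) \<partial>lborel)"
    \<comment> \<open>Only the endpoints t = 0 and t = x_i are dropped, a null set; both pieces are
      then positive.\<close>
    proof (rule nn_integral_cong_AE)
      show "AE t in lborel. ennreal (x i) * h (split_at i t x) * indicator {0..x i} t =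
          ennreal (x i) * (h (split_at i t x) * indicator {0<..<x i} t)"
        using AE_lborel_singleton[of 0] AE_lborel_singleton[of "x i"]
        by eventually_elim (auto simp: indicator_def)
    qed
    also have "\<dots> = ennreal (x i) * (\<integral>\<^sup>+t\<in>{0<..<x i}. h (split_at i t x) \<partial>lborel)"
      by (rule nn_integral_cmult) measurable
    also have "(\<integral>\<^sup>+t\<in>{0<..<x i}. h (split_at i t x) \<partial>lborel) =
       (\<integral>\<^sup>+t\<in>{0<..<x i}. h (rearrange (x(i := t, Suc k := x i - t))) \<partial>lborel)"
    proof (rule nn_integral_cong)
      fix t
      show "h (split_at i t x) * indicator {0<..<x i} t =
          h (rearrange (x(i := t, Suc k := x i - t))) * indicator {0<..<x i} t"
        using split_at_eq[OF null nn, of t i "Suc k"] i by (auto simp: indicator_def zero)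
    qed
    finally show "(\<integral>\<^sup>+t\<in>{0..x i}. ennreal (x i) * h (split_at i t x) \<partial>lborel) =
       ennreal (x i) * (\<integral>\<^sup>+t\<in>{0<..<x i}. h (rearrange (x(i := t, Suc k := x i - t))) \<partial>lborel)" .
  qed
  finally show ?thesis
    unfolding split_merge_dual_def 1 by simp
qed

lemma fun_upd_comp_inj: "inj p \<Longrightarrow> (f(p i := a)) \<circ> p = (f \<circ> p)(i := a)"
  by (auto simp: fun_eq_iff inj_eq)

lemma merge_dual_comp:
  assumes p: "p permutes {..k}" and h: "\<And>x. h (x \<circ> p) = h x"
  shows "merge_dual h k (x \<circ> p) = merge_dual h k x"
proof -
  have inj: "inj p" using p by (rule permutes_inj)
  have "merge_dual h k (x \<circ> p) = (\<Sum>i\<le>k. \<Sum>j\<in>{..k} - {i}. ennreal (x (p i) * x (p j)) * h (x(p i := x (p i) + x (p j), p j := 0)))"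
    unfolding merge_dual_def
    by (subst (2) h[symmetric]) (simp add: fun_upd_comp_inj[OF inj])
  also have "\<dots> = (\<Sum>i\<le>k. \<Sum>j\<in>{..k} - {p i}. ennreal (x (p i) * x j) * h (x(p i := x (p i) + x j, j := 0)))"
  proof (rule sum.cong)
    fix i assume "i \<in> {..k}"
    have "bij_betw p ({..k} - {i}) ({..k} - {p i})"
      using permutes_imp_bij[OF p] \<open>i \<in> {..k}\<close> by (auto simp: bij_betw_def inj_on_def)
    from sum.reindex_bij_betw[OF this, of "\<lambda>j. ennreal (x (p i) * x j) * h (x(p i := x (p i) + x j, j := 0))"]
    show "(\<Sum>j\<in>{..k} - {i}. ennreal (x (p i) * x (p j)) * h (x(p i := x (p i) + x (p j), p j := 0))) =
       (\<Sum>j\<in>{..k} - {p i}. ennreal (x (p i) * x j) * h (x(p i := x (p i) + x j, j := 0)))" .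
  qed simp
  also have "\<dots> = merge_dual h k x"
    unfolding merge_dual_def
    by (rule sum.permute[OF p, of "\<lambda>i. \<Sum>j\<in>{..k} - {i}. ennreal (x i * x j) * h (x(i := x i + x j, j := 0))", unfolded comp_def, symmetric])
  finally show ?thesis .
qed

lemma split_dual_comp:
  assumes p: "p permutes {..k}" and h: "\<And>x. h (x \<circ> p) = h x"
  shows "split_dual h k (x \<circ> p) = split_dual h k x"
proof -
  have inj: "inj p" using p by (rule permutes_inj)
  have k: "p (Suc k) = Suc k" using permutes_not_in[OF p] by simp
  have "(x \<circ> p)(i := t, Suc k := c) = x(p i := t, Suc k := c) \<circ> p" for i t c
    using fun_upd_comp_inj[OF inj, of "x(p i := t)" "Suc k" c] fun_upd_comp_inj[OF inj, of x i t] by (simp add: k)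
  then have "split_dual h k (x \<circ> p) =
     (\<Sum>i\<le>k. ennreal (x (p i)) * (\<integral>\<^sup>+t\<in>{0<..<x (p i)}. h (x(p i := t, Suc k := x (p i) - t)) \<partial>lborel))"
    unfolding split_dual_def by (simp add: h)
  also have "\<dots> = split_dual h k x"
    unfolding split_dual_def
    by (rule sum.permute[OF p, of "\<lambda>i. ennreal (x i) * (\<integral>\<^sup>+t\<in>{0<..<x i}. h (x(i := t, Suc k := x i - t)) \<partial>lborel)", unfolded comp_def, symmetric])
  finally show ?thesis .
qed

text \<open>Sorting is a permutation of the first k + 1 indices, under which both halves are
  invariant; so the dual at the sorted point can be computed at the unsorted one.\<close>

lemma split_merge_dual_rearrange:
  assumes x: "x \<in> open_simplex k" and h: "h \<in> borel_measurable borel"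
  shows "split_merge_dual h (rearrange x) =
    merge_dual (\<lambda>y. h (rearrange y)) k x + split_dual (\<lambda>y. h (rearrange y)) k x"
proof -
  obtain p where p: "p permutes {..k}" "rearrange x = x \<circ> p"
    using open_simplex_rearrange[OF x] .
  have "rearrange (y \<circ> p) = rearrange y" for y
    by (rule rearrange_comp_bij[OF permutes_bij[OF p(1)]])
  then show ?thesis
    unfolding p(2) split_merge_dual_open_simplex[OF open_simplex_comp[OF x p(1)] h]
    by (simp add: merge_dual_comp[OF p(1)] split_dual_comp[OF p(1)])
qed

section \<open>Integration over the simplex\<close>

abbreviation unit_uniform :: "real measure" where
  "unit_uniform \<equiv> uniform_measure lborel {0..1}"

lemma prob_space_uniform_seq: "prob_space uniform_seq"
  by (intro prob_space_PiM prob_space_uniform_unit)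

lemma space_uniform_seq [simp]: "space uniform_seq = UNIV"
  by (simp add: space_PiM)

lemma AE_unit_uniform: "AE v in unit_uniform. 0 < v \<and> v < 1"
proof -
  have "AE v in lborel. v \<in> {0..1} \<longrightarrow> 0 < v \<and> v < (1::real)"
    using AE_lborel_singleton[of 0] AE_lborel_singleton[of 1]
    by eventually_elim auto
  then show ?thesis by (intro AE_uniform_measureI) auto
qed

lemma AE_uniform_seq: "AE u in uniform_seq. \<forall>i. 0 < u i \<and> u i < 1"
  unfolding AE_all_countable
  by (intro allI AE_PiM_component prob_space_uniform_unit AE_unit_uniform) auto

lemma nn_integral_unit_uniform:
  assumes [measurable]: "f \<in> borel_measurable borel"
  shows "(\<integral>\<^sup>+v. f v \<partial>unit_uniform) = (\<integral>\<^sup>+v\<in>{0<..<1}. f v \<partial>lborel)"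
proof -
  have "(\<integral>\<^sup>+v. f v \<partial>unit_uniform) = (\<integral>\<^sup>+v\<in>{0..1}. f v \<partial>lborel)"
    by (subst nn_integral_uniform_measure) (auto simp: divide_ennreal_def)
  also have "\<dots> = (\<integral>\<^sup>+v\<in>{0<..<1}. f v \<partial>lborel)"
  proof (rule nn_integral_cong_AE)
    show "AE t in lborel. f t * indicator {0..1} t = f t * indicator {0<..<1} t"
      using AE_lborel_singleton[of 0] AE_lborel_singleton[of 1]
      by eventually_elim (auto simp: indicator_def)
  qed
  finally show ?thesis .
qed

text \<open>Since \<Phi> ignores coordinate k of its first argument, \<open>u k\<close> is
  independent of it and may be replaced by a fresh uniform variable.\<close>

lemma nn_integral_resample_coordinate:
  fixes \<Phi> :: "(nat \<Rightarrow> real) \<Rightarrow> real \<Rightarrow> ennreal"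
  assumes m: "(\<lambda>p. \<Phi> (fst p) (snd p)) \<in> borel_measurable (borel \<Otimes>\<^sub>M borel)"
    and indep: "\<And>u v a. \<Phi> (u(k := a)) v = \<Phi> u v"
  shows "(\<integral>\<^sup>+u. \<Phi> u (u k) \<partial>uniform_seq) = (\<integral>\<^sup>+u. \<integral>\<^sup>+v. \<Phi> u v \<partial>unit_uniform \<partial>uniform_seq)"
proof -
  let ?U = "\<lambda>_::nat. unit_uniform"
  define M where "M = Pi\<^sub>M (UNIV - {k}) ?U"
  interpret U: prob_space unit_uniform by (rule prob_space_uniform_unit)
  interpret M: prob_space M unfolding M_def by (intro prob_space_PiM prob_space_uniform_unit)
  interpret pair_sigma_finite M unit_uniform by standard
  have upd: "(\<lambda>(v, X). X(k := v)) \<in> unit_uniform \<Otimes>\<^sub>M M \<rightarrow>\<^sub>M uniform_seq"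
  proof -
    have "(\<lambda>(X, v). X(k := v)) \<in> M \<Otimes>\<^sub>M unit_uniform \<rightarrow>\<^sub>M uniform_seq"
      using measurable_add_dim[of k "UNIV - {k}" ?U] unfolding M_def by (simp add: insert_absorb)
    from measurable_compose[OF measurable_pair_swap' this] show ?thesis
      by (simp add: split_beta')
  qed
  have eq: "distr (unit_uniform \<Otimes>\<^sub>M M) uniform_seq (\<lambda>(v, X). X(k := v)) = uniform_seq"
    using distr_pair_PiM_eq_PiM[of "UNIV - {k}" ?U k] prob_space_uniform_unit
    unfolding M_def by (simp add: insert_absorb)
  \<comment> \<open>Elements of \<open>M\<close> are undefined at k; the value 0 there is a
    placeholder, and \<open>indep\<close> lets it be exchanged for any other.\<close>
  have base [measurable]: "(\<lambda>X. X(k := 0)) \<in> M \<rightarrow>\<^sub>M borel"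
  proof -
    have "(\<lambda>X. (\<lambda>(v, X). X(k := v)) (0, X)) \<in> M \<rightarrow>\<^sub>M uniform_seq"
      by (rule measurable_compose[OF _ upd]) simp
    then show ?thesis by (simp cong: measurable_cong_sets add: sets_uniform_seq)
  qed
  have mc: "(\<lambda>p. \<Phi> (f p) (g p)) \<in> borel_measurable N" if "f \<in> N \<rightarrow>\<^sub>M borel" "g \<in> N \<rightarrow>\<^sub>M borel" for f g and N :: "'z measure"
    using measurable_compose[OF measurable_Pair[OF that] m] by simp
  have mM: "(\<lambda>(X, v). \<Phi> (X(k := 0)) v) \<in> borel_measurable (M \<Otimes>\<^sub>M unit_uniform)"
    unfolding split_beta' by (intro mc measurable_compose[OF measurable_fst base]) simp
  have expand: "(\<integral>\<^sup>+u. f u \<partial>uniform_seq) = (\<integral>\<^sup>+v. \<integral>\<^sup>+X. f (X(k := v)) \<partial>M \<partial>unit_uniform)"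
    if f: "f \<in> borel_measurable borel" for f :: "(nat \<Rightarrow> real) \<Rightarrow> ennreal"
  proof -
    have f': "f \<in> borel_measurable uniform_seq"
      using f by (simp cong: measurable_cong_sets add: sets_uniform_seq)
    have "(\<integral>\<^sup>+u. f u \<partial>uniform_seq) = (\<integral>\<^sup>+p. f ((\<lambda>(v, X). X(k := v)) p) \<partial>(unit_uniform \<Otimes>\<^sub>M M))"
      using f' by (subst eq[symmetric], intro nn_integral_distr[OF upd]) simp
    also have "\<dots> = (\<integral>\<^sup>+v. \<integral>\<^sup>+X. f (X(k := v)) \<partial>M \<partial>unit_uniform)"
      using measurable_compose[OF upd f'] by (subst M.nn_integral_fst[symmetric]) auto
    finally show ?thesis .
  qed
  have "(\<integral>\<^sup>+u. \<Phi> u (u k) \<partial>uniform_seq) = (\<integral>\<^sup>+v. \<integral>\<^sup>+X. \<Phi> (X(k := 0)) v \<partial>M \<partial>unit_uniform)"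
  proof (subst expand)
    show "(\<lambda>u. \<Phi> u (u k)) \<in> borel_measurable borel"
      by (intro mc measurable_coordinate) auto
    have "\<Phi> (X(k := v)) v = \<Phi> (X(k := 0)) v" for X v
      using indep[of "X(k := 0)" v v] by simp
    then show "(\<integral>\<^sup>+v. \<integral>\<^sup>+X. \<Phi> (X(k := v)) ((X(k := v)) k) \<partial>M \<partial>unit_uniform) =
       (\<integral>\<^sup>+v. \<integral>\<^sup>+X. \<Phi> (X(k := 0)) v \<partial>M \<partial>unit_uniform)"
      by simp
  qed
  also have "\<dots> = (\<integral>\<^sup>+X. \<integral>\<^sup>+v. \<Phi> (X(k := 0)) v \<partial>unit_uniform \<partial>M)"
    using Fubini[OF mM] by simp
  also have "\<dots> = (\<integral>\<^sup>+u. \<integral>\<^sup>+v. \<Phi> u v \<partial>unit_uniform \<partial>uniform_seq)"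
  proof (subst expand)
    show "(\<lambda>u. \<integral>\<^sup>+v. \<Phi> u v \<partial>unit_uniform) \<in> borel_measurable borel"
      using m by (intro U.borel_measurable_nn_integral) (simp add: split_beta' cong: measurable_cong_sets)
    have "\<Phi> (X(k := w)) v = \<Phi> (X(k := 0)) v" for X v w
      using indep[of "X(k := 0)" w v] by simp
    then have "(\<integral>\<^sup>+X. \<integral>\<^sup>+v. \<Phi> (X(k := w)) v \<partial>unit_uniform \<partial>M) =
        (\<integral>\<^sup>+X. \<integral>\<^sup>+v. \<Phi> (X(k := 0)) v \<partial>unit_uniform \<partial>M)" for w
      by (intro nn_integral_cong)
    then have "(\<integral>\<^sup>+w. \<integral>\<^sup>+X. \<integral>\<^sup>+v. \<Phi> (X(k := w)) v \<partial>unit_uniform \<partial>M \<partial>unit_uniform) =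
        (\<integral>\<^sup>+w. \<integral>\<^sup>+X. \<integral>\<^sup>+v. \<Phi> (X(k := 0)) v \<partial>unit_uniform \<partial>M \<partial>unit_uniform)"
      by (rule nn_integral_cong)
    also have "\<dots> = (\<integral>\<^sup>+X. \<integral>\<^sup>+v. \<Phi> (X(k := 0)) v \<partial>unit_uniform \<partial>M)"
      unfolding nn_integral_const U.emeasure_space_1 by simp
    finally show "(\<integral>\<^sup>+X. \<integral>\<^sup>+v. \<Phi> (X(k := 0)) v \<partial>unit_uniform \<partial>M) =
       (\<integral>\<^sup>+w. \<integral>\<^sup>+X. \<integral>\<^sup>+v. \<Phi> (X(k := w)) v \<partial>unit_uniform \<partial>M \<partial>unit_uniform)" ..
  qed
  finally show ?thesis .
qed

section \<open>Stick-breaking coordinates on the simplex\<close>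

definition remaining :: "nat \<Rightarrow> (nat \<Rightarrow> real) \<Rightarrow> real" where
  "remaining k u = (\<Prod>i<k. 1 - u i)"

definition fragments :: "nat \<Rightarrow> (nat \<Rightarrow> real) \<Rightarrow> nat \<Rightarrow> real" where
  "fragments k u i = (if i < k then stick_breaking u i else if i = k then remaining k u else 0)"

text \<open>The product is the Jacobian of the stick-breaking coordinates, so that this is the integral
  over \<open>open_simplex k\<close> with respect to Lebesgue measure in any \<open>k\<close> of the \<open>k + 1\<close> coordinates.\<close>

definition simplex_integral :: "nat \<Rightarrow> ((nat \<Rightarrow> real) \<Rightarrow> ennreal) \<Rightarrow> ennreal" where
  "simplex_integral k F = (\<integral>\<^sup>+u. ennreal (\<Prod>j<k. remaining j u) * F (fragments k u) \<partial>uniform_seq)"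

text \<open>The innermost integral over the simplex: the last of k + 1 parts is cut in two, at
  positions k and k + 1.\<close>

definition split_last :: "nat \<Rightarrow> ((nat \<Rightarrow> real) \<Rightarrow> ennreal) \<Rightarrow> (nat \<Rightarrow> real) \<Rightarrow> ennreal" where
  "split_last k F x = (\<integral>\<^sup>+t\<in>{0<..<x k}. F (x(k := t, Suc k := x k - t)) \<partial>lborel)"

lemma stick_breaking_eq: "stick_breaking u k = u k * remaining k u"
  by (simp add: stick_breaking_def remaining_def)

lemma remaining_Suc: "remaining (Suc k) u = (1 - u k) * remaining k u"
  by (simp add: remaining_def)

lemma remaining_0 [simp]: "remaining 0 u = 1"
  by (simp add: remaining_def)

lemma remaining_diff: "remaining (Suc k) u = remaining k u - stick_breaking u k"
  by (simp add: remaining_Suc stick_breaking_eq algebra_simps)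

lemma fragments_Suc:
  "fragments (Suc k) u = (fragments k u)(k := u k * remaining k u, Suc k := (1 - u k) * remaining k u)"
  by (auto simp: fun_eq_iff fragments_def stick_breaking_eq remaining_Suc)

lemma remaining_upd: "i \<le> k \<Longrightarrow> remaining i (u(k := a)) = remaining i u"
  unfolding remaining_def by (intro prod.cong) auto

lemma fragments_upd: "fragments k (u(k := a)) = fragments k u"
  by (auto simp: fun_eq_iff fragments_def stick_breaking_eq remaining_upd)

lemma measurable_remaining [measurable]: "remaining k \<in> borel_measurable borel"
  unfolding remaining_def
  by (intro borel_measurable_prod borel_measurable_diff measurable_coordinate) auto

lemma measurable_fragments [measurable]: "fragments k \<in> borel \<rightarrow>\<^sub>M borel"
proof (rule measurable_coordinatewise_then_product)
  show "(\<lambda>u. fragments k u i) \<in> borel_measurable borel" for i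
    unfolding fragments_def using measurable_coordinate[OF measurable_stick_breaking, of i]
    by (cases "i < k"; cases "i = k") simp_all
qed

lemma measurable_seq_fun_upd:
  assumes "f \<in> M \<rightarrow>\<^sub>M borel" "a \<in> borel_measurable M"
  shows "(\<lambda>w. (f w :: nat \<Rightarrow> real)(i := a w)) \<in> M \<rightarrow>\<^sub>M borel"
proof (rule measurable_coordinatewise_then_product)
  show "(\<lambda>w. ((f w)(i := a w)) j) \<in> borel_measurable M" for j
    using assms measurable_coordinate[OF assms(1), of j] by (cases "i = j") auto
qed

lemma measurable_seq_comp:
  fixes p :: "nat \<Rightarrow> nat"
  shows "(\<lambda>x :: nat \<Rightarrow> real. x \<circ> p) \<in> borel \<rightarrow>\<^sub>M borel"
  by (rule measurable_coordinatewise_then_product) (auto intro: measurable_coordinate)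

lemma measurable_split_integral:
  fixes i l :: nat and F :: "(nat \<Rightarrow> real) \<Rightarrow> ennreal"
  assumes [measurable]: "F \<in> borel_measurable borel"
  shows "(\<lambda>x. \<integral>\<^sup>+t\<in>{0<..<x i}. F (x(i := t, l := x i - t)) \<partial>lborel) \<in> borel_measurable borel"
proof -
  have f: "fst \<in> borel \<Otimes>\<^sub>M (lborel :: real measure) \<rightarrow>\<^sub>M (borel :: (nat \<Rightarrow> real) measure)"
    by (rule measurable_fst)
  have i [measurable]: "(\<lambda>p. fst p i :: real) \<in> borel_measurable (borel \<Otimes>\<^sub>M (lborel :: real measure))"
    by (rule measurable_coordinate[OF f])
  have s [measurable]: "snd \<in> borel_measurable ((borel :: (nat \<Rightarrow> real) measure) \<Otimes>\<^sub>M lborel)"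
    by (rule measurable_compose[OF measurable_snd]) auto
  have [measurable]: "(\<lambda>p. F ((fst p)(i := snd p, l := fst p i - snd p))) \<in> borel_measurable (borel \<Otimes>\<^sub>M lborel)"
    by (rule measurable_compose[OF _ assms]) (intro measurable_seq_fun_upd f s borel_measurable_diff i)
  have "(\<lambda>p. F ((fst p)(i := snd p, l := fst p i - snd p)) * (if 0 < snd p \<and> snd p < fst p i then 1 else 0))
     \<in> borel_measurable (borel \<Otimes>\<^sub>M lborel)"
    by measurable
  then show ?thesis
    by (intro lborel.borel_measurable_nn_integral)
      (simp add: split_beta' indicator_def[of "{0<..<_}"] of_bool_def)
qed

lemma measurable_split_last [measurable]:
  "F \<in> borel_measurable borel \<Longrightarrow> split_last k F \<in> borel_measurable borel"
  unfolding split_last_def by (rule measurable_split_integral)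

lemma AE_remaining_pos: "AE u in uniform_seq. \<forall>k. 0 < remaining k u"
  using AE_uniform_seq by eventually_elim (auto simp: remaining_def intro!: prod_pos)

lemma nn_integral_rescale:
  assumes f [measurable]: "f \<in> borel_measurable borel" and r: "0 < r"
  shows "(\<integral>\<^sup>+t\<in>{0<..<r}. f t \<partial>lborel) = ennreal r * (\<integral>\<^sup>+v. f (v * r) \<partial>unit_uniform)"
proof -
  have "(\<integral>\<^sup>+t\<in>{0<..<r}. f t \<partial>lborel) = ennreal r * (\<integral>\<^sup>+v. f (0 + r * v) * indicator {0<..<r} (0 + r * v) \<partial>lborel)"
    using r by (subst nn_integral_real_affine[where c = r and t = 0]) auto
  also have "(\<lambda>v. f (0 + r * v) * indicator {0<..<r} (0 + r * v)) = (\<lambda>v. f (v * r) * indicator {0<..<1} v)"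
    using r by (auto simp: fun_eq_iff indicator_def mult.commute zero_less_mult_iff)
  also have "(\<integral>\<^sup>+v. f (v * r) * indicator {0<..<1} v \<partial>lborel) = (\<integral>\<^sup>+v. f (v * r) \<partial>unit_uniform)"
    by (rule nn_integral_unit_uniform[symmetric]) measurable
  finally show ?thesis .
qed

lemma simplex_integral_0: "simplex_integral 0 F = F (\<lambda>i. if i = 0 then 1 else 0)"
proof -
  interpret prob_space uniform_seq by (rule prob_space_uniform_seq)
  have "fragments 0 u = (\<lambda>i. if i = 0 then 1 else 0)" for u
    by (auto simp: fragments_def)
  then show ?thesis
    unfolding simplex_integral_def by (simp add: emeasure_space_1[simplified])
qed

text \<open>The Jacobian grows by the factor r = \<open>remaining k u\<close>, which is exactly what
  the substitution t = v r consumes when \<open>u k\<close> is integrated out. The expectation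
  thereby becomes an iterated integral of cuts.\<close>

lemma simplex_integral_Suc:
  assumes F [measurable]: "F \<in> borel_measurable borel"
  shows "simplex_integral (Suc k) F = simplex_integral k (split_last k F)"
proof -
  define \<Phi> where "\<Phi> u v = ennreal ((\<Prod>j<k. remaining j u) * remaining k u) *
      F ((fragments k u)(k := v * remaining k u, Suc k := remaining k u - v * remaining k u))" for u v
  have "simplex_integral (Suc k) F = (\<integral>\<^sup>+u. \<Phi> u (u k) \<partial>uniform_seq)"
    unfolding simplex_integral_def \<Phi>_def fragments_Suc
    by (simp add: left_diff_distrib)
  also have "\<dots> = (\<integral>\<^sup>+u. \<integral>\<^sup>+v. \<Phi> u v \<partial>unit_uniform \<partial>uniform_seq)"
  proof (rule nn_integral_resample_coordinate)
    have [measurable]: "(\<lambda>p. remaining j (fst p)) \<in> borel_measurable (borel \<Otimes>\<^sub>M (borel :: real measure))" for j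
      by measurable
    have "(\<lambda>p. (fragments k (fst p))(k := snd p * remaining k (fst p), Suc k := remaining k (fst p) - snd p * remaining k (fst p)))
        \<in> borel \<Otimes>\<^sub>M borel \<rightarrow>\<^sub>M borel"
      by (intro measurable_seq_fun_upd measurable_compose[OF measurable_fst measurable_fragments]) measurable
    from measurable_compose[OF this F]
    show "(\<lambda>p. \<Phi> (fst p) (snd p)) \<in> borel_measurable (borel \<Otimes>\<^sub>M borel)"
      unfolding \<Phi>_def by measurable
    show "\<Phi> (u(k := a)) v = \<Phi> u v" for u v a
      unfolding \<Phi>_def by (simp add: remaining_upd fragments_upd)
  qed
  also have "\<dots> = simplex_integral k (split_last k F)"
    unfolding simplex_integral_def
  proof (rule nn_integral_cong_AE)
    show "AE u in uniform_seq. (\<integral>\<^sup>+v. \<Phi> u v \<partial>unit_uniform) =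
        ennreal (\<Prod>j<k. remaining j u) * split_last k F (fragments k u)"
      using AE_remaining_pos
    proof eventually_elim
      case (elim u)
      define x where "x = fragments k u"
      define r where "r = remaining k u"
      have xk: "x k = r" by (simp add: x_def r_def fragments_def)
      have "0 < r" using elim by (simp add: r_def)
      have [measurable]: "(\<lambda>t. F (x(k := t, Suc k := r - t))) \<in> borel_measurable borel"
        by (rule measurable_compose[OF _ F]) (intro measurable_seq_fun_upd; simp)
      have m: "(\<lambda>v. F (x(k := v * r, Suc k := r - v * r))) \<in> borel_measurable borel"
        by (rule measurable_compose[OF _ F]) (intro measurable_seq_fun_upd; simp)
      have "(\<integral>\<^sup>+v. \<Phi> u v \<partial>unit_uniform) = ennreal ((\<Prod>j<k. remaining j u) * r) *
          (\<integral>\<^sup>+v. F (x(k := v * r, Suc k := r - v * r)) \<partial>unit_uniform)"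
        unfolding \<Phi>_def x_def[symmetric] r_def[symmetric]
        using m by (intro nn_integral_cmult) (simp cong: measurable_cong_sets)
      also have "ennreal ((\<Prod>j<k. remaining j u) * r) = ennreal (\<Prod>j<k. remaining j u) * ennreal r"
        using elim by (intro ennreal_mult) (auto simp: r_def less_imp_le intro!: prod_nonneg)
      also have "\<dots> * (\<integral>\<^sup>+v. F (x(k := v * r, Suc k := r - v * r)) \<partial>unit_uniform) =
          ennreal (\<Prod>j<k. remaining j u) * split_last k F x"
        unfolding split_last_def xk mult.assoc
        using nn_integral_rescale[of "\<lambda>t. F (x(k := t, Suc k := r - t))" r] \<open>0 < r\<close> by simp
      finally show ?case unfolding x_def .
    qed
  qed
  finally show ?thesis .
qed

lemma AE_fragments: "AE u in uniform_seq. fragments k u \<in> open_simplex k"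
  using AE_uniform_seq AE_remaining_pos
proof eventually_elim
  case (elim u)
  have "(\<Sum>i\<le>k. fragments k u i) = (\<Sum>i<k. stick_breaking u i) + remaining k u"
    unfolding lessThan_Suc_atMost[symmetric] by (simp add: fragments_def)
  also have "\<dots> = 1" by (simp add: stick_breaking_sum remaining_def)
  finally show ?case
    using elim by (auto simp: open_simplex_def fragments_def stick_breaking_eq)
qed

lemma simplex_integral_cong:
  assumes "\<And>x. x \<in> open_simplex k \<Longrightarrow> F x = G x"
  shows "simplex_integral k F = simplex_integral k G"
  unfolding simplex_integral_def
proof (rule nn_integral_cong_AE)
  show "AE u in uniform_seq. ennreal (\<Prod>j<k. remaining j u) * F (fragments k u) =
      ennreal (\<Prod>j<k. remaining j u) * G (fragments k u)"
    using AE_fragments[of k] by eventually_elim (simp add: assms)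
qed

lemma measurable_simplex_integrand:
  assumes [measurable]: "F \<in> borel_measurable borel"
  shows "(\<lambda>u. ennreal (\<Prod>j<k. remaining j u) * F (fragments k u)) \<in> borel_measurable uniform_seq"
  by measurable

lemma simplex_integral_add:
  assumes "F \<in> borel_measurable borel" "G \<in> borel_measurable borel"
  shows "simplex_integral k (\<lambda>x. F x + G x) = simplex_integral k F + simplex_integral k G"
  unfolding simplex_integral_def distrib_left
  by (rule nn_integral_add) (rule measurable_simplex_integrand assms)+

lemma simplex_integral_sum:
  assumes "\<And>i. i \<in> A \<Longrightarrow> F i \<in> borel_measurable borel"
  shows "simplex_integral k (\<lambda>x. \<Sum>i\<in>A. F i x) = (\<Sum>i\<in>A. simplex_integral k (F i))"
  unfolding simplex_integral_def sum_distrib_left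
  by (rule nn_integral_sum) (rule measurable_simplex_integrand[OF assms])

lemma simplex_integral_cmult:
  assumes "F \<in> borel_measurable borel"
  shows "simplex_integral k (\<lambda>x. c * F x) = c * simplex_integral k F"
  unfolding simplex_integral_def
  by (simp only: mult.left_commute[of _ c] nn_integral_cmult[OF measurable_simplex_integrand[OF assms]])

section \<open>Permutation invariance of the simplex integral\<close>

lemma simplex_integral_swap_adjacent:
  assumes "F \<in> borel_measurable borel" "i < k"
  shows "simplex_integral k (\<lambda>x. F (x \<circ> Transposition.transpose i (Suc i))) = simplex_integral k F"
  using assms
proof (induction k arbitrary: F)
  case (Suc n)
  note F [measurable] = Suc.prems(1)
  let ?\<tau> = "Transposition.transpose i (Suc i)"
  have F\<tau> [measurable]: "(\<lambda>x. F (x \<circ> ?\<tau>)) \<in> borel_measurable borel"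
    by (rule measurable_compose[OF measurable_seq_comp F])
  consider "i = n" | "Suc i = n" | "Suc i < n" using Suc.prems(2) by linarith
  then show ?case
  proof cases
    \<comment> \<open>The two pieces of the last cut are exchanged: reflect t to x_n - t.\<close>
    case 1
    have "split_last n (\<lambda>x. F (x \<circ> ?\<tau>)) x = split_last n F x" for x
    proof -
      have *: "x(n := t, Suc n := x n - t) \<circ> ?\<tau> = x(n := x n - t, Suc n := t)" for t
        using 1 by (auto simp: fun_eq_iff Transposition.transpose_def)
      have m [measurable]: "(\<lambda>t. F (x(n := t, Suc n := x n - t))) \<in> borel_measurable borel"
        by (rule measurable_compose[OF _ F]) (intro measurable_seq_fun_upd; simp)
      have "split_last n F x = (\<integral>\<^sup>+t. F (x(n := x n + -1 * t, Suc n := x n - (x n + -1 * t))) * indicator {0<..<x n} (x n + -1 * t) \<partial>lborel)"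
        unfolding split_last_def by (subst nn_integral_real_affine[where c = "-1" and t = "x n"]) auto
      also have "\<dots> = split_last n (\<lambda>x. F (x \<circ> ?\<tau>)) x"
        unfolding split_last_def * by (intro nn_integral_cong) (auto simp: indicator_def)
      finally show ?thesis ..
    qed
    then have "split_last n (\<lambda>x. F (x \<circ> ?\<tau>)) = split_last n F" by (rule ext)
    then show ?thesis
      unfolding simplex_integral_Suc[OF F] simplex_integral_Suc[OF F\<tau>] by (rule arg_cong)
  next
    \<comment> \<open>The last two cuts are involved. Written over t, s > 0 with t + s < c, the
      double integral is symmetric by Fubini.\<close>
    case 2
    have "split_last i (split_last n (\<lambda>x. F (x \<circ> ?\<tau>))) x = split_last i (split_last n F) x" for x
    proof -
      define c where "c = x i"
      define y where "y t s = x(i := t, Suc i := s, Suc (Suc i) := c - t - s)" for t s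
      have y\<tau>: "y t s \<circ> ?\<tau> = y s t" for t s
        by (auto simp: fun_eq_iff Transposition.transpose_def y_def)
      have *: "split_last i (split_last n G) x =
          (\<integral>\<^sup>+t. \<integral>\<^sup>+s. G (y t s) * indicator {0<..} t * indicator {0<..} s * indicator {..<c} (t + s) \<partial>lborel \<partial>lborel)"
        (is "_ = ?R")
        if [measurable]: "G \<in> borel_measurable borel" for G
      proof -
        have "split_last i (split_last n G) x = (\<integral>\<^sup>+t. (\<integral>\<^sup>+s. G (y t s) * indicator {0<..<c - t} s \<partial>lborel) * indicator {0<..<c} t \<partial>lborel)"
          unfolding split_last_def 2[symmetric] c_def[symmetric] by (simp add: y_def)
        also have "\<dots> = ?R"
        proof (rule nn_integral_cong)
          fix t
          have [measurable]: "(\<lambda>s. G (y t s)) \<in> borel_measurable borel"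
            unfolding y_def
            by (rule measurable_compose[OF _ that]) (intro measurable_seq_fun_upd; simp)
          have "(\<integral>\<^sup>+s. G (y t s) * indicator {0<..<c - t} s \<partial>lborel) * indicator {0<..<c} t =
              (\<integral>\<^sup>+s. (G (y t s) * indicator {0<..<c - t} s) * indicator {0<..<c} t \<partial>lborel)"
            by (rule nn_integral_multc[symmetric]) measurable
          also have "\<dots> = (\<integral>\<^sup>+s. G (y t s) * indicator {0<..} t * indicator {0<..} s * indicator {..<c} (t + s) \<partial>lborel)"
            by (intro nn_integral_cong) (auto simp: indicator_def)
          finally show "(\<integral>\<^sup>+s. G (y t s) * indicator {0<..<c - t} s \<partial>lborel) * indicator {0<..<c} t =
            (\<integral>\<^sup>+s. G (y t s) * indicator {0<..} t * indicator {0<..} s * indicator {..<c} (t + s) \<partial>lborel)" .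
        qed
        finally show ?thesis .
      qed
      have "(\<lambda>p. y (fst p) (snd p)) \<in> (lborel :: real measure) \<Otimes>\<^sub>M (lborel :: real measure) \<rightarrow>\<^sub>M borel"
        unfolding y_def by (intro measurable_seq_fun_upd) auto
      from measurable_compose[OF this F]
      have [measurable]: "(\<lambda>p. F (y (fst p) (snd p))) \<in> borel_measurable (lborel \<Otimes>\<^sub>M lborel)" .
      have m: "(\<lambda>(t, s). F (y t s) * indicator {0<..} t * indicator {0<..} s * indicator {..<c} (t + s)) \<in> borel_measurable (lborel \<Otimes>\<^sub>M lborel)"
        unfolding split_beta' by measurable
      show ?thesis
        unfolding *[OF F] *[OF F\<tau>] y\<tau> using lborel_pair.Fubini[OF m]
        by (simp add: ac_simps)
    qed
    then have "split_last i (split_last n (\<lambda>x. F (x \<circ> ?\<tau>))) = split_last i (split_last n F)" by (rule ext)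
    then show ?thesis
      unfolding simplex_integral_Suc[OF F] simplex_integral_Suc[OF F\<tau>] 2[symmetric]
      by (subst (1 2) simplex_integral_Suc) (auto intro: measurable_split_last)
  next
    \<comment> \<open>The transposition moves earlier parts only and commutes with the last cut, so
      the induction hypothesis applies.\<close>
    case 3
    have "split_last n (\<lambda>x. F (x \<circ> ?\<tau>)) x = split_last n F (x \<circ> ?\<tau>)" for x
    proof -
      have "x(n := t, Suc n := c) \<circ> ?\<tau> = (x \<circ> ?\<tau>)(n := t, Suc n := c)" for t c
        using 3 by (auto simp: fun_eq_iff Transposition.transpose_def)
      moreover have "(x \<circ> ?\<tau>) n = x n" using 3 by (auto simp: Transposition.transpose_def)
      ultimately show ?thesis unfolding split_last_def by simp
    qed
    then have eq: "split_last n (\<lambda>x. F (x \<circ> ?\<tau>)) = (\<lambda>x. split_last n F (x \<circ> ?\<tau>))" by (rule ext)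
    show ?thesis
      unfolding simplex_integral_Suc[OF F] simplex_integral_Suc[OF F\<tau>] eq
      by (rule Suc.IH[OF measurable_split_last[OF F]]) (use 3 in simp)
  qed
qed simp

text \<open>The transposition of i and j + 1 is that of i and j conjugated by the adjacent one of j
  and j + 1.\<close>

lemma simplex_integral_swap:
  assumes F: "F \<in> borel_measurable borel" and "i < j" "j \<le> k"
  shows "simplex_integral k (\<lambda>x. F (x \<circ> Transposition.transpose i j)) = simplex_integral k F"
  using assms
proof (induction j arbitrary: F)
  case (Suc j)
  show ?case
  proof (cases "i = j")
    case True
    show ?thesis
      unfolding True by (rule simplex_integral_swap_adjacent) (use Suc.prems in auto)
  next
    case False
    let ?a = "Transposition.transpose j (Suc j)" and ?b = "Transposition.transpose i j"
    have ij: "i < j" using False Suc.prems by simp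
    have m: "(\<lambda>x. G (x \<circ> p)) \<in> borel_measurable borel" if "G \<in> borel_measurable borel" for G :: "(nat \<Rightarrow> real) \<Rightarrow> ennreal" and p :: "nat \<Rightarrow> nat"
      by (rule measurable_compose[OF measurable_seq_comp that])
    have "x \<circ> Transposition.transpose i (Suc j) = ((x \<circ> ?a) \<circ> ?b) \<circ> ?a" for x :: "nat \<Rightarrow> real"
      using ij by (auto simp: fun_eq_iff Transposition.transpose_def)
    then have "simplex_integral k (\<lambda>x. F (x \<circ> Transposition.transpose i (Suc j))) =
        simplex_integral k (\<lambda>x. F (((x \<circ> ?a) \<circ> ?b) \<circ> ?a))" by simp
    also have "\<dots> = simplex_integral k (\<lambda>x. F ((x \<circ> ?b) \<circ> ?a))"
      using Suc.prems by (intro simplex_integral_swap_adjacent[of "\<lambda>x. F ((x \<circ> ?b) \<circ> ?a)"] m) auto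
    also have "\<dots> = simplex_integral k (\<lambda>x. F (x \<circ> ?a))"
      using Suc.prems ij by (intro Suc.IH[of "\<lambda>x. F (x \<circ> ?a)"] m) auto
    also have "\<dots> = simplex_integral k F"
      using Suc.prems by (intro simplex_integral_swap_adjacent) auto
    finally show ?thesis .
  qed
qed simp

lemma simplex_integral_permute:
  assumes "p permutes {..k}" and "F \<in> borel_measurable borel"
  shows "simplex_integral k (\<lambda>x. F (x \<circ> p)) = simplex_integral k F"
proof -
  have "finite {..k}" by simp
  from assms(1) this have "\<forall>F\<in>borel_measurable borel. simplex_integral k (\<lambda>x. F (x \<circ> p)) = simplex_integral k F"
  proof (induction rule: permutes_induct)
    case (swap a b p)
    show ?case
    proof
      fix F :: "(nat \<Rightarrow> real) \<Rightarrow> ennreal" assume F: "F \<in> borel_measurable borel"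
      have m: "(\<lambda>x. F (x \<circ> p)) \<in> borel_measurable borel"
        by (rule measurable_compose[OF measurable_seq_comp F])
      have "simplex_integral k (\<lambda>x. F ((x \<circ> Transposition.transpose a b) \<circ> p)) = simplex_integral k (\<lambda>x. F (x \<circ> p))"
        using simplex_integral_swap[OF m, of a b k] simplex_integral_swap[OF m, of b a k] swap
        by (cases a b rule: linorder_cases) (auto simp: transpose_commute[of b a])
      then show "simplex_integral k (\<lambda>x. F (x \<circ> (Transposition.transpose a b \<circ> p))) = simplex_integral k F"
        using swap F by (simp add: comp_assoc)
    qed
  qed simp
  with assms(2) show ?thesis by blast
qed

lemma measurable_coord: "(\<lambda>x :: nat \<Rightarrow> real. x i) \<in> borel_measurable borel"
  by (rule measurable_product_coordinates)

lemma measurable_stick: "(\<lambda>u. stick_breaking u i) \<in> borel_measurable borel"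
  by (rule measurable_coordinate[OF measurable_stick_breaking])

lemma stick_breaking_upd: "i < k \<Longrightarrow> stick_breaking (u(k := a)) i = stick_breaking u i"
  by (simp add: stick_breaking_eq remaining_upd)

text \<open>The denominators of the size-biased ordering are these tails, hence remaining lengths of
  the stick, the same quantities that make up the Jacobian.\<close>

lemma sum_fragments: "(\<Sum>l=i..k. fragments k u l) = remaining i u" if "i \<le> k"
proof -
  have *: "(\<Sum>l<i. fragments k u l) = 1 - remaining i u"
    using that stick_breaking_sum[of u i] by (simp add: fragments_def remaining_def)
  have "(\<Sum>l\<le>k. fragments k u l) = 1 - remaining k u + remaining k u"
    unfolding lessThan_Suc_atMost[symmetric]
    using stick_breaking_sum[of u k] by (simp add: fragments_def remaining_def)
  moreover have "{..k} = {..<i} \<union> {i..k}" using that by auto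
  then have "(\<Sum>l\<le>k. fragments k u l) = (\<Sum>l<i. fragments k u l) + (\<Sum>l=i..k. fragments k u l)"
    by (simp only:) (rule sum.union_disjoint; auto)
  ultimately show ?thesis using * by simp
qed

section \<open>Split and merge as transformations of densities\<close>

definition weight :: "nat \<Rightarrow> nat \<Rightarrow> (nat \<Rightarrow> real) \<Rightarrow> real" where
  "weight k m x = fact m * fps_nth (\<Prod>i\<le>k. exp_quot (x i)) (Suc m)"

text \<open>The names refer to moves backwards from x: what flows into x through a merge is found by
  splitting a part of x, and what flows in through a split by merging two parts of x.\<close>

definition split_weight :: "nat \<Rightarrow> nat \<Rightarrow> nat \<Rightarrow> (nat \<Rightarrow> real) \<Rightarrow> real" where
  "split_weight k m i x =
     fact m * fps_nth (split_kernel (x i) * (\<Prod>l\<in>{..k} - {i}. exp_quot (x l))) (Suc m)"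

text \<open>The factor x_i + x_j is the rate at which the part of this size is split, per unit of
  t.\<close>

definition merge_weight :: "nat \<Rightarrow> nat \<Rightarrow> nat \<Rightarrow> nat \<Rightarrow> (nat \<Rightarrow> real) \<Rightarrow> real" where
  "merge_weight k m i j x = (x i + x j) *
     (fact m * fps_nth (exp_quot (x i + x j) * (\<Prod>l\<in>{..k} - {i, j}. exp_quot (x l))) (Suc m))"

lemma weight_identity:
  assumes "x \<in> open_simplex k"
  shows "(\<Sum>i\<le>k. split_weight k m i x) + (\<Sum>i\<le>k. \<Sum>j\<in>{..k} - {i}. merge_weight k m i j x) + weight k m x =
    2 * weight k (Suc m) x"
proof -
  have "(\<Sum>i\<le>k. x i) = 1" using assms by (simp add: open_simplex_def)
  note id = coefficient_identity[OF finite_atMost this, of m]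
  have "(\<Sum>i\<le>k. split_weight k m i x) + (\<Sum>i\<le>k. \<Sum>j\<in>{..k} - {i}. merge_weight k m i j x) =
     fact m * ((\<Sum>i\<le>k. fps_nth (split_kernel (x i) * (\<Prod>l\<in>{..k} - {i}. exp_quot (x l))) (Suc m)) +
      (\<Sum>i\<le>k. \<Sum>j\<in>{..k} - {i}. (x i + x j) * fps_nth (exp_quot (x i + x j) * (\<Prod>l\<in>{..k} - {i, j}. exp_quot (x l))) (Suc m)))"
    unfolding split_weight_def merge_weight_def distrib_left sum_distrib_left by (simp only: mult.left_commute)
  then show ?thesis
    unfolding id weight_def by (simp add: algebra_simps)
qed

lemma weight_nonneg: "(\<And>i. 0 \<le> x i) \<Longrightarrow> 0 \<le> weight k m x"
  unfolding weight_def by (intro mult_nonneg_nonneg prod_exp_quot_nonneg) auto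

lemma merge_weight_nonneg: "(\<And>i. 0 \<le> x i) \<Longrightarrow> 0 \<le> merge_weight k m i j x"
  unfolding merge_weight_def fps_mult_nth
  by (intro mult_nonneg_nonneg sum_nonneg prod_exp_quot_nonneg exp_quot_nonneg add_nonneg_nonneg) auto

lemma split_weight_nonneg: "(\<And>i. 0 \<le> x i) \<Longrightarrow> 0 \<le> split_weight k m i x"
  unfolding split_weight_def fps_mult_nth
  by (intro mult_nonneg_nonneg sum_nonneg prod_exp_quot_nonneg split_kernel_nonneg) auto

text \<open>Each \<open>exp_quot\<close> has order at least one. In terms of the process, m steps
  from a single part leave at most m + 1 parts.\<close>

lemma weight_eq_0: "m < k \<Longrightarrow> weight k m x = 0"
  unfolding weight_def by (subst fps_nth_prod_eq_0) (auto simp: exp_quot_nth)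

lemma measurable_weight [measurable]: "weight k m \<in> borel_measurable borel"
  unfolding weight_def
  by (intro borel_measurable_times measurable_fps_nth_prod measurable_exp_quot measurable_coord) auto

lemma measurable_split_weight [measurable]: "split_weight k m i \<in> borel_measurable borel"
  unfolding split_weight_def
  by (intro borel_measurable_times measurable_fps_nth_mult measurable_fps_nth_prod
      measurable_exp_quot measurable_split_kernel measurable_coord) auto

lemma measurable_merge_weight [measurable]: "merge_weight k m i j \<in> borel_measurable borel"
  unfolding merge_weight_def
  by (intro borel_measurable_times measurable_fps_nth_mult measurable_fps_nth_prod
      borel_measurable_add measurable_exp_quot measurable_coord) auto

lemma prod_permutes_diff:
  assumes p: "p permutes A" and B: "B \<subseteq> A"
  shows "(\<Prod>l\<in>A - B. g (p l)) = (\<Prod>l\<in>A - p ` B. g l)"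
proof (rule prod.reindex_bij_betw)
  have "p ` (A - B) = A - p ` B"
    using permutes_inj[OF p] permutes_image[OF p] by (simp add: image_set_diff)
  then show "bij_betw p (A - B) (A - p ` B)"
    using permutes_inj_on[OF p] by (auto simp: bij_betw_def)
qed

lemma weight_comp: "p permutes {..k} \<Longrightarrow> weight k m (x \<circ> p) = weight k m x"
  using prod_permutes_diff[of p "{..k}" "{}" "\<lambda>l. exp_quot (x l)"] by (simp add: weight_def)

lemma split_weight_comp:
  "p permutes {..k} \<Longrightarrow> i \<le> k \<Longrightarrow> split_weight k m i (x \<circ> p) = split_weight k m (p i) x"
  using prod_permutes_diff[of p "{..k}" "{i}" "\<lambda>l. exp_quot (x l)"] by (simp add: split_weight_def)

lemma merge_weight_comp:
  "p permutes {..k} \<Longrightarrow> i \<le> k \<Longrightarrow> j \<le> k \<Longrightarrow> merge_weight k m i j (x \<circ> p) = merge_weight k m (p i) (p j) x"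
  using prod_permutes_diff[of p "{..k}" "{i, j}" "\<lambda>l. exp_quot (x l)"] by (simp add: merge_weight_def)

text \<open>Terms that permutations carry into each other have equal integrals. The last index is
  chosen as representative because it is the one that \<open>split_last\<close> reaches.\<close>

lemma simplex_integral_sum_single:
  assumes m: "\<And>i. i \<le> k \<Longrightarrow> \<Phi> i \<in> borel_measurable borel"
    and eq: "\<And>p i x. p permutes {..k} \<Longrightarrow> i \<le> k \<Longrightarrow> \<Phi> i (x \<circ> p) = \<Phi> (p i) x"
  shows "(\<Sum>i\<le>k. simplex_integral k (\<Phi> i)) = of_nat (Suc k) * simplex_integral k (\<Phi> k)"
proof -
  have *: "simplex_integral k (\<Phi> i) = simplex_integral k (\<Phi> k)" if i: "i \<le> k" for i
  proof -
    have p: "Transposition.transpose i k permutes {..k}"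
      using i by (intro permutes_swap_id) auto
    have "\<Phi> i = (\<lambda>x. \<Phi> k (x \<circ> Transposition.transpose i k))"
      using eq[OF p, of k] by simp
    then show ?thesis
      using simplex_integral_permute[OF p m[of k]] by simp
  qed
  have "(\<Sum>i\<le>k. simplex_integral k (\<Phi> i)) = (\<Sum>i\<le>k. simplex_integral k (\<Phi> k))"
    by (rule sum.cong[OF refl], rule *) simp
  then show ?thesis by (simp del: of_nat_Suc)
qed

lemma simplex_integral_sum_pairs:
  assumes m: "\<And>i j. i \<le> Suc k \<Longrightarrow> j \<le> Suc k \<Longrightarrow> \<Phi> i j \<in> borel_measurable borel"
    and eq: "\<And>p i j x. p permutes {..Suc k} \<Longrightarrow> i \<le> Suc k \<Longrightarrow> j \<le> Suc k \<Longrightarrow> \<Phi> i j (x \<circ> p) = \<Phi> (p i) (p j) x"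
  shows "(\<Sum>i\<le>Suc k. \<Sum>j\<in>{..Suc k} - {i}. simplex_integral (Suc k) (\<Phi> i j)) =
    of_nat (Suc k) * of_nat (Suc (Suc k)) * simplex_integral (Suc k) (\<Phi> k (Suc k))"
proof -
  have *: "simplex_integral (Suc k) (\<Phi> i j) = simplex_integral (Suc k) (\<Phi> k (Suc k))"
    if i: "i \<le> Suc k" and j: "j \<in> {..Suc k} - {i}" for i j
  proof -
    \<comment> \<open>q is where the first transposition puts \<open>Suc k\<close>. Exchanging q
      with j leaves i fixed, so p sends k to i and \<open>Suc k\<close> to j.\<close>
    define q where "q = Transposition.transpose k i (Suc k)"
    define p where "p = Transposition.transpose q j \<circ> Transposition.transpose k i"
    have q: "q \<le> Suc k" "q \<noteq> i"
      using i by (auto simp: q_def Transposition.transpose_def)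
    have p: "p permutes {..Suc k}"
      unfolding p_def using i j q by (intro permutes_compose permutes_swap_id) auto
    have "p k = i" "p (Suc k) = j"
      using q j by (auto simp: p_def q_def[symmetric])
    then have "\<Phi> i j = (\<lambda>x. \<Phi> k (Suc k) (x \<circ> p))"
      using eq[OF p, of k "Suc k"] by simp
    then show ?thesis
      using simplex_integral_permute[OF p m[of k "Suc k"]] by simp
  qed
  have "(\<Sum>i\<le>Suc k. \<Sum>j\<in>{..Suc k} - {i}. simplex_integral (Suc k) (\<Phi> i j)) =
     (\<Sum>i\<le>Suc k. \<Sum>j\<in>{..Suc k} - {i}. simplex_integral (Suc k) (\<Phi> k (Suc k)))"
    by (intro sum.cong refl, rule *) (auto simp only: atMost_iff)
  also have "\<dots> = (\<Sum>i\<le>Suc k. of_nat (Suc k) * simplex_integral (Suc k) (\<Phi> k (Suc k)))"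
    by (intro sum.cong refl) (auto simp: card_Diff_singleton simp del: of_nat_Suc)
  also have "\<dots> = of_nat (Suc k) * of_nat (Suc (Suc k)) * simplex_integral (Suc k) (\<Phi> k (Suc k))"
    by (simp add: mult.left_commute mult.assoc del: of_nat_Suc)
  finally show ?thesis .
qed

text \<open>Abstracts the test functions \<open>h (rearrange x)\<close>, which do not see the order
  of the parts.\<close>

locale symmetric_function =
  fixes h :: "(nat \<Rightarrow> real) \<Rightarrow> ennreal"
  assumes measurable_h [measurable]: "h \<in> borel_measurable borel"
    and symmetric: "bij p \<Longrightarrow> h (x \<circ> p) = h x"
begin

lemma measurable_merged:
  "(\<lambda>x. h (x(i := x i + x j, j := 0))) \<in> borel_measurable borel"
  by (rule measurable_compose[OF _ measurable_h])
    (intro measurable_seq_fun_upd borel_measurable_add measurable_coord; simp)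

lemma measurable_h_times:
  "f \<in> borel_measurable borel \<Longrightarrow> (\<lambda>x. ennreal (f x) * h x) \<in> borel_measurable borel"
  by (intro borel_measurable_times_ennreal measurable_compose[OF _ measurable_ennreal] measurable_h)

section \<open>Adjoints of merging and splitting\<close>

lemma split_weight_symmetrize:
  "simplex_integral k (\<lambda>x. ennreal (\<Sum>i\<le>k. split_weight k m i x) * h x) =
    of_nat (Suc k) * simplex_integral k (\<lambda>x. ennreal (split_weight k m k x) * h x)"
proof -
  have "simplex_integral k (\<lambda>x. ennreal (\<Sum>i\<le>k. split_weight k m i x) * h x) =
      simplex_integral k (\<lambda>x. \<Sum>i\<le>k. ennreal (split_weight k m i x) * h x)"
  proof (rule simplex_integral_cong)
    fix x assume x: "x \<in> open_simplex k"
    have "ennreal (\<Sum>i\<le>k. split_weight k m i x) = (\<Sum>i\<le>k. ennreal (split_weight k m i x))"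
      using open_simplex_nonneg[OF x] by (intro sum_ennreal[symmetric] split_weight_nonneg)
    then show "ennreal (\<Sum>i\<le>k. split_weight k m i x) * h x = (\<Sum>i\<le>k. ennreal (split_weight k m i x) * h x)"
      by (simp only: sum_distrib_right)
  qed
  also have "\<dots> = (\<Sum>i\<le>k. simplex_integral k (\<lambda>x. ennreal (split_weight k m i x) * h x))"
    by (intro simplex_integral_sum measurable_h_times measurable_split_weight)
  also have "\<dots> = of_nat (Suc k) * simplex_integral k (\<lambda>x. ennreal (split_weight k m k x) * h x)"
    by (rule simplex_integral_sum_single)
      (auto intro: measurable_h_times simp: split_weight_comp symmetric permutes_bij simp del: o_apply)
  finally show ?thesis .
qed

lemma merge_weight_symmetrize:
  "simplex_integral (Suc k) (\<lambda>x. ennreal (\<Sum>i\<le>Suc k. \<Sum>j\<in>{..Suc k} - {i}. merge_weight (Suc k) m i j x) * h x) =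
    of_nat (Suc k) * of_nat (Suc (Suc k)) *
      simplex_integral (Suc k) (\<lambda>x. ennreal (merge_weight (Suc k) m k (Suc k) x) * h x)"
proof -
  have "simplex_integral (Suc k) (\<lambda>x. ennreal (\<Sum>i\<le>Suc k. \<Sum>j\<in>{..Suc k} - {i}. merge_weight (Suc k) m i j x) * h x) =
      simplex_integral (Suc k) (\<lambda>x. \<Sum>i\<le>Suc k. \<Sum>j\<in>{..Suc k} - {i}. ennreal (merge_weight (Suc k) m i j x) * h x)"
  proof (rule simplex_integral_cong)
    fix x assume x: "x \<in> open_simplex (Suc k)"
    have nn: "0 \<le> merge_weight (Suc k) m i j x" for i j
      using open_simplex_nonneg[OF x] by (rule merge_weight_nonneg)
    have "ennreal (\<Sum>i\<le>Suc k. \<Sum>j\<in>{..Suc k} - {i}. merge_weight (Suc k) m i j x) =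
        (\<Sum>i\<le>Suc k. ennreal (\<Sum>j\<in>{..Suc k} - {i}. merge_weight (Suc k) m i j x))"
      by (intro sum_ennreal[symmetric] sum_nonneg nn)
    also have "\<dots> = (\<Sum>i\<le>Suc k. \<Sum>j\<in>{..Suc k} - {i}. ennreal (merge_weight (Suc k) m i j x))"
      by (intro sum.cong refl sum_ennreal[symmetric] nn)
    finally show "ennreal (\<Sum>i\<le>Suc k. \<Sum>j\<in>{..Suc k} - {i}. merge_weight (Suc k) m i j x) * h x =
        (\<Sum>i\<le>Suc k. \<Sum>j\<in>{..Suc k} - {i}. ennreal (merge_weight (Suc k) m i j x) * h x)"
      by (simp only: sum_distrib_right)
  qed
  also have "\<dots> = (\<Sum>i\<le>Suc k. \<Sum>j\<in>{..Suc k} - {i}. simplex_integral (Suc k) (\<lambda>x. ennreal (merge_weight (Suc k) m i j x) * h x))"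
    by (subst simplex_integral_sum, intro borel_measurable_sum measurable_h_times measurable_merge_weight)
      (intro sum.cong refl simplex_integral_sum measurable_h_times measurable_merge_weight)
  also have "\<dots> = of_nat (Suc k) * of_nat (Suc (Suc k)) *
      simplex_integral (Suc k) (\<lambda>x. ennreal (merge_weight (Suc k) m k (Suc k) x) * h x)"
    by (rule simplex_integral_sum_pairs)
      (auto intro: measurable_h_times simp: merge_weight_comp symmetric permutes_bij simp del: o_apply)
  finally show ?thesis .
qed

lemma measurable_merge_dual: "merge_dual h k \<in> borel_measurable borel"
  unfolding merge_dual_def
  by (intro borel_measurable_sum borel_measurable_times_ennreal measurable_compose[OF _ measurable_ennreal]
      borel_measurable_times measurable_coord measurable_merged)

lemma measurable_split_dual: "split_dual h k \<in> borel_measurable borel"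
  unfolding split_dual_def
  by (intro borel_measurable_sum borel_measurable_times_ennreal measurable_compose[OF _ measurable_ennreal]
      measurable_coord measurable_split_integral measurable_h)

text \<open>By symmetry it suffices to merge the parts k and \<open>Suc k\<close>. In the iterated
  integral these are the pieces of the last cut, so merging them restores x, h is constant along the
  inner integral, and \<open>nn_integral_split_kernel\<close> evaluates the rest.\<close>

lemma simplex_integral_merge_dual:
  "simplex_integral (Suc k) (\<lambda>x. ennreal (weight (Suc k) m x) * merge_dual h (Suc k) x) =
    of_nat (Suc k) * of_nat (Suc (Suc k)) *
      simplex_integral k (\<lambda>x. ennreal (split_weight k m k x) * h x)"
proof -
  define \<Phi> where "\<Phi> i j x = ennreal (weight (Suc k) m x) *
      (ennreal (x i * x j) * h (x(i := x i + x j, j := 0)))" for i j x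
  have m\<Phi>: "\<Phi> i j \<in> borel_measurable borel" for i j
    unfolding \<Phi>_def
    by (intro borel_measurable_times_ennreal measurable_compose[OF _ measurable_ennreal]
      borel_measurable_times measurable_coord measurable_merged measurable_weight)
  have "simplex_integral (Suc k) (\<lambda>x. ennreal (weight (Suc k) m x) * merge_dual h (Suc k) x) =
     simplex_integral (Suc k) (\<lambda>x. \<Sum>i\<le>Suc k. \<Sum>j\<in>{..Suc k} - {i}. \<Phi> i j x)"
    by (simp only: merge_dual_def \<Phi>_def sum_distrib_left)
  also have "\<dots> = (\<Sum>i\<le>Suc k. \<Sum>j\<in>{..Suc k} - {i}. simplex_integral (Suc k) (\<Phi> i j))"
    by (subst simplex_integral_sum, intro borel_measurable_sum m\<Phi>) (intro sum.cong refl simplex_integral_sum m\<Phi>)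
  also have "\<dots> = of_nat (Suc k) * of_nat (Suc (Suc k)) * simplex_integral (Suc k) (\<Phi> k (Suc k))"
  proof (rule simplex_integral_sum_pairs)
    fix p i j and x :: "nat \<Rightarrow> real"
    assume p: "p permutes {..Suc k}"
    have inj: "inj p" using p by (rule permutes_inj)
    have "(x \<circ> p)(i := a, j := b) = x(p i := a, p j := b) \<circ> p" for a b
      by (simp only: fun_upd_comp_inj[OF inj])
    then show "\<Phi> i j (x \<circ> p) = \<Phi> (p i) (p j) x"
      unfolding \<Phi>_def weight_comp[OF p] by (simp add: symmetric[OF permutes_bij[OF p]] del: fun_upd_apply)
  qed (rule m\<Phi>)
  also have "simplex_integral (Suc k) (\<Phi> k (Suc k)) = simplex_integral k (split_last k (\<Phi> k (Suc k)))"
    by (rule simplex_integral_Suc[OF m\<Phi>])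
  also have "\<dots> = simplex_integral k (\<lambda>x. ennreal (split_weight k m k x) * h x)"
  proof (rule simplex_integral_cong)
    fix x assume x: "x \<in> open_simplex k"
    define Q where "Q = (\<Prod>l\<in>{..k} - {k}. exp_quot (x l))"
    have Q: "0 \<le> fps_nth Q n" for n
      unfolding Q_def using open_simplex_nonneg[OF x] by (rule prod_exp_quot_nonneg)
    have xk: "0 < x k" "x (Suc k) = 0" using x by (auto simp: open_simplex_def)
    have "split_last k (\<Phi> k (Suc k)) x = (\<integral>\<^sup>+t. ennreal (fact m) * h x *
        (ennreal (t * (x k - t) * fps_nth (exp_quot t * exp_quot (x k - t) * Q) (Suc m)) * indicator {0<..<x k} t) \<partial>lborel)"
      unfolding split_last_def
    proof (rule nn_integral_cong)
      fix t
      have "(\<Prod>i\<le>Suc k. exp_quot ((x(k := t, Suc k := x k - t)) i)) = exp_quot t * exp_quot (x k - t) * Q"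
      proof -
        define B where "B = {..k} - {k}"
        have B: "{..Suc k} = insert (Suc k) (insert k B)" "finite B" "k \<notin> B" "Suc k \<notin> B"
          by (auto simp: B_def)
        have "(\<Prod>l\<in>B. exp_quot ((x(k := t, Suc k := x k - t)) l)) = Q"
          unfolding Q_def B_def by (intro prod.cong) auto
        then show ?thesis
          unfolding B(1) using B(2-) by (subst prod.insert; simp)
      qed
      then have w: "weight (Suc k) m (x(k := t, Suc k := x k - t)) = fact m * fps_nth (exp_quot t * exp_quot (x k - t) * Q) (Suc m)"
        by (simp only: weight_def)
      \<comment> \<open>Merging undoes the cut, so h is evaluated at x for every t.\<close>
      have y: "x(k := t, Suc k := x k - t, k := t + (x k - t), Suc k := 0) = x"
        using xk by auto
      show "\<Phi> k (Suc k) (x(k := t, Suc k := x k - t)) * indicator {0<..<x k} t =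
        ennreal (fact m) * h x *
        (ennreal (t * (x k - t) * fps_nth (exp_quot t * exp_quot (x k - t) * Q) (Suc m)) * indicator {0<..<x k} t)"
      proof (cases "t \<in> {0<..<x k}")
        case True
        then have nn: "0 \<le> fps_nth (exp_quot t * exp_quot (x k - t) * Q) (Suc m)" "0 \<le> t * (x k - t)"
          using Q by (auto intro!: fps_nth_mult_nonneg exp_quot_nonneg)
        show ?thesis
          unfolding \<Phi>_def w ennreal_mult[OF nn(2,1)] ennreal_mult[OF fact_ge_zero nn(1)]
          using y by (simp add: mult_ac)
      qed simp
    qed
    also have "\<dots> = ennreal (fact m) * h x * ennreal (fps_nth (split_kernel (x k) * Q) (Suc m))"
      unfolding nn_integral_split_kernel[OF xk(1) Q, symmetric]
      by (intro nn_integral_cmult borel_measurable_times_ennreal measurable_compose[OF _ measurable_ennreal]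
          borel_measurable_times measurable_fps_nth_mult measurable_exp_quot) auto
    also have "\<dots> = ennreal (split_weight k m k x) * h x"
      unfolding split_weight_def Q_def[symmetric]
      using Q split_kernel_nonneg[of "x k"] xk by (subst ennreal_mult) (auto simp: mult_ac intro!: fps_nth_mult_nonneg)
    finally show "split_last k (\<Phi> k (Suc k)) x = ennreal (split_weight k m k x) * h x" .
  qed
  finally show ?thesis .
qed

text \<open>Conversely, the uniform split of part k is itself the last cut of an integral over one
  more part. The merge weight depends on the two pieces through their sum only, so it is constant
  along the cut.\<close>

lemma simplex_integral_split_dual:
  "simplex_integral k (\<lambda>x. ennreal (weight k m x) * split_dual h k x) =
    of_nat (Suc k) * simplex_integral (Suc k) (\<lambda>x. ennreal (merge_weight (Suc k) m k (Suc k) x) * h x)"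
proof -
  define \<Phi> where "\<Phi> i x = ennreal (weight k m x) *
      (ennreal (x i) * (\<integral>\<^sup>+t\<in>{0<..<x i}. h (x(i := t, Suc k := x i - t)) \<partial>lborel))" for i x
  have m\<Phi>: "\<Phi> i \<in> borel_measurable borel" for i
    unfolding \<Phi>_def
    by (intro borel_measurable_times_ennreal measurable_compose[OF _ measurable_ennreal]
      measurable_coord measurable_split_integral measurable_weight measurable_h)
  have "simplex_integral k (\<lambda>x. ennreal (weight k m x) * split_dual h k x) =
      simplex_integral k (\<lambda>x. \<Sum>i\<le>k. \<Phi> i x)"
    by (simp only: split_dual_def \<Phi>_def sum_distrib_left)
  also have "\<dots> = (\<Sum>i\<le>k. simplex_integral k (\<Phi> i))"
    by (rule simplex_integral_sum[OF m\<Phi>])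
  also have "\<dots> = of_nat (Suc k) * simplex_integral k (\<Phi> k)"
  proof (rule simplex_integral_sum_single)
    fix p i and x :: "nat \<Rightarrow> real"
    assume p: "p permutes {..k}"
    have inj: "inj p" using p by (rule permutes_inj)
    have k: "p (Suc k) = Suc k" using permutes_not_in[OF p] by simp
    have "(x \<circ> p)(i := a, Suc k := b) = x(p i := a, Suc k := b) \<circ> p" for a b
      using fun_upd_comp_inj[OF inj, of "x(p i := a)" "Suc k" b] fun_upd_comp_inj[OF inj, of x i a] by (simp add: k)
    then show "\<Phi> i (x \<circ> p) = \<Phi> (p i) x"
      unfolding \<Phi>_def weight_comp[OF p] by (simp add: symmetric[OF permutes_bij[OF p]] del: fun_upd_apply)
  qed (rule m\<Phi>)
  also have "simplex_integral k (\<Phi> k) =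
      simplex_integral k (split_last k (\<lambda>x. ennreal (merge_weight (Suc k) m k (Suc k) x) * h x))"
  proof (rule simplex_integral_cong)
    fix x assume x: "x \<in> open_simplex k"
    have xk: "0 < x k" "x (Suc k) = 0" using x by (auto simp: open_simplex_def)
    have "merge_weight (Suc k) m k (Suc k) (x(k := t, Suc k := x k - t)) = x k * weight k m x" for t
    proof -
      have "{..Suc k} - {k, Suc k} = {..k} - {k}" by auto
      moreover have "(\<Prod>l\<in>{..k} - {k}. exp_quot ((x(k := t, Suc k := x k - t)) l)) = (\<Prod>l\<in>{..k} - {k}. exp_quot (x l))"
        by (intro prod.cong) auto
      moreover have "(\<Prod>l\<le>k. exp_quot (x l)) = exp_quot (x k) * (\<Prod>l\<in>{..k} - {k}. exp_quot (x l))"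
        by (rule prod.remove) auto
      ultimately show ?thesis
        unfolding merge_weight_def weight_def by (simp only:) simp
    qed
    then have "split_last k (\<lambda>x. ennreal (merge_weight (Suc k) m k (Suc k) x) * h x) x =
       (\<integral>\<^sup>+t. ennreal (x k * weight k m x) * (h (x(k := t, Suc k := x k - t)) * indicator {0<..<x k} t) \<partial>lborel)"
      unfolding split_last_def by (simp add: mult.assoc)
    also have "\<dots> = ennreal (x k * weight k m x) * (\<integral>\<^sup>+t\<in>{0<..<x k}. h (x(k := t, Suc k := x k - t)) \<partial>lborel)"
      by (intro nn_integral_cmult borel_measurable_times_ennreal measurable_compose[OF _ measurable_h] measurable_seq_fun_upd) auto
    also have "\<dots> = \<Phi> k x"
      unfolding \<Phi>_def using xk weight_nonneg[OF open_simplex_nonneg[OF x]]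
      by (simp add: ennreal_mult mult_ac)
    finally show "\<Phi> k x = split_last k (\<lambda>x. ennreal (merge_weight (Suc k) m k (Suc k) x) * h x) x" ..
  qed
  also have "\<dots> = simplex_integral (Suc k) (\<lambda>x. ennreal (merge_weight (Suc k) m k (Suc k) x) * h x)"
    by (intro simplex_integral_Suc[symmetric] measurable_h_times measurable_merge_weight)
  finally show ?thesis .
qed

end

section \<open>Densities of the iterates\<close>

text \<open>The integral of h against the m-th iterate, as \<open>nn_integral_iterate\<close> shows;
  1 / (k + 1)! compensates for the orderings of k + 1 parts.\<close>

definition mixture :: "nat \<Rightarrow> ((nat \<Rightarrow> real) \<Rightarrow> ennreal) \<Rightarrow> ennreal" where
  "mixture m h = (\<Sum>k. ennreal (1 / fact (Suc k)) *
     simplex_integral k (\<lambda>x. ennreal (weight k m x) * h (rearrange x)))"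

lemma symmetric_function_rearrange:
  assumes "h \<in> borel_measurable borel"
  shows "symmetric_function (\<lambda>x. h (rearrange x))"
  by standard (auto intro: measurable_compose[OF measurable_rearrange assms] simp: rearrange_comp_bij simp del: o_apply)

lemma suminf_ennreal_shift:
  fixes f :: "nat \<Rightarrow> ennreal"
  assumes "f 0 = 0"
  shows "(\<Sum>n. f n) = (\<Sum>n. f (Suc n))"
proof (rule LIMSEQ_unique)
  show "(\<lambda>n. \<Sum>i<n. f (Suc i)) \<longlonglongrightarrow> (\<Sum>n. f (Suc n))"
    by (rule summable_LIMSEQ) auto
  have "(\<lambda>n. \<Sum>i<Suc n. f i) \<longlonglongrightarrow> (\<Sum>n. f n)"
    by (rule LIMSEQ_Suc[OF summable_LIMSEQ]) auto
  then show "(\<lambda>n. \<Sum>i<n. f (Suc i)) \<longlonglongrightarrow> (\<Sum>n. f n)"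
    unfolding sum.lessThan_Suc_shift using assms by simp
qed

text \<open>There are (k + 1) (k + 2) ordered pairs among k + 2 parts but only k + 1 single parts
  among k + 1; the factorials balance these counts.\<close>

lemma inverse_fact_mult:
  "ennreal (1 / fact (Suc (Suc k))) * (of_nat (Suc k) * of_nat (Suc (Suc k)) * y) =
    ennreal (1 / fact (Suc k)) * (of_nat (Suc k) * y)"
proof -
  have "ennreal (1 / fact (Suc (Suc k))) * of_nat (Suc (Suc k)) = ennreal (1 / fact (Suc (Suc k)) * real (Suc (Suc k)))"
    unfolding ennreal_of_nat_eq_real_of_nat by (rule ennreal_mult[symmetric]) auto
  also have "1 / fact (Suc (Suc k)) * real (Suc (Suc k)) = 1 / fact (Suc k)"
    by (subst fact_Suc) (simp del: fact_Suc of_nat_Suc)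
  finally have *: "ennreal (1 / fact (Suc (Suc k))) * of_nat (Suc (Suc k)) = ennreal (1 / fact (Suc k))" .
  show ?thesis
    unfolding *[symmetric] by (simp only: mult_ac)
qed

text \<open>The recursion is kept free of subtraction, as it lives in \<open>ennreal\<close>. Merges
  lower and splits raise the number of parts by one: \<open>A (Suc k)\<close> matches
  \<open>C k\<close>, and \<open>B k\<close> matches \<open>D (Suc k)\<close>. The weights then
  combine pointwise by \<open>weight_identity\<close>.\<close>

lemma mixture_split_merge_dual:
  assumes h: "h \<in> borel_measurable borel"
  shows "mixture m h + mixture m (split_merge_dual h) = 2 * mixture (Suc m) h"
proof -
  define g where "g x = h (rearrange x)" for x
  interpret symmetric_function g
    unfolding g_def by (rule symmetric_function_rearrange[OF h])
  define c where "c k = ennreal (1 / fact (Suc k))" for k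
  define A where "A k = c k * simplex_integral k (\<lambda>x. ennreal (weight k m x) * merge_dual g k x)" for k
  define B where "B k = c k * simplex_integral k (\<lambda>x. ennreal (weight k m x) * split_dual g k x)" for k
  define C where "C k = c k * simplex_integral k (\<lambda>x. ennreal (\<Sum>i\<le>k. split_weight k m i x) * g x)" for k
  define D where "D k = c k * simplex_integral k (\<lambda>x. ennreal (\<Sum>i\<le>k. \<Sum>j\<in>{..k} - {i}. merge_weight k m i j x) * g x)" for k
  define W where "W n k = c k * simplex_integral k (\<lambda>x. ennreal (weight k n x) * g x)" for n k
  have mw: "(\<lambda>x. ennreal (weight k m x) * G x) \<in> borel_measurable borel" if "G \<in> borel_measurable borel" for G k
    using that by (intro borel_measurable_times_ennreal measurable_compose[OF _ measurable_ennreal] measurable_weight)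
  have "mixture m (split_merge_dual h) = (\<Sum>k. A k + B k)"
    unfolding mixture_def
  proof (rule suminf_cong)
    fix k
    have "simplex_integral k (\<lambda>x. ennreal (weight k m x) * split_merge_dual h (rearrange x)) =
      simplex_integral k (\<lambda>x. ennreal (weight k m x) * merge_dual g k x + ennreal (weight k m x) * split_dual g k x)"
      unfolding g_def
      by (rule simplex_integral_cong) (simp only: split_merge_dual_rearrange[OF _ h] distrib_left)
    also have "\<dots> = simplex_integral k (\<lambda>x. ennreal (weight k m x) * merge_dual g k x) +
        simplex_integral k (\<lambda>x. ennreal (weight k m x) * split_dual g k x)"
      by (intro simplex_integral_add mw measurable_merge_dual measurable_split_dual)
    finally show "ennreal (1 / fact (Suc k)) * simplex_integral k (\<lambda>x. ennreal (weight k m x) * split_merge_dual h (rearrange x)) = A k + B k"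
      unfolding A_def B_def c_def by (simp only: distrib_left)
  qed
  also have "\<dots> = (\<Sum>k. A k) + (\<Sum>k. B k)"
    by (rule suminf_add[symmetric]) auto
  also have "(\<Sum>k. A k) = (\<Sum>k. A (Suc k))"
  proof (rule suminf_ennreal_shift)
    \<comment> \<open>With a single part there is nothing to merge.\<close>
    show "A 0 = 0" unfolding A_def by (simp add: merge_dual_def simplex_integral_0)
  qed
  also have "\<dots> = (\<Sum>k. C k)"
    unfolding A_def C_def c_def
    by (simp only: simplex_integral_merge_dual split_weight_symmetrize inverse_fact_mult)
  also have "(\<Sum>k. B k) = (\<Sum>k. D (Suc k))"
    unfolding B_def D_def c_def
    by (simp only: simplex_integral_split_dual merge_weight_symmetrize inverse_fact_mult)
  also have "\<dots> = (\<Sum>k. D k)"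
  proof (rule suminf_ennreal_shift[symmetric])
    show "D 0 = 0" unfolding D_def by (simp add: simplex_integral_0)
  qed
  finally have "mixture m h + mixture m (split_merge_dual h) = (\<Sum>k. W m k) + ((\<Sum>k. C k) + (\<Sum>k. D k))"
    by (simp add: mixture_def W_def g_def c_def)
  also have "\<dots> = (\<Sum>k. W m k + (C k + D k))"
    by (simp add: suminf_add)
  also have "\<dots> = (\<Sum>k. 2 * W (Suc m) k)"
  proof (rule suminf_cong)
    fix k
    define S where "S x = (\<Sum>i\<le>k. split_weight k m i x)" for x
    define R where "R x = (\<Sum>i\<le>k. \<Sum>j\<in>{..k} - {i}. merge_weight k m i j x)" for x
    have S: "S \<in> borel_measurable borel" and R: "R \<in> borel_measurable borel"
      unfolding S_def R_def by (intro borel_measurable_sum measurable_split_weight measurable_merge_weight)+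
    note ms = measurable_h_times[OF S] and mr = measurable_h_times[OF R] and mwg = measurable_h_times[OF measurable_weight]
    have "W m k + (C k + D k) = c k * (simplex_integral k (\<lambda>x. ennreal (weight k m x) * g x) +
       (simplex_integral k (\<lambda>x. ennreal (S x) * g x) + simplex_integral k (\<lambda>x. ennreal (R x) * g x)))"
      unfolding W_def C_def D_def S_def R_def by (simp only: distrib_left)
    also have "\<dots> = c k * simplex_integral k (\<lambda>x. ennreal (weight k m x) * g x + (ennreal (S x) * g x + ennreal (R x) * g x))"
      by (simp only: simplex_integral_add[OF ms mr] simplex_integral_add[OF mwg borel_measurable_add[OF ms mr]])
    also have "simplex_integral k (\<lambda>x. ennreal (weight k m x) * g x + (ennreal (S x) * g x + ennreal (R x) * g x)) =
        simplex_integral k (\<lambda>x. 2 * (ennreal (weight k (Suc m) x) * g x))"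
    proof (rule simplex_integral_cong)
      fix x assume x: "x \<in> open_simplex k"
      note nn = open_simplex_nonneg[OF x]
      have "S x + R x + weight k m x = 2 * weight k (Suc m) x"
        unfolding S_def R_def by (rule weight_identity[OF x])
      moreover have "0 \<le> S x" "0 \<le> R x" "0 \<le> weight k m x" "0 \<le> weight k (Suc m) x"
        unfolding S_def R_def by (intro sum_nonneg split_weight_nonneg merge_weight_nonneg weight_nonneg nn)+
      ultimately have "ennreal (weight k m x) + (ennreal (S x) + ennreal (R x)) = ennreal 2 * ennreal (weight k (Suc m) x)"
        by (simp add: ennreal_plus[symmetric] ennreal_mult[symmetric] algebra_simps del: ennreal_plus ennreal_numeral)
      then show "ennreal (weight k m x) * g x + (ennreal (S x) * g x + ennreal (R x) * g x) = 2 * (ennreal (weight k (Suc m) x) * g x)"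
        unfolding distrib_right[symmetric] by (simp add: mult.assoc)
    qed
    also have "\<dots> = 2 * simplex_integral k (\<lambda>x. ennreal (weight k (Suc m) x) * g x)"
      by (rule simplex_integral_cmult[OF mwg])
    finally show "W m k + (C k + D k) = 2 * W (Suc m) k"
      unfolding W_def by (simp only: mult.left_commute)
  qed
  also have "\<dots> = 2 * mixture (Suc m) h"
    unfolding mixture_def W_def g_def c_def by (rule ennreal_suminf_cmult)
  finally show ?thesis .
qed

section \<open>From values on sets to integrals of functions\<close>

lemma nn_integral_mixture_repr:
  fixes W :: "nat \<Rightarrow> 'a \<Rightarrow> ennreal" and X :: "nat \<Rightarrow> 'a \<Rightarrow> 'b"
  assumes N: "sigma_finite_measure N"
    and W: "\<And>k. W k \<in> borel_measurable N" and X: "\<And>k. X k \<in> N \<rightarrow>\<^sub>M M"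
    and eq: "\<And>A. A \<in> sets M \<Longrightarrow> emeasure M A = (\<Sum>k. \<integral>\<^sup>+u. W k u * indicator A (X k u) \<partial>N)"
    and h: "h \<in> borel_measurable M"
  shows "(\<integral>\<^sup>+x. h x \<partial>M) = (\<Sum>k. \<integral>\<^sup>+u. W k u * h (X k u) \<partial>N)"
proof -
  interpret sigma_finite_measure N by fact
  let ?P = "count_space UNIV \<Otimes>\<^sub>M N"
  have W': "(\<lambda>p. W (fst p) (snd p)) \<in> borel_measurable ?P"
    by (rule measurable_pair_measure_countable1) (auto intro: W)
  have X': "(\<lambda>p. X (fst p) (snd p)) \<in> ?P \<rightarrow>\<^sub>M M"
    by (rule measurable_pair_measure_countable1) (auto intro: X)
  \<comment> \<open>With the index k as a further coordinate, the right-hand side is the integral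
    against one measure \<open>D\<close>; agreement on sets then gives \<open>M = D\<close>, and
    with it the formula for every h.\<close>
  define D where "D = distr (density ?P (\<lambda>p. W (fst p) (snd p))) M (\<lambda>p. X (fst p) (snd p))"
  have *: "(\<integral>\<^sup>+x. f x \<partial>D) = (\<Sum>k. \<integral>\<^sup>+u. W k u * f (X k u) \<partial>N)" if f: "f \<in> borel_measurable M" for f
  proof -
    have fX: "(\<lambda>p. f (X (fst p) (snd p))) \<in> borel_measurable ?P"
      by (rule measurable_compose[OF X' f])
    have "(\<integral>\<^sup>+x. f x \<partial>D) = (\<integral>\<^sup>+p. W (fst p) (snd p) * f (X (fst p) (snd p)) \<partial>?P)"
      unfolding D_def using X' f fX W' by (simp add: nn_integral_distr nn_integral_density)
    also have "\<dots> = (\<integral>\<^sup>+k. \<integral>\<^sup>+u. W k u * f (X k u) \<partial>N \<partial>count_space UNIV)"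
      using nn_integral_fst[OF borel_measurable_times_ennreal[OF W' fX]] by simp
    also have "\<dots> = (\<Sum>k. \<integral>\<^sup>+u. W k u * f (X k u) \<partial>N)"
      by (rule nn_integral_count_space_nat)
    finally show ?thesis .
  qed
  have "M = D"
  proof (rule measure_eqI)
    show "sets M = sets D" by (simp add: D_def)
    fix A assume A: "A \<in> sets M"
    have "emeasure D A = (\<integral>\<^sup>+x. indicator A x \<partial>D)"
      using A by (simp add: D_def)
    also have "\<dots> = emeasure M A"
      unfolding eq[OF A] using A by (intro *) auto
    finally show "emeasure M A = emeasure D A" ..
  qed
  then show ?thesis using *[OF h] by simp
qed

lemma mixture_cong:
  assumes "\<And>x. x \<in> Sigma1 \<Longrightarrow> f x = g x"
  shows "mixture m f = mixture m g"
  unfolding mixture_def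
  by (intro suminf_cong arg_cong2[where f = "(*)"] refl simplex_integral_cong)
     (simp add: assms rearrange_open_simplex_in_Sigma1)

lemma mixture_eq_nn_integral:
  assumes h: "h \<in> borel_measurable borel"
  shows "mixture m h = (\<Sum>k. \<integral>\<^sup>+u. ennreal (1 / fact (Suc k)) * (ennreal (\<Prod>j<k. remaining j u) *
     ennreal (weight k m (fragments k u))) * h (rearrange (fragments k u)) \<partial>uniform_seq)"
  unfolding mixture_def simplex_integral_def
proof (rule suminf_cong)
  fix k
  have "(\<lambda>x. ennreal (weight k m x) * h (rearrange x)) \<in> borel_measurable borel"
    by (intro borel_measurable_times_ennreal measurable_compose[OF _ measurable_ennreal] measurable_weight
        measurable_compose[OF measurable_rearrange h])
  from nn_integral_cmult[OF measurable_simplex_integrand[OF this], symmetric]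
  show "ennreal (1 / fact (Suc k)) * (\<integral>\<^sup>+u. ennreal (\<Prod>j<k. remaining j u) * (ennreal (weight k m (fragments k u)) * h (rearrange (fragments k u))) \<partial>uniform_seq) =
    (\<integral>\<^sup>+u. ennreal (1 / fact (Suc k)) * (ennreal (\<Prod>j<k. remaining j u) *
     ennreal (weight k m (fragments k u))) * h (rearrange (fragments k u)) \<partial>uniform_seq)"
    by (simp only: mult.assoc)
qed

lemma borel_measurable_borel_Sigma1: "h \<in> borel_measurable borel \<Longrightarrow> h \<in> borel_measurable borel_Sigma1"
  unfolding borel_Sigma1_def by (rule measurable_restrict_space1)

text \<open>The iterates are constructed through their values on sets. The proof passes to the image
  measure on all real sequences, because \<open>rearrange (fragments k u)\<close> lies in
  \<open>Sigma1\<close> only for almost all u.\<close>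

lemma nn_integral_mixtureI:
  assumes M: "sets M = sets borel_Sigma1"
    and eq: "\<And>A. A \<in> sets borel_Sigma1 \<Longrightarrow> emeasure M A = mixture m (indicator A)"
    and h: "h \<in> borel_measurable borel"
  shows "(\<integral>\<^sup>+x. h x \<partial>M) = mixture m h"
proof -
  interpret U: prob_space uniform_seq by (rule prob_space_uniform_seq)
  have id: "(\<lambda>x. x) \<in> M \<rightarrow>\<^sub>M borel"
    using M unfolding borel_Sigma1_def by (simp cong: measurable_cong_sets) (rule measurable_restrict_space1, simp)
  have sp: "space M = Sigma1" using sets_eq_imp_space_eq[OF M] by simp
  have "(\<integral>\<^sup>+x. h x \<partial>M) = (\<integral>\<^sup>+x. h x \<partial>distr M borel (\<lambda>x. x))"
    by (rule nn_integral_distr[symmetric, OF id]) (simp add: h)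
  also have "\<dots> = mixture m h"
    unfolding mixture_eq_nn_integral[OF h]
  proof (rule nn_integral_mixture_repr)
    show "sigma_finite_measure uniform_seq" ..
    show "(\<lambda>u. rearrange (fragments k u)) \<in> uniform_seq \<rightarrow>\<^sub>M distr M borel (\<lambda>x. x)" for k
      by simp
    show "(\<lambda>u. ennreal (1 / fact (Suc k)) * (ennreal (\<Prod>j<k. remaining j u) * ennreal (weight k m (fragments k u)))) \<in> borel_measurable uniform_seq" for k
      by measurable
    fix A assume "A \<in> sets (distr M borel (\<lambda>x. x))"
    then have A: "A \<in> sets borel" by simp
    have "emeasure (distr M borel (\<lambda>x. x)) A = emeasure M (A \<inter> Sigma1)"
      by (simp add: emeasure_distr[OF id A] sp)
    also have "\<dots> = mixture m (indicator (A \<inter> Sigma1))"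
      using A by (intro eq) (auto simp: sets_borel_Sigma1_iff)
    also have "\<dots> = mixture m (indicator A)"
      by (rule mixture_cong) (auto simp: indicator_def)
    finally show "emeasure (distr M borel (\<lambda>x. x)) A = (\<Sum>k. \<integral>\<^sup>+u. ennreal (1 / fact (Suc k)) * (ennreal (\<Prod>j<k. remaining j u) *
       ennreal (weight k m (fragments k u))) * indicator A (rearrange (fragments k u)) \<partial>uniform_seq)"
      using A by (simp only: mixture_eq_nn_integral[OF borel_measurable_indicator])
  qed (simp add: h)
  finally show ?thesis .
qed

text \<open>For m = 0 only the term with a single part survives, and its weight at (1, 0, ...) is
  the coefficient 1 of s in exp(s) - 1.\<close>

lemma nn_integral_nu0:
  assumes h: "h \<in> borel_measurable borel"
  shows "(\<integral>\<^sup>+x. h x \<partial>nu0) = mixture 0 h"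
proof -
  define e :: "nat \<Rightarrow> real" where "e = (\<lambda>n. if n = 0 then 1 else 0)"
  have e: "e \<in> open_simplex 0" by (auto simp: e_def open_simplex_def)
  have re: "rearrange e = e"
    by (intro rearrange_decseq open_simplex_null[OF e] open_simplex_nonneg[OF e]) (auto simp: decseq_def e_def)
  then have "e \<in> Sigma1" using rearrange_open_simplex_in_Sigma1[OF e] by simp
  then have "(\<integral>\<^sup>+x. h x \<partial>nu0) = h e"
    unfolding nu0_def e_def[symmetric]
    by (intro nn_integral_return borel_measurable_borel_Sigma1 h) simp
  moreover have "mixture 0 h = (\<Sum>k\<in>{0}. ennreal (1 / fact (Suc k)) *
     simplex_integral k (\<lambda>x. ennreal (weight k 0 x) * h (rearrange x)))"
    unfolding mixture_def by (rule suminf_finite) (auto simp: weight_eq_0 simplex_integral_def)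
  moreover have "weight 0 0 e = 1" by (simp add: weight_def e_def exp_quot_nth)
  ultimately show ?thesis
    by (simp add: simplex_integral_0 e_def[symmetric] re)
qed

text \<open>The induction is over all h at once: the step applies the hypothesis both to an
  indicator and to its image under \<open>split_merge_dual\<close>.\<close>

lemma nn_integral_iterate:
  assumes "h \<in> borel_measurable borel"
  shows "(\<integral>\<^sup>+x. h x \<partial>(half_sum (\<lambda>\<nu>. \<nu>) split_merge ^^ m) nu0) = mixture m h"
  using assms
proof (induction m arbitrary: h)
  case 0
  then show ?case by (simp add: nn_integral_nu0)
next
  case (Suc m)
  define \<nu> where "\<nu> = (half_sum (\<lambda>\<nu>. \<nu>) split_merge ^^ m) nu0"
  have \<nu>: "\<nu> \<in> space (prob_algebra borel_Sigma1)"
    unfolding \<nu>_def by (rule iterates_in_prob_algebra)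
  have sp: "space \<nu> = Sigma1" "sets \<nu> = sets borel_Sigma1"
    using \<nu> sets_eq_imp_space_eq[of \<nu> borel_Sigma1] by (auto simp: space_prob_algebra)
  have "(\<integral>\<^sup>+x. h x \<partial>half_sum (\<lambda>\<nu>. \<nu>) split_merge \<nu>) = mixture (Suc m) h"
  proof (rule nn_integral_mixtureI)
    fix A assume A: "A \<in> sets borel_Sigma1"
    then have A': "A \<in> sets borel" by (simp add: sets_borel_Sigma1_iff)
    have i: "(indicator A :: _ \<Rightarrow> ennreal) \<in> borel_measurable borel" using A' by simp
    have "emeasure \<nu> A = mixture m (indicator A)"
      using Suc.IH[OF i] A sp unfolding \<nu>_def[symmetric] by simp
    moreover have "emeasure (split_merge \<nu>) A = mixture m (split_merge_dual (indicator A))"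
    proof -
      have "emeasure (split_merge \<nu>) A = (\<integral>\<^sup>+x. split_merge_dual (indicator A) x \<partial>\<nu>)"
        unfolding emeasure_split_merge[OF \<nu> A] emeasure_split_merge_law[OF A] split_merge_dual_def ..
      also have "\<dots> = mixture m (split_merge_dual (indicator A))"
        unfolding \<nu>_def by (rule Suc.IH[OF measurable_split_merge_dual[OF i]])
      finally show ?thesis .
    qed
    ultimately have "emeasure (half_sum (\<lambda>\<nu>. \<nu>) split_merge \<nu>) A =
        (mixture m (indicator A) + mixture m (split_merge_dual (indicator A))) / 2"
      using emeasure_half_sum[of "\<lambda>\<nu>. \<nu>" \<nu> split_merge A, OF \<nu> split_merge_in_prob_algebra[OF \<nu>] A] by simp
    also have "\<dots> = mixture (Suc m) (indicator A)"
      unfolding mixture_split_merge_dual[OF i]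
      by (simp add: mult.commute[of 2] ennreal_mult_divide_eq)
    finally show "emeasure (half_sum (\<lambda>\<nu>. \<nu>) split_merge \<nu>) A = mixture (Suc m) (indicator A)" .
  qed (use Suc.prems in auto)
  then show ?case unfolding \<nu>_def by simp
qed

section \<open>Size-biased ordering and the limit\<close>

text \<open>Pick parts successively, each with probability proportional to its size among those
  left. At stage j the probabilities x_l / \<open>tail j x\<close> for l >= j sum to one, and by
  symmetry all k + 1 - j choices contribute as much as l = j. The product of these counts is (k +
  1)!.\<close>

lemma simplex_integral_size_biased:
  assumes \<phi>: "\<phi> \<in> borel_measurable borel"
    and sym: "\<And>p x. p permutes {..k} \<Longrightarrow> \<phi> (x \<circ> p) = \<phi> x"
  shows "simplex_integral k \<phi> = ennreal (fact (Suc k)) *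
    simplex_integral k (\<lambda>x. ennreal (\<Prod>i<k. x i / (\<Sum>l=i..k. x l)) * \<phi> x)"
proof -
  define tail where "tail i x = (\<Sum>l=i..k. x l)" for i and x :: "nat \<Rightarrow> real"
  define P where "P j x = (\<Prod>i<j. x i / tail i x)" for j and x :: "nat \<Rightarrow> real"
  have tail [measurable]: "tail i \<in> borel_measurable borel" for i
    unfolding tail_def by (intro borel_measurable_sum measurable_coord)
  have P: "P j \<in> borel_measurable borel" for j
    unfolding P_def by (intro borel_measurable_prod borel_measurable_divide measurable_coord tail)
  have m: "(\<lambda>x. ennreal (f x) * \<phi> x) \<in> borel_measurable borel" if "f \<in> borel_measurable borel" for f
    using that by (intro borel_measurable_times_ennreal measurable_compose[OF _ measurable_ennreal] \<phi>)
  have step: "simplex_integral k (\<lambda>x. ennreal (P j x) * \<phi> x) =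
      of_nat (Suc k - j) * simplex_integral k (\<lambda>x. ennreal (P (Suc j) x) * \<phi> x)" if j: "j \<le> k" for j
  proof -
    define \<Psi> where "\<Psi> l x = ennreal (P j x * (x l / tail j x)) * \<phi> x" for l x
    have m\<Psi>: "\<Psi> l \<in> borel_measurable borel" for l
      unfolding \<Psi>_def by (intro m borel_measurable_times borel_measurable_divide measurable_coord tail P)
    have "simplex_integral k (\<lambda>x. ennreal (P j x) * \<phi> x) = simplex_integral k (\<lambda>x. \<Sum>l=j..k. \<Psi> l x)"
    proof (rule simplex_integral_cong)
      fix x assume x: "x \<in> open_simplex k"
      have pos: "0 < x i" if "i \<le> k" for i using x that by (simp add: open_simplex_def)
      have t: "0 < tail i x" if "i \<le> k" for i
        unfolding tail_def using that by (intro sum_pos pos) auto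
      have "P j x = (\<Sum>l=j..k. P j x * (x l / tail j x))"
        unfolding sum_distrib_left[symmetric] sum_divide_distrib[symmetric] tail_def[symmetric]
        using t[OF j] by simp
      moreover have "0 \<le> P j x * (x l / tail j x)" if "l \<le> k" for l
        unfolding P_def using j pos t that
        by (intro mult_nonneg_nonneg prod_nonneg divide_nonneg_nonneg) (auto simp: less_imp_le)
      ultimately have "ennreal (P j x) = (\<Sum>l=j..k. ennreal (P j x * (x l / tail j x)))"
        by (subst sum_ennreal) auto
      then show "ennreal (P j x) * \<phi> x = (\<Sum>l=j..k. \<Psi> l x)"
        unfolding \<Psi>_def by (simp only: sum_distrib_right)
    qed
    also have "\<dots> = (\<Sum>l=j..k. simplex_integral k (\<Psi> l))"
      by (rule simplex_integral_sum[OF m\<Psi>])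
    also have "\<dots> = (\<Sum>l=j..k. simplex_integral k (\<Psi> j))"
    proof (rule sum.cong[OF refl])
      fix l assume l: "l \<in> {j..k}"
      let ?\<tau> = "Transposition.transpose j l"
      have \<tau>: "?\<tau> permutes {..k}" using l by (intro permutes_swap_id) auto
      \<comment> \<open>For i <= j both j and l belong to the tail starting at i, so exchanging them
        preserves its sum.\<close>
      have tail\<tau>: "tail i (x \<circ> ?\<tau>) = tail i x" if "i \<le> j" for i and x :: "nat \<Rightarrow> real"
      proof -
        have "?\<tau> permutes {i..k}" using l that by (intro permutes_swap_id) auto
        from sum.permute[OF this, of x] show ?thesis unfolding tail_def by (simp add: comp_def)
      qed
      have "P j (x \<circ> ?\<tau>) = P j x" for x
        unfolding P_def using l by (intro prod.cong refl) (simp add: tail\<tau> Transposition.transpose_def)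
      then have "\<Psi> l = (\<lambda>x. \<Psi> j (x \<circ> ?\<tau>))"
        unfolding \<Psi>_def by (simp add: tail\<tau> sym[OF \<tau>] fun_eq_iff del: o_apply) (simp add: o_def)
      then show "simplex_integral k (\<Psi> l) = simplex_integral k (\<Psi> j)"
        using simplex_integral_permute[OF \<tau> m\<Psi>[of j]] by simp
    qed
    also have "\<Psi> j = (\<lambda>x. ennreal (P (Suc j) x) * \<phi> x)"
      by (simp add: \<Psi>_def P_def fun_eq_iff)
    finally show ?thesis by simp
  qed
  have "j \<le> k \<Longrightarrow> simplex_integral k \<phi> = of_nat (\<Prod>i<j. Suc k - i) * simplex_integral k (\<lambda>x. ennreal (P j x) * \<phi> x)" for j
  proof (induction j)
    case 0
    show ?case by (simp add: P_def)
  next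
    case (Suc j)
    then show ?case using step[of j] by (simp only: Suc_leD prod.lessThan_Suc of_nat_mult mult.assoc)
  qed
  from this[of k] have "simplex_integral k \<phi> = of_nat (\<Prod>i<k. Suc k - i) * simplex_integral k (\<lambda>x. ennreal (P k x) * \<phi> x)"
    by simp
  \<comment> \<open>The factors are k + 1, k, ..., 2; the missing last factor is 1.\<close>
  moreover have "(\<Prod>i<k. Suc k - i) = fact (Suc k)"
    unfolding fact_prod_rev[of "Suc k"] by (simp add: lessThan_atLeast0[symmetric])
  ultimately show ?thesis
    unfolding P_def tail_def by (simp only: of_nat_fact ennreal_of_nat_eq_real_of_nat)
qed

section \<open>Hitting the pieces of a stick with uniform points\<close>

text \<open>The probability that \<open>m\<close> independent points, uniform on the stick, all land in the first \<open>k\<close> pieces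
  or in a further part of length \<open>r\<close>, and hit each of the \<open>k\<close> pieces.\<close>

definition hit_prob :: "nat \<Rightarrow> nat \<Rightarrow> real \<Rightarrow> (nat \<Rightarrow> real) \<Rightarrow> real" where
  "hit_prob k m r u = fact m * fps_nth ((\<Prod>i<k. fps_exp (stick_breaking u i) - 1) * fps_exp r) m"

lemma hit_prob_0: "hit_prob 0 m 1 u = 1"
  by (simp add: hit_prob_def)

text \<open>Once the first k pieces are hit, either piece k is hit too or all points avoid it:
  (exp(V) - 1) exp(R') = exp(R) - exp(R') for R = V + R'. The subtracted term is the probability
  that piece k is the first one unhit.\<close>

lemma hit_prob_Suc:
  "hit_prob (Suc k) m (remaining (Suc k) u) u =
    hit_prob k m (remaining k u) u - hit_prob k m (remaining (Suc k) u) u"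
proof -
  have "fps_exp (stick_breaking u k) * fps_exp (remaining (Suc k) u) = fps_exp (remaining k u)"
    unfolding fps_exp_add_mult[symmetric] by (simp add: remaining_diff)
  then have "(\<Prod>i<Suc k. fps_exp (stick_breaking u i) - 1) * fps_exp (remaining (Suc k) u) =
     (\<Prod>i<k. fps_exp (stick_breaking u i) - 1) * fps_exp (remaining k u) -
     (\<Prod>i<k. fps_exp (stick_breaking u i) - 1) * fps_exp (remaining (Suc k) u)"
    by (simp add: left_diff_distrib right_diff_distrib mult.assoc)
  then show ?thesis
    unfolding hit_prob_def by (simp only: fps_sub_nth right_diff_distrib)
qed

lemma hit_prob_eq_0:
  assumes "m < k" shows "hit_prob k m r u = 0"
proof -
  have "fps_nth (\<Prod>i<k. fps_exp (stick_breaking u i) - 1) n = 0" if "n \<le> m" for n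
    using assms that by (intro fps_nth_prod_eq_0) auto
  then show ?thesis by (simp add: hit_prob_def fps_mult_nth)
qed

text \<open>A telescoping sum. Its remainder vanishes since m points hit at most m pieces, so the
  first unhit piece, counted from 0, has index at most m.\<close>

lemma sum_hit_prob: "(\<Sum>k\<le>m. hit_prob k m (remaining (Suc k) u) u) = 1"
proof -
  have "(\<Sum>k<n. hit_prob k m (remaining (Suc k) u) u) = 1 - hit_prob n m (remaining n u) u" for n
    by (induction n) (simp_all add: hit_prob_0 hit_prob_Suc)
  from this[of "Suc m"] show ?thesis
    by (simp add: hit_prob_eq_0 lessThan_Suc_atMost)
qed

lemma hit_prob_nonneg:
  assumes "\<And>i. 0 \<le> stick_breaking u i" "0 \<le> r"
  shows "0 \<le> hit_prob k m r u"
  unfolding hit_prob_def using assms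
  by (intro mult_nonneg_nonneg fps_nth_mult_nonneg fps_nth_prod_nonneg fps_exp_minus_1_nonneg) auto

text \<open>Dropping the demand that the pieces be hit replaces each exp(V) - 1 by exp(V), which is
  larger coefficientwise; what remains is the chance that all points fall into the given
  length.\<close>

lemma hit_prob_le:
  assumes V: "\<And>i. 0 \<le> stick_breaking u i" and r: "0 \<le> r"
  shows "hit_prob k m r u \<le> ((\<Sum>i<k. stick_breaking u i) + r) ^ m"
proof -
  let ?G = "\<lambda>k. \<Prod>i<k. fps_exp (stick_breaking u i) - 1"
  have nn: "0 \<le> fps_nth (?G k) n" for k n
    by (intro fps_nth_prod_nonneg fps_exp_minus_1_nonneg V)
  have "fps_nth (?G k) n \<le> fps_nth (fps_exp (\<Sum>i<k. stick_breaking u i)) n" for n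
  proof (induction k arbitrary: n)
    case (Suc k)
    have "fps_nth (?G k * (fps_exp (stick_breaking u k) - 1)) n \<le>
        fps_nth (fps_exp (\<Sum>i<k. stick_breaking u i) * fps_exp (stick_breaking u k)) n"
      by (intro fps_nth_mult_mono Suc nn fps_exp_minus_1_nonneg V) simp
    then show ?case by (simp add: fps_exp_add_mult)
  qed simp
  then have "fps_nth (?G k * fps_exp r) m \<le> fps_nth (fps_exp (\<Sum>i<k. stick_breaking u i) * fps_exp r) m"
    using r by (intro fps_nth_mult_mono nn) auto
  also have "\<dots> = ((\<Sum>i<k. stick_breaking u i) + r) ^ m / fact m"
    by (simp add: fps_exp_add_mult[symmetric])
  finally show ?thesis
    unfolding hit_prob_def by (simp add: field_simps)
qed

text \<open>Piece k is missed by m points with probability (1 - V_k)^m, where V_k > 0.\<close>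

lemma hit_prob_tendsto_0:
  assumes u: "\<And>i. 0 < u i \<and> u i < 1"
  shows "(\<lambda>m. hit_prob k m (remaining (Suc k) u) u) \<longlonglongrightarrow> 0"
proof (rule tendsto_sandwich[where f = "\<lambda>_. 0" and h = "\<lambda>m. (1 - stick_breaking u k) ^ m"])
  have rem: "0 < remaining j u" for j
    unfolding remaining_def using u by (intro prod_pos) auto
  have V: "0 < stick_breaking u i" for i
    using u rem by (simp add: stick_breaking_eq)
  have s: "(\<Sum>i<k. stick_breaking u i) + remaining (Suc k) u = 1 - stick_breaking u k"
    using stick_breaking_sum[of u k] by (simp add: remaining_diff) (simp add: remaining_def)
  have "0 \<le> 1 - stick_breaking u k"
    unfolding s[symmetric] using V rem by (intro add_nonneg_nonneg sum_nonneg) (auto simp: less_imp_le)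
  then show "(\<lambda>m. (1 - stick_breaking u k) ^ m) \<longlonglongrightarrow> 0"
    using V[of k] by (intro LIMSEQ_power_zero) auto
  show "eventually (\<lambda>m. hit_prob k m (remaining (Suc k) u) u \<le> (1 - stick_breaking u k) ^ m) sequentially"
    using hit_prob_le[of u "remaining (Suc k) u" k] V rem s by (auto simp: less_imp_le)
  show "eventually (\<lambda>m. 0 \<le> hit_prob k m (remaining (Suc k) u) u) sequentially"
    using V rem by (intro always_eventually allI hit_prob_nonneg) (auto simp: less_imp_le)
qed simp

lemma nn_integral_power_complement:
  "(\<integral>\<^sup>+v. ennreal ((1 - v) ^ n) \<partial>unit_uniform) = ennreal (1 / (real n + 1))"
proof -
  have "(\<integral>\<^sup>+v. ennreal ((1 - v) ^ n) \<partial>unit_uniform) = (\<integral>\<^sup>+v\<in>{0..1}. ennreal ((1 - v) ^ n) \<partial>lborel)"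
    by (subst nn_integral_uniform_measure) (auto simp: divide_ennreal_def)
  also have "\<dots> = ennreal (- ((1 - 1) ^ Suc n / real (Suc n)) - - ((1 - 0) ^ Suc n / real (Suc n)))"
  proof (rule nn_integral_FTC_Icc[where F = "\<lambda>v. - ((1 - v) ^ Suc n / real (Suc n))"])
    fix v :: real assume "v \<in> {0..1}"
    have "((\<lambda>v. (1 - v) ^ Suc n) has_real_derivative real (Suc n) * (1 - v) ^ n * (0 - 1)) (at v)"
      by (rule derivative_eq_intros refl)+ simp
    from DERIV_minus[OF DERIV_cdivide[OF this, of "real (Suc n)"]]
    show "((\<lambda>v. - ((1 - v) ^ Suc n / real (Suc n))) has_real_derivative (1 - v) ^ n) (at v)" by simp
  qed auto
  finally show ?thesis by (simp add: add.commute)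
qed

text \<open>This averaging is what raises the order from m to m + 1: the power (1 - v)^n integrates
  to 1 / (n + 1), which completes n! to (n + 1)!.\<close>

lemma nn_integral_exp_complement:
  fixes G :: "real fps"
  assumes G: "\<And>n. 0 \<le> fps_nth G n" and r: "0 \<le> r"
  shows "(\<integral>\<^sup>+v. ennreal (fps_nth (G * fps_exp ((1 - v) * r)) m) \<partial>unit_uniform) =
    ennreal (fps_nth (G * exp_quot r) (Suc m))"
proof -
  have "(\<integral>\<^sup>+v. ennreal (fps_nth (G * fps_exp ((1 - v) * r)) m) \<partial>unit_uniform) =
    (\<integral>\<^sup>+v. (\<Sum>j=0..m. ennreal (fps_nth G j * r ^ (m - j) / fact (m - j)) * ennreal ((1 - v) ^ (m - j))) \<partial>unit_uniform)"
  proof (rule nn_integral_cong_AE)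
    show "AE v in unit_uniform. ennreal (fps_nth (G * fps_exp ((1 - v) * r)) m) =
      (\<Sum>j=0..m. ennreal (fps_nth G j * r ^ (m - j) / fact (m - j)) * ennreal ((1 - v) ^ (m - j)))"
      using AE_unit_uniform
    proof eventually_elim
      case (elim v)
      have "(\<Sum>j=0..m. ennreal (fps_nth G j * r ^ (m - j) / fact (m - j)) * ennreal ((1 - v) ^ (m - j))) =
         (\<Sum>j=0..m. ennreal (fps_nth G j * r ^ (m - j) / fact (m - j) * (1 - v) ^ (m - j)))"
        using elim G r by (intro sum.cong refl ennreal_mult[symmetric]) auto
      also have "\<dots> = ennreal (\<Sum>j=0..m. fps_nth G j * r ^ (m - j) / fact (m - j) * (1 - v) ^ (m - j))"
        using elim G r by (intro sum_ennreal) auto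
      also have "(\<Sum>j=0..m. fps_nth G j * r ^ (m - j) / fact (m - j) * (1 - v) ^ (m - j)) = fps_nth (G * fps_exp ((1 - v) * r)) m"
        unfolding fps_mult_nth by (intro sum.cong refl) (simp add: power_mult_distrib)
      finally show ?case ..
    qed
  qed
  also have "\<dots> = (\<Sum>j=0..m. \<integral>\<^sup>+v. ennreal (fps_nth G j * r ^ (m - j) / fact (m - j)) * ennreal ((1 - v) ^ (m - j)) \<partial>unit_uniform)"
    by (rule nn_integral_sum) simp
  also have "\<dots> = (\<Sum>j=0..m. ennreal (fps_nth G j * r ^ (m - j) / fact (m - j)) * ennreal (1 / (real (m - j) + 1)))"
    by (intro sum.cong refl) (simp add: nn_integral_cmult nn_integral_power_complement)
  also have "\<dots> = (\<Sum>j=0..m. ennreal (fps_nth G j * fps_nth (exp_quot r) (Suc m - j)))"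
  proof (intro sum.cong refl)
    fix j assume j: "j \<in> {0..m}"
    have "fps_nth G j * r ^ (m - j) / fact (m - j) * (1 / (real (m - j) + 1)) = fps_nth G j * fps_nth (exp_quot r) (Suc m - j)"
      using j by (simp add: exp_quot_nth Suc_diff_le add.commute mult.commute)
    then show "ennreal (fps_nth G j * r ^ (m - j) / fact (m - j)) * ennreal (1 / (real (m - j) + 1)) =
       ennreal (fps_nth G j * fps_nth (exp_quot r) (Suc m - j))"
      using G r by (subst ennreal_mult[symmetric]) auto
  qed
  also have "\<dots> = ennreal (\<Sum>j=0..m. fps_nth G j * fps_nth (exp_quot r) (Suc m - j))"
    by (intro sum_ennreal mult_nonneg_nonneg G exp_quot_nonneg r)
  \<comment> \<open>The coefficient of the product has a further summand j = m + 1, which vanishes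
    because \<open>exp_quot r\<close> has no constant term.\<close>
  also have "(\<Sum>j=0..m. fps_nth G j * fps_nth (exp_quot r) (Suc m - j)) = fps_nth (G * exp_quot r) (Suc m)"
    unfolding fps_mult_nth by (simp add: exp_quot_nth)
  finally show ?thesis .
qed

lemma measurable_hit_prob:
  assumes "r \<in> borel_measurable M" "f \<in> M \<rightarrow>\<^sub>M borel"
  shows "(\<lambda>w. hit_prob k m (r w) (f w)) \<in> borel_measurable M"
proof -
  have "(\<lambda>w. stick_breaking (f w) i) \<in> borel_measurable M" for i
    by (rule measurable_compose[OF assms(2) measurable_stick])
  then show ?thesis
    unfolding hit_prob_def using assms(1)
    by (intro borel_measurable_times measurable_fps_nth_mult measurable_fps_nth_prod) auto
qed

text \<open>After size-biasing, the denominators \<open>remaining i u\<close> cancel the Jacobian,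
  and the numerators turn the \<open>exp_quot\<close> of each broken-off piece into exp - 1. The
  factor left over, \<open>exp_quot (remaining k u)\<close>, is read as an average over a fresh v,
  which resampling identifies with \<open>u k\<close>. What emerges is the event that piece k is the
  first one unhit, with everything from it on glued into one part.\<close>

lemma mixture_size_biased:
  assumes h: "h \<in> borel_measurable borel"
  shows "mixture m h = (\<Sum>k. \<integral>\<^sup>+u. ennreal (hit_prob k m (remaining (Suc k) u) u) *
    h (rearrange (fragments k u)) \<partial>uniform_seq)"
  unfolding mixture_def
proof (rule suminf_cong)
  fix k
  define \<phi> where "\<phi> x = ennreal (weight k m x) * h (rearrange x)" for x
  have m\<phi>: "\<phi> \<in> borel_measurable borel"
    unfolding \<phi>_def by (intro borel_measurable_times_ennreal measurable_compose[OF _ measurable_ennreal] measurable_weight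
        measurable_compose[OF measurable_rearrange h])
  have sym: "\<phi> (x \<circ> p) = \<phi> x" if "p permutes {..k}" for p x
    unfolding \<phi>_def weight_comp[OF that] rearrange_comp_bij[OF permutes_bij[OF that]] ..
  \<comment> \<open>v stands in for \<open>u k\<close>, on which neither the fragments nor the first
    k pieces depend; for v = \<open>u k\<close> the length in \<open>hit_prob\<close> becomes
    \<open>remaining (Suc k) u\<close>.\<close>
  define \<Phi> where "\<Phi> u v = ennreal (hit_prob k m ((1 - v) * remaining k u) u) * h (rearrange (fragments k u))" for u v
  have "ennreal (1 / fact (Suc k)) * simplex_integral k \<phi> =
     simplex_integral k (\<lambda>x. ennreal (\<Prod>i<k. x i / (\<Sum>l=i..k. x l)) * \<phi> x)"
  proof -
    have "ennreal (1 / fact (Suc k)) * ennreal (fact (Suc k)) = 1"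
      by (subst ennreal_mult[symmetric]) (auto simp del: fact_Suc)
    moreover have "simplex_integral k \<phi> = ennreal (fact (Suc k)) *
        simplex_integral k (\<lambda>x. ennreal (\<Prod>i<k. x i / (\<Sum>l=i..k. x l)) * \<phi> x)"
      by (rule simplex_integral_size_biased[OF m\<phi>]) (rule sym)
    ultimately show ?thesis by (simp only: mult.assoc[symmetric] mult_1)
  qed
  also have "\<dots> = (\<integral>\<^sup>+u. \<integral>\<^sup>+v. \<Phi> u v \<partial>unit_uniform \<partial>uniform_seq)"
    unfolding simplex_integral_def
  proof (rule nn_integral_cong_AE)
    show "AE u in uniform_seq. ennreal (\<Prod>j<k. remaining j u) *
        (ennreal (\<Prod>i<k. fragments k u i / (\<Sum>l=i..k. fragments k u l)) * \<phi> (fragments k u)) =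
        (\<integral>\<^sup>+v. \<Phi> u v \<partial>unit_uniform)"
      using AE_uniform_seq AE_remaining_pos
    proof eventually_elim
      case (elim u)
      have V: "0 \<le> stick_breaking u i" for i
        using elim by (simp add: stick_breaking_eq less_imp_le)
      define G where "G = (\<Prod>i<k. fps_exp (stick_breaking u i) - 1)"
      define H where "H = (\<Prod>i<k. exp_quot (stick_breaking u i)) * exp_quot (remaining k u)"
      have G: "0 \<le> fps_nth G n" for n
        unfolding G_def by (intro fps_nth_prod_nonneg fps_exp_minus_1_nonneg V)
      have H: "0 \<le> fps_nth H n" for n
        unfolding H_def using V elim by (intro fps_nth_mult_nonneg fps_nth_prod_nonneg exp_quot_nonneg) (auto simp: less_imp_le)
      have GH: "fps_const (\<Prod>i<k. stick_breaking u i) * H = G * exp_quot (remaining k u)"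
      proof -
        have "fps_const (\<Prod>i<k. stick_breaking u i) * (\<Prod>i<k. exp_quot (stick_breaking u i)) = G"
          unfolding G_def const_mult_exp_quot[symmetric] prod.distrib
          by (induction k) (simp_all add: fps_const_mult[symmetric] mult_ac del: fps_const_mult)
        then show ?thesis unfolding H_def by (simp add: mult.assoc[symmetric])
      qed
      have w: "weight k m (fragments k u) = fact m * fps_nth H (Suc m)"
        unfolding weight_def H_def lessThan_Suc_atMost[symmetric] by (simp add: fragments_def)
      have "(\<Prod>i<k. fragments k u i / (\<Sum>l=i..k. fragments k u l)) = (\<Prod>i<k. stick_breaking u i / remaining i u)"
        by (intro prod.cong refl) (simp add: sum_fragments, simp add: fragments_def)
      then have "ennreal (\<Prod>j<k. remaining j u) * (ennreal (\<Prod>i<k. fragments k u i / (\<Sum>l=i..k. fragments k u l)) * ennreal (weight k m (fragments k u)))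
        = ennreal ((\<Prod>j<k. remaining j u) * ((\<Prod>i<k. stick_breaking u i / remaining i u) * (fact m * fps_nth H (Suc m))))"
        unfolding w using elim V H
        by (simp add: ennreal_mult prod_nonneg less_imp_le)
      also have "(\<Prod>j<k. remaining j u) * ((\<Prod>i<k. stick_breaking u i / remaining i u) * (fact m * fps_nth H (Suc m))) =
         fact m * ((\<Prod>i<k. stick_breaking u i) * fps_nth H (Suc m))"
      proof -
        have "(\<Prod>j<k. remaining j u) \<noteq> 0" using elim by (auto simp: less_le)
        then show ?thesis by (simp add: prod_dividef)
      qed
      also have "(\<Prod>i<k. stick_breaking u i) * fps_nth H (Suc m) = fps_nth (G * exp_quot (remaining k u)) (Suc m)"
        unfolding GH[symmetric] by simp
      finally have 1: "ennreal (\<Prod>j<k. remaining j u) * (ennreal (\<Prod>i<k. fragments k u i / (\<Sum>l=i..k. fragments k u l)) * ennreal (weight k m (fragments k u)))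
        = ennreal (fact m * fps_nth (G * exp_quot (remaining k u)) (Suc m))" .
      have mG: "(\<lambda>v. ennreal (fps_nth (G * fps_exp ((1 - v) * remaining k u)) m)) \<in> borel_measurable unit_uniform"
        by (simp add: fps_mult_nth)
      have "(\<integral>\<^sup>+v. \<Phi> u v \<partial>unit_uniform) = (\<integral>\<^sup>+v. ennreal (fact m) * h (rearrange (fragments k u)) *
          ennreal (fps_nth (G * fps_exp ((1 - v) * remaining k u)) m) \<partial>unit_uniform)"
        unfolding \<Phi>_def hit_prob_def G_def[symmetric]
        by (intro nn_integral_cong) (simp add: ennreal_mult' mult_ac)
      also have "\<dots> = ennreal (fact m) * h (rearrange (fragments k u)) * ennreal (fps_nth (G * exp_quot (remaining k u)) (Suc m))"
        unfolding nn_integral_cmult[OF mG] using elim by (subst nn_integral_exp_complement[OF G]) (auto simp: less_imp_le)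
      also have "\<dots> = ennreal (fact m * fps_nth (G * exp_quot (remaining k u)) (Suc m)) * h (rearrange (fragments k u))"
        by (simp add: ennreal_mult' mult_ac)
      finally show ?case
        unfolding \<phi>_def 1[symmetric] by (simp only: mult.assoc)
    qed
  qed
  also have "\<dots> = (\<integral>\<^sup>+u. \<Phi> u (u k) \<partial>uniform_seq)"
  proof (rule nn_integral_resample_coordinate[symmetric])
    show "(\<lambda>p. \<Phi> (fst p) (snd p)) \<in> borel_measurable (borel \<Otimes>\<^sub>M borel)"
      unfolding \<Phi>_def
      by (intro borel_measurable_times_ennreal measurable_compose[OF _ measurable_ennreal] measurable_hit_prob
          borel_measurable_times borel_measurable_diff measurable_compose[OF measurable_fst measurable_remaining]
          measurable_compose[OF measurable_fst measurable_compose[OF measurable_fragments measurable_compose[OF measurable_rearrange h]]])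
        auto
    show "\<Phi> (u(k := a)) v = \<Phi> u v" for u v a
      unfolding \<Phi>_def hit_prob_def by (simp add: remaining_upd fragments_upd stick_breaking_upd)
  qed
  finally show "ennreal (1 / fact (Suc k)) * simplex_integral k (\<lambda>x. ennreal (weight k m x) * h (rearrange x)) =
     (\<integral>\<^sup>+u. ennreal (hit_prob k m (remaining (Suc k) u) u) * h (rearrange (fragments k u)) \<partial>uniform_seq)"
    unfolding \<phi>_def \<Phi>_def remaining_Suc .
qed

text \<open>If n + 1 entries of x are at least a, then the same entries of y are at least a - e.
  Hence \<open>rearrange\<close> is 1-Lipschitz in the supremum norm.\<close>

lemma rearrange_perturb:
  assumes x: "x \<longlonglongrightarrow> 0" and y: "y \<longlonglongrightarrow> 0" and nn: "\<And>i. 0 \<le> x i" "\<And>i. 0 \<le> y i"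
    and close: "\<And>i. \<bar>x i - y i\<bar> \<le> e"
  shows "\<bar>rearrange x n - rearrange y n\<bar> \<le> e"
proof -
  have *: "rearrange x n \<le> rearrange y n + e"
    if x: "x \<longlonglongrightarrow> 0" and y: "y \<longlonglongrightarrow> 0" and nn: "\<And>i. 0 \<le> y i" and close: "\<And>i. \<bar>x i - y i\<bar> \<le> e" for x y
  proof (rule ccontr)
    assume "\<not> ?thesis"
    then have gt: "rearrange y n < rearrange x n - e" by simp
    define t where "t = rearrange x n - e"
    have t: "0 < t" "0 < rearrange x n"
      using gt rearrange_nonneg[OF null_seq_bdd_above[OF y] nn, of n] close[of 0] by (auto simp: t_def)
    have "n < card {i. rearrange x n \<le> x i}" using le_rearrange_iff[OF x t(2), of n] by simp
    also have "\<dots> \<le> card {i. t \<le> y i}"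
    proof (rule card_mono[OF finite_level[OF y t(1)]])
      show "{i. rearrange x n \<le> x i} \<subseteq> {i. t \<le> y i}"
      proof safe
        fix i assume "rearrange x n \<le> x i"
        then show "t \<le> y i" using close[of i] by (simp add: t_def)
      qed
    qed
    finally have "t \<le> rearrange y n" using le_rearrange_iff[OF y t(1)] by simp
    with gt show False by (simp add: t_def)
  qed
  have close': "\<bar>y i - x i\<bar> \<le> e" for i using close[of i] by simp
  show ?thesis using *[OF x y nn(2) close] *[OF y x nn(1) close'] by simp
qed

lemma tendsto_seq_coordinatewise:
  fixes f :: "'a \<Rightarrow> nat \<Rightarrow> real"
  assumes "\<And>i. ((\<lambda>c. f c i) \<longlongrightarrow> l i) F"
  shows "(f \<longlongrightarrow> l) F"
proof -
  have "limitin (product_topology (\<lambda>i. euclidean) UNIV) f l F"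
    unfolding limitin_componentwise using assms by simp
  then show ?thesis by (simp add: euclidean_product_topology)
qed

text \<open>No entry of \<open>fragments k u\<close> differs from that of
  \<open>stick_breaking u\<close> by more than \<open>remaining k u\<close>, and this length tends
  to 0.\<close>

lemma rearrange_fragments_tendsto:
  assumes u: "\<And>i. 0 < u i \<and> u i < 1" and S: "rearrange (stick_breaking u) \<in> Sigma1"
  shows "(\<lambda>k. rearrange (fragments k u)) \<longlonglongrightarrow> rearrange (stick_breaking u)"
proof -
  have rem: "0 < remaining j u" for j
    unfolding remaining_def using u by (intro prod_pos) auto
  have V: "0 < stick_breaking u i" for i
    using u rem by (simp add: stick_breaking_eq)
  have sumV: "(\<Sum>i<n. stick_breaking u i) = 1 - remaining n u" for n
    by (simp add: stick_breaking_sum remaining_def)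
  have "summable (stick_breaking u)"
    using V rem sumV by (intro summableI_nonneg_bounded[where x = 1]) (auto simp: less_imp_le)
  then have V0: "stick_breaking u \<longlonglongrightarrow> 0" by (rule summable_LIMSEQ_zero)
  have Vnn: "0 \<le> stick_breaking u i" for i using V[of i] by simp
  \<comment> \<open>That nothing of the stick is left in the limit does not follow from 0 < u_i < 1
    alone. It is recovered from \<open>S\<close>, since rearranging preserves the sum.\<close>
  have R: "0 \<le> rearrange (stick_breaking u) i" "rearrange (stick_breaking u) sums 1" for i
    using S by (simp_all add: Sigma1_def)
  have "(\<Sum>i. ennreal (stick_breaking u i)) = 1"
    using iffD1[OF sums_1_iff[OF R(1)] R(2)] suminf_rearrange[OF V0 Vnn] by simp
  then have "stick_breaking u sums 1"
    by (rule iffD2[OF sums_1_iff[OF Vnn]])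
  then have "(\<lambda>n. 1 - (\<Sum>i<n. stick_breaking u i)) \<longlonglongrightarrow> 1 - 1"
    unfolding sums_def by (intro tendsto_diff tendsto_const)
  then have rem0: "(\<lambda>n. remaining n u) \<longlonglongrightarrow> 0" by (simp add: sumV)
  have le: "stick_breaking u i \<le> remaining k u" if "k \<le> i" for i k
  proof -
    have "remaining (Suc j) u \<le> remaining j u" for j using V[of j] by (simp add: remaining_diff)
    then have "remaining i u \<le> remaining k u" using that by (rule lift_Suc_antimono_le)
    moreover have "stick_breaking u i \<le> remaining i u"
      using rem[of "Suc i"] by (simp add: remaining_diff)
    ultimately show ?thesis by simp
  qed
  have frag: "fragments k u \<longlonglongrightarrow> 0" for k
  proof (rule tendsto_eventually)
    show "eventually (\<lambda>n. fragments k u n = 0) sequentially"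
      using eventually_gt_at_top[of k] by eventually_elim (simp add: fragments_def)
  qed
  have close: "\<bar>fragments k u i - stick_breaking u i\<bar> \<le> remaining k u" for k i
    using V[of i] rem[of k] le[of k i] by (cases "i < k"; cases "i = k") (auto simp: fragments_def)
  show ?thesis
  proof (rule tendsto_seq_coordinatewise)
    fix n
    have "\<bar>rearrange (fragments k u) n - rearrange (stick_breaking u) n\<bar> \<le> remaining k u" for k
      using V rem by (intro rearrange_perturb frag V0 close) (auto simp: fragments_def less_imp_le)
    then have "(\<lambda>k. rearrange (fragments k u) n - rearrange (stick_breaking u) n) \<longlonglongrightarrow> 0"
      by (intro Lim_null_comparison[OF _ rem0]) auto
    then show "(\<lambda>k. rearrange (fragments k u) n) \<longlonglongrightarrow> rearrange (stick_breaking u) n"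
      by (rule LIM_zero_cancel)
  qed
qed

text \<open>A Toeplitz argument: the weights leave every finite set of indices, so only the tail of
  \<open>a\<close> counts.\<close>

lemma weighted_average_tendsto:
  fixes d :: "nat \<Rightarrow> nat \<Rightarrow> real"
  assumes d: "\<And>k m. 0 \<le> d k m" and one: "\<And>m. (\<Sum>k\<le>m. d k m) = 1"
    and d0: "\<And>k. (\<lambda>m. d k m) \<longlonglongrightarrow> 0" and a: "a \<longlonglongrightarrow> l"
  shows "(\<lambda>m. \<Sum>k\<le>m. d k m * a k) \<longlonglongrightarrow> (l :: real)"
proof (rule LIMSEQ_I)
  fix e :: real assume e: "0 < e"
  obtain K where K: "\<And>k. k \<ge> K \<Longrightarrow> \<bar>a k - l\<bar> < e / 2"
    using LIMSEQ_D[OF a, of "e / 2"] e by auto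
  have "(\<lambda>m. \<Sum>k<K. d k m * \<bar>a k - l\<bar>) \<longlonglongrightarrow> (\<Sum>k<K. 0 * \<bar>a k - l\<bar>)"
    by (intro tendsto_sum tendsto_mult d0 tendsto_const)
  then have "(\<lambda>m. \<Sum>k<K. d k m * \<bar>a k - l\<bar>) \<longlonglongrightarrow> 0" by simp
  from LIMSEQ_D[OF this, of "e / 2"] e
  obtain M where M: "\<And>m. m \<ge> M \<Longrightarrow> \<bar>\<Sum>k<K. d k m * \<bar>a k - l\<bar>\<bar> < e / 2" by auto
  show "\<exists>no. \<forall>m\<ge>no. norm ((\<Sum>k\<le>m. d k m * a k) - l) < e"
  proof (intro exI allI impI)
    fix m assume m: "max K M \<le> m"
    have "(\<Sum>k\<le>m. d k m * a k) - l = (\<Sum>k\<le>m. d k m * a k) - (\<Sum>k\<le>m. d k m) * l"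
      by (simp add: one)
    also have "\<dots> = (\<Sum>k\<le>m. d k m * (a k - l))"
      by (simp add: sum_distrib_right sum_subtractf right_diff_distrib)
    finally have "\<bar>(\<Sum>k\<le>m. d k m * a k) - l\<bar> \<le> (\<Sum>k\<le>m. d k m * \<bar>a k - l\<bar>)"
      using sum_abs[of "\<lambda>k. d k m * (a k - l)" "{..m}"] d by (simp add: abs_mult)
    also have "{..m} = {..<K} \<union> {K..m}" using m by auto
    then have "(\<Sum>k\<le>m. d k m * \<bar>a k - l\<bar>) = (\<Sum>k<K. d k m * \<bar>a k - l\<bar>) + (\<Sum>k=K..m. d k m * \<bar>a k - l\<bar>)"
      by (simp only:) (rule sum.union_disjoint; auto)
    also have "(\<Sum>k=K..m. d k m * \<bar>a k - l\<bar>) \<le> (\<Sum>k=K..m. d k m * (e / 2))"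
      using K d by (intro sum_mono mult_left_mono) (auto simp: less_imp_le)
    also have "\<dots> \<le> (\<Sum>k\<le>m. d k m * (e / 2))"
      using d e by (intro sum_mono2) auto
    also have "\<dots> = e / 2"
      unfolding sum_distrib_right[symmetric] one by simp
    finally show "norm ((\<Sum>k\<le>m. d k m * a k) - l) < e"
      using M[of m] m by simp
  qed
qed

section \<open>Passage to the limit\<close>

lemma integral_iterate_tendsto:
  fixes g :: "(nat \<Rightarrow> real) \<Rightarrow> real"
  assumes g [measurable]: "g \<in> borel_measurable borel"
    and cont: "continuous_on Sigma1 g" and nn: "\<And>x. 0 \<le> g x" and bound: "\<And>x. g x \<le> B"
  shows "(\<lambda>m. \<integral>x. g x \<partial>(half_sum (\<lambda>\<nu>. \<nu>) split_merge ^^ m) nu0) \<longlonglongrightarrow>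
    (\<integral>u. g (rearrange (stick_breaking u)) \<partial>uniform_seq)"
proof -
  interpret U: prob_space uniform_seq by (rule prob_space_uniform_seq)
  define d where "d k m u = hit_prob k m (remaining (Suc k) u) u" for k m u
  \<comment> \<open>The mean of \<open>g\<close> over the position of the first unhit piece, for a
    fixed stick u.\<close>
  define s where "s m u = (\<Sum>k\<le>m. d k m u * g (rearrange (fragments k u)))" for m u
  have md: "d k m \<in> borel_measurable borel" for k m
    unfolding d_def by (rule measurable_hit_prob) auto
  have mg: "(\<lambda>u. g (rearrange (fragments k u))) \<in> borel_measurable borel" for k
    by (rule measurable_compose[OF measurable_fragments measurable_compose[OF measurable_rearrange g]])
  have toU: "f \<in> borel_measurable uniform_seq" if "f \<in> borel_measurable borel" for f :: "(nat \<Rightarrow> real) \<Rightarrow> real"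
    using that by (simp cong: measurable_cong_sets add: sets_uniform_seq)
  have ms: "s m \<in> borel_measurable uniform_seq" for m
    unfolding s_def by (intro toU borel_measurable_sum borel_measurable_times md mg)
  have dnn: "0 \<le> d k m u" if "\<forall>i. 0 < u i \<and> u i < 1" for k m u
  proof -
    have "0 < remaining j u" for j
      unfolding remaining_def using that by (intro prod_pos) auto
    then show ?thesis
      unfolding d_def using that by (intro hit_prob_nonneg) (auto simp: stick_breaking_eq less_imp_le)
  qed
  have snn: "AE u in uniform_seq. 0 \<le> s m u" for m
    using AE_uniform_seq by eventually_elim (auto simp: s_def intro!: sum_nonneg mult_nonneg_nonneg dnn nn)
  have iterate: "(\<integral>x. g x \<partial>(half_sum (\<lambda>\<nu>. \<nu>) split_merge ^^ m) nu0) = (\<integral>u. s m u \<partial>uniform_seq)" for m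
  proof -
    define \<nu> where "\<nu> = (half_sum (\<lambda>\<nu>. \<nu>) split_merge ^^ m) nu0"
    have "\<nu> \<in> space (prob_algebra borel_Sigma1)" unfolding \<nu>_def by (rule iterates_in_prob_algebra)
    then have sets: "sets \<nu> = sets borel_Sigma1" by (simp add: space_prob_algebra)
    have "g \<in> borel_measurable borel_Sigma1"
      unfolding borel_Sigma1_def by (rule measurable_restrict_space1) simp
    then have "g \<in> borel_measurable \<nu>" using sets by (simp cong: measurable_cong_sets)
    then have "(\<integral>x. g x \<partial>\<nu>) = enn2real (\<integral>\<^sup>+x. ennreal (g x) \<partial>\<nu>)"
      using nn by (intro integral_eq_nn_integral) auto
    also have "(\<integral>\<^sup>+x. ennreal (g x) \<partial>\<nu>) = mixture m (\<lambda>x. ennreal (g x))"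
      unfolding \<nu>_def by (rule nn_integral_iterate) measurable
    also have "\<dots> = (\<Sum>k. \<integral>\<^sup>+u. ennreal (d k m u) * ennreal (g (rearrange (fragments k u))) \<partial>uniform_seq)"
      unfolding d_def by (rule mixture_size_biased) measurable
    also have "\<dots> = (\<Sum>k\<le>m. \<integral>\<^sup>+u. ennreal (d k m u) * ennreal (g (rearrange (fragments k u))) \<partial>uniform_seq)"
      by (rule suminf_finite) (auto simp: d_def hit_prob_eq_0)
    also have "\<dots> = (\<integral>\<^sup>+u. (\<Sum>k\<le>m. ennreal (d k m u) * ennreal (g (rearrange (fragments k u)))) \<partial>uniform_seq)"
      by (rule nn_integral_sum[symmetric])
        (intro borel_measurable_times_ennreal measurable_compose[OF _ measurable_ennreal] toU md mg)
    also have "\<dots> = (\<integral>\<^sup>+u. ennreal (s m u) \<partial>uniform_seq)"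
    proof (rule nn_integral_cong_AE)
      show "AE u in uniform_seq. (\<Sum>k\<le>m. ennreal (d k m u) * ennreal (g (rearrange (fragments k u)))) = ennreal (s m u)"
        using AE_uniform_seq
      proof eventually_elim
        case (elim u)
        have "(\<Sum>k\<le>m. ennreal (d k m u) * ennreal (g (rearrange (fragments k u)))) =
            (\<Sum>k\<le>m. ennreal (d k m u * g (rearrange (fragments k u))))"
          by (intro sum.cong refl ennreal_mult[symmetric] dnn elim nn)
        also have "\<dots> = ennreal (s m u)"
          unfolding s_def by (intro sum_ennreal mult_nonneg_nonneg dnn elim nn)
        finally show ?case .
      qed
    qed
    also have "enn2real (\<integral>\<^sup>+u. ennreal (s m u) \<partial>uniform_seq) = (\<integral>u. s m u \<partial>uniform_seq)"
      by (rule integral_eq_nn_integral[symmetric, OF ms snn])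
    finally show ?thesis unfolding \<nu>_def .
  qed
  have fragments: "AE u in uniform_seq. \<forall>k. fragments k u \<in> open_simplex k"
    by (simp add: AE_all_countable AE_fragments)
  have lim: "AE u in uniform_seq. (\<lambda>m. s m u) \<longlonglongrightarrow> g (rearrange (stick_breaking u))"
    using AE_uniform_seq AE_stick_breaking fragments
  proof eventually_elim
    case (elim u)
    have "(\<lambda>k. g (rearrange (fragments k u))) \<longlonglongrightarrow> g (rearrange (stick_breaking u))"
      using elim rearrange_open_simplex_in_Sigma1
      by (intro continuous_on_tendsto_compose[OF cont rearrange_fragments_tendsto] always_eventually allI) auto
    moreover have "(\<Sum>k\<le>m. d k m u) = 1" for m unfolding d_def by (rule sum_hit_prob)
    moreover have "(\<lambda>m. d k m u) \<longlonglongrightarrow> 0" for k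
      unfolding d_def using elim by (intro hit_prob_tendsto_0) auto
    ultimately show ?case
      unfolding s_def by (intro weighted_average_tendsto[of "\<lambda>k m. d k m u"] dnn elim) auto
  qed
  have bd: "AE u in uniform_seq. norm (s m u) \<le> B" for m
    using AE_uniform_seq
  proof eventually_elim
    case (elim u)
    have "s m u \<le> (\<Sum>k\<le>m. d k m u * B)"
      unfolding s_def by (intro sum_mono mult_left_mono bound dnn elim)
    also have "\<dots> = B" unfolding sum_distrib_right[symmetric] d_def sum_hit_prob by simp
    finally have "s m u \<le> B" .
    moreover have "0 \<le> s m u" unfolding s_def by (intro sum_nonneg mult_nonneg_nonneg dnn elim nn)
    ultimately show ?case by simp
  qed
  have mR: "(\<lambda>u. g (rearrange (stick_breaking u))) \<in> borel_measurable uniform_seq"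
    by (rule toU) measurable
  show ?thesis
    unfolding iterate
    by (rule integral_dominated_convergence[OF mR ms _ lim bd]) simp
qed

theorem theorem1:
  shows "weakly_converges_on Sigma1 (\<lambda>m. (half_sum (\<lambda>\<nu>. \<nu>) split_merge ^^ m) nu0) PD1"
  unfolding weakly_converges_on_def
proof (intro allI impI, elim conjE)
  fix f :: "(nat \<Rightarrow> real) \<Rightarrow> real"
  assume cont: "continuous_on Sigma1 f" and bdd: "bounded (f ` Sigma1)"
  interpret U: prob_space uniform_seq by (rule prob_space_uniform_seq)
  obtain C where C: "\<And>x. x \<in> Sigma1 \<Longrightarrow> \<bar>f x\<bar> \<le> C"
    using bdd by (auto simp: bounded_iff)
  \<comment> \<open>Extension by zero gives a measurable function on all sequences. Adding a bound
    then makes it nonnegative, as integration through \<open>mixture\<close> requires.\<close>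
  define F where "F x = indicator Sigma1 x *\<^sub>R f x" for x
  have "f \<in> borel_measurable (restrict_space borel Sigma1)"
    by (rule borel_measurable_continuous_on_restrict[OF cont])
  then have F [measurable]: "F \<in> borel_measurable borel"
    unfolding F_def using borel_measurable_restrict_space_iff[of Sigma1 borel f] by (simp add: mult.commute)
  \<comment> \<open>The absolute value ensures that the bound also covers the value zero outside
    \<open>Sigma1\<close>.\<close>
  define D where "D = \<bar>C\<bar>"
  have FD: "\<bar>F x\<bar> \<le> D" for x
    using C[of x] by (auto simp: F_def D_def indicator_def)
  have shift: "(\<integral>x. F (T x) + D \<partial>M) = (\<integral>x. F (T x) \<partial>M) + D"
    if "prob_space M" and "(\<lambda>x. F (T x)) \<in> borel_measurable M" for M :: "'c measure" and T
  proof -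
    interpret prob_space M by fact
    have "integrable M (\<lambda>x. F (T x))"
      using that(2) FD by (intro integrable_const_bound[of _ D]) auto
    then show ?thesis by (simp add: prob_space)
  qed
  let ?\<nu> = "\<lambda>m. (half_sum (\<lambda>\<nu>. \<nu>) split_merge ^^ m) nu0"
  have "(\<lambda>m. \<integral>x. F x + D \<partial>?\<nu> m) \<longlonglongrightarrow> (\<integral>u. F (rearrange (stick_breaking u)) + D \<partial>uniform_seq)"
  proof (rule integral_iterate_tendsto)
    have "continuous_on Sigma1 F \<longleftrightarrow> continuous_on Sigma1 f"
      by (rule continuous_on_cong) (auto simp: F_def)
    then show "continuous_on Sigma1 (\<lambda>x. F x + D)"
      using cont by (intro continuous_on_add continuous_on_const) simp
    show "0 \<le> F x + D" "F x + D \<le> 2 * D" for x using FD[of x] by auto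
  qed measurable
  moreover have "(\<integral>x. F x + D \<partial>?\<nu> m) = (\<integral>x. f x \<partial>?\<nu> m) + D" for m
  proof -
    have \<nu>: "prob_space (?\<nu> m)" "sets (?\<nu> m) = sets borel_Sigma1"
      using iterates_in_prob_algebra[of m] by (auto simp: space_prob_algebra)
    have "F \<in> borel_measurable borel_Sigma1"
      unfolding borel_Sigma1_def by (rule measurable_restrict_space1) simp
    then have "F \<in> borel_measurable (?\<nu> m)" using \<nu>(2) by (simp cong: measurable_cong_sets)
    from shift[OF \<nu>(1), of "\<lambda>x. x"] this
    have "(\<integral>x. F x + D \<partial>?\<nu> m) = (\<integral>x. F x \<partial>?\<nu> m) + D" by simp
    also have "(\<integral>x. F x \<partial>?\<nu> m) = (\<integral>x. f x \<partial>?\<nu> m)"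
      using sets_eq_imp_space_eq[OF \<nu>(2)] by (intro Bochner_Integration.integral_cong) (auto simp: F_def)
    finally show ?thesis .
  qed
  moreover have "(\<integral>u. F (rearrange (stick_breaking u)) + D \<partial>uniform_seq) = (\<integral>x. f x \<partial>PD1) + D"
  proof -
    have R: "(\<lambda>u. rearrange (stick_breaking u)) \<in> uniform_seq \<rightarrow>\<^sub>M borel" by measurable
    have "(\<integral>u. F (rearrange (stick_breaking u)) + D \<partial>uniform_seq) = (\<integral>u. F (rearrange (stick_breaking u)) \<partial>uniform_seq) + D"
      by (rule shift[OF prob_space_uniform_seq measurable_compose[OF R F]])
    also have "(\<integral>u. F (rearrange (stick_breaking u)) \<partial>uniform_seq) =
        (\<integral>x. F x \<partial>distr uniform_seq borel (\<lambda>u. rearrange (stick_breaking u)))"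
      by (rule integral_distr[symmetric, OF R F])
    also have "\<dots> = (\<integral>x. f x \<partial>PD1)"
      unfolding PD1_def F_def by (rule integral_restrict_space[symmetric]) simp
    finally show ?thesis .
  qed
  ultimately have "(\<lambda>m. (\<integral>x. f x \<partial>?\<nu> m) + D) \<longlonglongrightarrow> (\<integral>x. f x \<partial>PD1) + D" by simp
  from tendsto_diff[OF this tendsto_const[of D]]
  show "(\<lambda>m. \<integral>x. f x \<partial>?\<nu> m) \<longlonglongrightarrow> (\<integral>x. f x \<partial>PD1)" by simp
qed

end
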